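(* Let $V=\mathbb{C}^n$, let $G$ be a finite subgroup of $GL(V)$, let $\alpha:G\times G\rightarrow\mathbb{C}^{\times}$ be a normalized two-cocycle, let $g\in G\setminus\{1\}$, and let $a_g: V\times V\to\mathbb{C}$ be a skew-symmetric bilinear form. Then the following are equivalent: (i) $a_g\neq 0$, and there is a twisted graded Hecke algebra $A$ (for $G$ and $\alpha$) defined by a family of skew-symmetric bilinear forms on $V$ indexed by $G$ whose member at the index $g$ is the given form $a_g$; (ii) $\ker a_g=V^g$, $\operatorname{codim}(V^g)=2$, and $$\det(h^{\perp})=\alpha(h,g)\,\alpha(g,h)^{-1}$$ for all $h\in C(g)=\{h\in G\mid hg=gh\}$.
   Context: All algebras and vector spaces are over $\mathbb{C}$. A two-cocycle is a function $\alpha:G\times G\to\mathbb{C}^\times$ with $\alpha(g,h)\alpha(gh,k)=\alpha(h,k)\alpha(g,hk)$ for all $g,h,k\in G$; it is normalized if $\alpha(1,g)=\alpha(g,1)=1$ for all $g\in G$. If $S$ is an associative $\mathbb{C}$-algebra with an action of $G$ by algebra automorphisms, the crossed product algebra $S\#_{\alpha}G$ is the vector space $S\otimes\mathbb{C}G$ with multiplication $(r\otimes g)(s\otimes h)=\alpha(g,h)\,r(g\cdot s)\otimes gh$ for $r,s\in S$, $g,h\in G$; write $s\overline{g}$ for $s\otimes g$. The action of $G$ on $V$ induces actions on the tensor algebra $T(V)$ and the symmetric algebra $S(V)$. Let $t$ be an indeterminate and write $S\#_\alpha G[t]=\mathbb{C}[t]\otimes(S\#_\alpha G)$. Given skew-symmetric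 bilinear forms $a_g:V\times V\to\mathbb{C}$ (one for each $g\in G$, possibly $0$), let $A$ be the quotient of $T(V)\#_\alpha G[t]$ by the two-sided ideal generated by all elements $$vw-wv-\sum_{g\in G}a_g(v,w)\,t\,\overline{g}\qquad (v,w\in V).$$ A choice of linear section $S(V)\hookrightarrow T(V)$ of the canonical projection $T(V)\to S(V)$ that preserves the grading (for example, writing monomials in the order $v_1^{i_1}\cdots v_n^{i_n}$ for a basis $v_1,\dots,v_n$ of $V$) induces a surjective $\mathbb{C}[t]$-linear map $S(V)\#_\alpha G[t]\to A$. One says $A$ is a twisted graded Hecke algebra (for $G$ and $\alpha$, defined by the forms $\{a_g\}_{g\in G}$) if this map is an isomorphism of $\mathbb{C}[t]$-modules. Equivalently, giving elements of $V$ degree 1 and elements of $G$ (and $t$) degree 0, $A$ is a filtered algebra over $\mathbb{C}[t]$, and it is a twisted graded Hecke algebra when the canonical surjection $S(V)\#_\alpha G[t]\to\operatorname{gr}A$ is an isomorphism. For a skew-symmetric form $a$ on $V$, $\ker a=\{v\in V\mid a(v,w)=0\text{ for all }w\in V\}$. Fix a $G$-invariant nondegenerate Hermitian form on $V$; orthogonal complements are taken with respect to it. For $g\in G$, $V^g=\{v\in V\mid g\cdot v=v\}$. One has $(V^g)^\perp=\operatorname{im}(g-1)$ and $V=V^g\oplus (V^g)^\perp$. For $h\in G$ (with $g$ fixed), $h^{\perp}:(V^g)^{\perp}\to(V^g)^{\perp}$ is the composition of the restriction $h:(V^g)^\perp\to V$, the quotient map $V\to V/V^g$, and the natural isomorphism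 $V/V^g\cong(V^g)^\perp$ (i.e. $h$ restricted to $(V^g)^\perp$ followed by projection onto $(V^g)^\perp$ along $V^g$). *)

theory Defs
  imports
    "HOL-Analysis.Analysis"
    "HOL-Algebra.QuotRing"
    "HOL-Algebra.UnivPoly"
    "HOL-Combinatorics.Permutations"
begin

text \<open>
  \<open>V = \<complex>\<^sup>n\<close> is the type \<open>complex ^ 'n\<close> with \<open>n = CARD('n)\<close>. Algebras over a ring of scalars are
  \<^type>\<open>module\<close> records (a ring together with a scalar multiplication); the scalars are
  either \<open>complex\<close> or \<open>complex poly\<close>, the latter in the role of \<open>\<complex>[t]\<close>.
\<close>

section \<open>Groups of matrices and two-cocycles\<close>

definition GL :: "(complex ^ 'n ^ 'n) monoid" where
  "GL = \<lparr>carrier = {A. invertible A}, mult = (**), one = mat 1\<rparr>"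

definition normalized_two_cocycle :: "('g, 'm) monoid_scheme \<Rightarrow> ('g \<Rightarrow> 'g \<Rightarrow> complex) \<Rightarrow> bool" where
  "normalized_two_cocycle K \<alpha> \<longleftrightarrow>
     (\<forall>g \<in> carrier K. \<forall>h \<in> carrier K. \<alpha> g h \<noteq> 0) \<and>
     (\<forall>g \<in> carrier K. \<forall>h \<in> carrier K. \<forall>k \<in> carrier K.
        \<alpha> g h * \<alpha> (g \<otimes>\<^bsub>K\<^esub> h) k = \<alpha> h k * \<alpha> g (h \<otimes>\<^bsub>K\<^esub> k)) \<and>
     (\<forall>g \<in> carrier K. \<alpha> \<one>\<^bsub>K\<^esub> g = 1 \<and> \<alpha> g \<one>\<^bsub>K\<^esub> = 1)"

section \<open>General constructions on algebras\<close>

definition quotient_algebra :: "('c, 'b) module \<Rightarrow> 'b set \<Rightarrow> ('c, 'b set) module" where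
  "quotient_algebra M I =
     \<lparr>carrier = carrier (M Quot I), mult = mult (M Quot I), one = one (M Quot I),
      zero = zero (M Quot I), add = add (M Quot I),
      smult = (\<lambda>c X. \<Union>x\<in>X. I +>\<^bsub>M\<^esub> (c \<odot>\<^bsub>M\<^esub> x))\<rparr>"

text \<open>
  An element of \<open>S #\<^sub>\<alpha> G = S \<otimes> \<complex>G\<close> is the family of its coefficients: \<open>x\<close> stands for
  the sum of the \<open>x g \<otimes> g\<close>. The function \<open>act\<close> is the action of the group \<open>K\<close> on \<open>S\<close>.
\<close>

definition crossed_product ::
  "('g, 'm) monoid_scheme \<Rightarrow> ('g \<Rightarrow> 'g \<Rightarrow> complex) \<Rightarrow> ('g \<Rightarrow> 's \<Rightarrow> 's) \<Rightarrow> (complex, 's) module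
     \<Rightarrow> (complex, 'g \<Rightarrow> 's) module" where
  "crossed_product K \<alpha> act S =
     \<lparr>carrier = carrier K \<rightarrow>\<^sub>E carrier S,
      mult = (\<lambda>x y. \<lambda>k\<in>carrier K.
        \<Oplus>\<^bsub>S\<^esub>p \<in> {(g, h). g \<in> carrier K \<and> h \<in> carrier K \<and> g \<otimes>\<^bsub>K\<^esub> h = k}.
          \<alpha> (fst p) (snd p) \<odot>\<^bsub>S\<^esub> (x (fst p) \<otimes>\<^bsub>S\<^esub> act (fst p) (y (snd p)))),
      one = (\<lambda>k\<in>carrier K. if k = \<one>\<^bsub>K\<^esub> then \<one>\<^bsub>S\<^esub> else \<zero>\<^bsub>S\<^esub>),
      zero = (\<lambda>k\<in>carrier K. \<zero>\<^bsub>S\<^esub>),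
      add = (\<lambda>x y. \<lambda>k\<in>carrier K. x k \<oplus>\<^bsub>S\<^esub> y k),
      smult = (\<lambda>c x. \<lambda>k\<in>carrier K. c \<odot>\<^bsub>S\<^esub> x k)\<rparr>"

definition pure_tensor :: "('g, 'm) monoid_scheme \<Rightarrow> (complex, 's) module \<Rightarrow> 's \<Rightarrow> 'g \<Rightarrow> 'g \<Rightarrow> 's" where
  "pure_tensor K S s g = (\<lambda>k\<in>carrier K. if k = g then s else \<zero>\<^bsub>S\<^esub>)"

text \<open>
  \<open>R[t] = \<complex>[t] \<otimes> R\<close>: polynomials in a central indeterminate with coefficients in the (not
  necessarily commutative) algebra \<open>R\<close>. The scalar multiplication of \<^const>\<open>UP\<close> is by
  elements of \<open>R\<close> and is replaced by the one by \<open>\<complex>[t]\<close>.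
\<close>

definition poly_algebra :: "(complex, 'r) module \<Rightarrow> (complex poly, nat \<Rightarrow> 'r) module" where
  "poly_algebra R =
     \<lparr>carrier = carrier (UP R), mult = mult (UP R), one = one (UP R),
      zero = zero (UP R), add = add (UP R),
      smult = (\<lambda>p x n. \<Oplus>\<^bsub>R\<^esub>i \<in> {..n}. Polynomial.coeff p i \<odot>\<^bsub>R\<^esub> x (n - i))\<rparr>"

definition module_homs :: "('c, 'a) module \<Rightarrow> ('c, 'b) module \<Rightarrow> ('a \<Rightarrow> 'b) set" where
  "module_homs M N = {\<phi>. \<phi> \<in> carrier M \<rightarrow> carrier N \<and>
     (\<forall>x \<in> carrier M. \<forall>y \<in> carrier M. \<phi> (x \<oplus>\<^bsub>M\<^esub> y) = \<phi> x \<oplus>\<^bsub>N\<^esub> \<phi> y) \<and>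
     (\<forall>c. \<forall>x \<in> carrier M. \<phi> (c \<odot>\<^bsub>M\<^esub> x) = c \<odot>\<^bsub>N\<^esub> \<phi> x)}"

definition module_isos :: "('c, 'a) module \<Rightarrow> ('c, 'b) module \<Rightarrow> ('a \<Rightarrow> 'b) set" where
  "module_isos M N = {\<phi> \<in> module_homs M N. bij_betw \<phi> (carrier M) (carrier N)}"

section \<open>Tensor and symmetric algebra of \<open>V\<close>\<close>

text \<open>
  A tensor is given by its coordinates in the standard basis: \<open>f w\<close> is the coefficient of
  \<open>e\<^bsub>w!0\<^esub> \<otimes> e\<^bsub>w!1\<^esub> \<otimes> \<dots>\<close>, and words of length \<open>k\<close> index the coordinates of
  \<open>V\<^bsup>\<otimes>k\<^esup>\<close>. The product is the tensor product (concatenation of words).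
\<close>

definition tensor_algebra :: "(complex, 'n::finite list \<Rightarrow> complex) module" where
  "tensor_algebra =
     \<lparr>carrier = {f. finite {w. f w \<noteq> 0}},
      mult = (\<lambda>f f' w. \<Sum>i\<le>length w. f (take i w) * f' (drop i w)),
      one = (\<lambda>w. if w = [] then 1 else 0),
      zero = (\<lambda>w. 0),
      add = (\<lambda>f f' w. f w + f' w),
      smult = (\<lambda>c f w. c * f w)\<rparr>"

definition tensor_vec :: "complex ^ 'n \<Rightarrow> 'n::finite list \<Rightarrow> complex" where
  "tensor_vec v = (\<lambda>w. case w of [i] \<Rightarrow> v $ i | _ \<Rightarrow> 0)"

text \<open>The diagonal action \<open>v\<^sub>1 \<otimes> \<dots> \<otimes> v\<^sub>k \<mapsto> h v\<^sub>1 \<otimes> \<dots> \<otimes> h v\<^sub>k\<close> in coordinates.\<close>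

definition tensor_act ::
  "complex ^ 'n ^ 'n \<Rightarrow> ('n::finite list \<Rightarrow> complex) \<Rightarrow> 'n list \<Rightarrow> complex" where
  "tensor_act h f w = (\<Sum>u | length u = length w. (\<Prod>i<length w. h $ (w ! i) $ (u ! i)) * f u)"

definition tensor_degree :: "nat \<Rightarrow> ('n::finite list \<Rightarrow> complex) set" where
  "tensor_degree k = {f \<in> carrier tensor_algebra. \<forall>w. f w \<noteq> 0 \<longrightarrow> length w = k}"

definition sym_ideal :: "('n::finite list \<Rightarrow> complex) set" where
  "sym_ideal = Idl\<^bsub>tensor_algebra\<^esub>
     {tensor_vec v \<otimes>\<^bsub>tensor_algebra\<^esub> tensor_vec w
        \<ominus>\<^bsub>tensor_algebra\<^esub> tensor_vec w \<otimes>\<^bsub>tensor_algebra\<^esub> tensor_vec v | v w. True}"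

definition sym_algebra :: "(complex, ('n::finite list \<Rightarrow> complex) set) module" where
  "sym_algebra = quotient_algebra tensor_algebra sym_ideal"

definition sym_proj :: "('n::finite list \<Rightarrow> complex) \<Rightarrow> ('n list \<Rightarrow> complex) set" where
  "sym_proj f = sym_ideal +>\<^bsub>tensor_algebra\<^esub> f"

text \<open>
  The induced action on \<open>S(V)\<close>: an invertible \<open>h\<close> preserves the ideal, hence maps the coset
  of \<open>f\<close> onto the coset of \<open>h \<cdot> f\<close>.
\<close>

definition sym_act ::
  "complex ^ 'n ^ 'n \<Rightarrow> ('n::finite list \<Rightarrow> complex) set \<Rightarrow> ('n list \<Rightarrow> complex) set" where
  "sym_act h X = tensor_act h ` X"

definition graded_section :: "(('n::finite list \<Rightarrow> complex) set \<Rightarrow> 'n list \<Rightarrow> complex) \<Rightarrow> bool" where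
  "graded_section \<sigma> \<longleftrightarrow>
     \<sigma> \<in> module_homs sym_algebra tensor_algebra \<and>
     (\<forall>X \<in> carrier sym_algebra. sym_proj (\<sigma> X) = X) \<and>
     (\<forall>k. \<sigma> ` (sym_proj ` tensor_degree k) \<subseteq> tensor_degree k)"

section \<open>Twisted graded Hecke algebras\<close>

definition skew_bilinear_form :: "(complex ^ 'n \<Rightarrow> complex ^ 'n \<Rightarrow> complex) \<Rightarrow> bool" where
  "skew_bilinear_form a \<longleftrightarrow>
     (\<forall>v. Vector_Spaces.linear (*s) (*) (\<lambda>w. a v w)) \<and>
     (\<forall>w. Vector_Spaces.linear (*s) (*) (\<lambda>v. a v w)) \<and>
     (\<forall>v w. a v w = - a w v)"

definition tensor_crossed ::
  "(complex ^ 'n ^ 'n) set \<Rightarrow> (complex ^ 'n ^ 'n \<Rightarrow> complex ^ 'n ^ 'n \<Rightarrow> complex)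
     \<Rightarrow> (complex, complex ^ 'n ^ 'n \<Rightarrow> 'n::finite list \<Rightarrow> complex) module" where
  "tensor_crossed G \<alpha> = crossed_product (GL\<lparr>carrier := G\<rparr>) \<alpha> tensor_act tensor_algebra"

definition sym_crossed ::
  "(complex ^ 'n ^ 'n) set \<Rightarrow> (complex ^ 'n ^ 'n \<Rightarrow> complex ^ 'n ^ 'n \<Rightarrow> complex)
     \<Rightarrow> (complex, complex ^ 'n ^ 'n \<Rightarrow> ('n::finite list \<Rightarrow> complex) set) module" where
  "sym_crossed G \<alpha> = crossed_product (GL\<lparr>carrier := G\<rparr>) \<alpha> sym_act sym_algebra"

text \<open>
  \<open>hecke_vec G \<alpha> v\<close> is \<open>v \<otimes> 1\<close>, and \<open>hecke_group G \<alpha> c g\<close> is \<open>c t (1 \<otimes> g)\<close>, both in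
  \<open>T(V) #\<^sub>\<alpha> G[t]\<close>.
\<close>

definition hecke_vec ::
  "(complex ^ 'n ^ 'n) set \<Rightarrow> (complex ^ 'n ^ 'n \<Rightarrow> complex ^ 'n ^ 'n \<Rightarrow> complex) \<Rightarrow> complex ^ 'n
     \<Rightarrow> nat \<Rightarrow> complex ^ 'n ^ 'n \<Rightarrow> 'n::finite list \<Rightarrow> complex" where
  "hecke_vec G \<alpha> v = up_ring.monom (UP (tensor_crossed G \<alpha>))
     (pure_tensor (GL\<lparr>carrier := G\<rparr>) tensor_algebra (tensor_vec v) (mat 1)) 0"

definition hecke_group ::
  "(complex ^ 'n ^ 'n) set \<Rightarrow> (complex ^ 'n ^ 'n \<Rightarrow> complex ^ 'n ^ 'n \<Rightarrow> complex) \<Rightarrow> complex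
     \<Rightarrow> complex ^ 'n ^ 'n \<Rightarrow> nat \<Rightarrow> complex ^ 'n ^ 'n \<Rightarrow> 'n::finite list \<Rightarrow> complex" where
  "hecke_group G \<alpha> c g = up_ring.monom (UP (tensor_crossed G \<alpha>))
     (c \<odot>\<^bsub>tensor_crossed G \<alpha>\<^esub> pure_tensor (GL\<lparr>carrier := G\<rparr>) tensor_algebra \<one>\<^bsub>tensor_algebra\<^esub> g) 1"

definition hecke_ideal ::
  "(complex ^ 'n ^ 'n) set \<Rightarrow> (complex ^ 'n ^ 'n \<Rightarrow> complex ^ 'n ^ 'n \<Rightarrow> complex)
     \<Rightarrow> (complex ^ 'n ^ 'n \<Rightarrow> complex ^ 'n \<Rightarrow> complex ^ 'n \<Rightarrow> complex)
     \<Rightarrow> (nat \<Rightarrow> complex ^ 'n ^ 'n \<Rightarrow> 'n::finite list \<Rightarrow> complex) set" where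
  "hecke_ideal G \<alpha> a = (let P = poly_algebra (tensor_crossed G \<alpha>) in
     Idl\<^bsub>P\<^esub> {hecke_vec G \<alpha> v \<otimes>\<^bsub>P\<^esub> hecke_vec G \<alpha> w
       \<ominus>\<^bsub>P\<^esub> hecke_vec G \<alpha> w \<otimes>\<^bsub>P\<^esub> hecke_vec G \<alpha> v
       \<ominus>\<^bsub>P\<^esub> (\<Oplus>\<^bsub>P\<^esub>g \<in> G. hecke_group G \<alpha> (a g v w) g) | v w. True})"

definition hecke_algebra ::
  "(complex ^ 'n ^ 'n) set \<Rightarrow> (complex ^ 'n ^ 'n \<Rightarrow> complex ^ 'n ^ 'n \<Rightarrow> complex)
     \<Rightarrow> (complex ^ 'n ^ 'n \<Rightarrow> complex ^ 'n \<Rightarrow> complex ^ 'n \<Rightarrow> complex)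
     \<Rightarrow> (complex poly, (nat \<Rightarrow> complex ^ 'n ^ 'n \<Rightarrow> 'n::finite list \<Rightarrow> complex) set) module" where
  "hecke_algebra G \<alpha> a = quotient_algebra (poly_algebra (tensor_crossed G \<alpha>)) (hecke_ideal G \<alpha> a)"

text \<open>The map \<open>S(V) #\<^sub>\<alpha> G[t] \<rightarrow> A\<close> induced by the section \<open>\<sigma> : S(V) \<rightarrow> T(V)\<close>.\<close>

definition hecke_map ::
  "(complex ^ 'n ^ 'n) set \<Rightarrow> (complex ^ 'n ^ 'n \<Rightarrow> complex ^ 'n ^ 'n \<Rightarrow> complex)
     \<Rightarrow> (complex ^ 'n ^ 'n \<Rightarrow> complex ^ 'n \<Rightarrow> complex ^ 'n \<Rightarrow> complex)
     \<Rightarrow> (('n::finite list \<Rightarrow> complex) set \<Rightarrow> 'n list \<Rightarrow> complex)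
     \<Rightarrow> (nat \<Rightarrow> complex ^ 'n ^ 'n \<Rightarrow> ('n list \<Rightarrow> complex) set)
     \<Rightarrow> (nat \<Rightarrow> complex ^ 'n ^ 'n \<Rightarrow> 'n list \<Rightarrow> complex) set" where
  "hecke_map G \<alpha> a \<sigma> x =
     hecke_ideal G \<alpha> a +>\<^bsub>poly_algebra (tensor_crossed G \<alpha>)\<^esub> (\<lambda>i. \<lambda>g\<in>G. \<sigma> (x i g))"

definition twisted_graded_hecke_algebra ::
  "(complex ^ 'n ^ 'n) set \<Rightarrow> (complex ^ 'n ^ 'n \<Rightarrow> complex ^ 'n ^ 'n \<Rightarrow> complex)
     \<Rightarrow> (complex ^ 'n ^ 'n \<Rightarrow> complex ^ 'n \<Rightarrow> complex ^ 'n \<Rightarrow> complex)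
     \<Rightarrow> (('n::finite list \<Rightarrow> complex) set \<Rightarrow> 'n list \<Rightarrow> complex) \<Rightarrow> bool" where
  "twisted_graded_hecke_algebra G \<alpha> a \<sigma> \<longleftrightarrow>
     hecke_map G \<alpha> a \<sigma> \<in> module_isos (poly_algebra (sym_crossed G \<alpha>)) (hecke_algebra G \<alpha> a)"

section \<open>Fixed spaces, orthogonal complements and \<open>h\<^sup>\<bottom>\<close>\<close>

definition form_kernel :: "(complex ^ 'n \<Rightarrow> complex ^ 'n \<Rightarrow> complex) \<Rightarrow> (complex ^ 'n) set" where
  "form_kernel a = {v. \<forall>w. a v w = 0}"

definition fixed_space :: "complex ^ 'n ^ 'n \<Rightarrow> (complex ^ 'n) set" where
  "fixed_space g = {v. g *v v = v}"

definition codim :: "(complex ^ 'n) set \<Rightarrow> nat" where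
  "codim W = CARD('n) - vec.dim W"

definition invariant_nondegenerate_hermitian ::
  "(complex ^ 'n ^ 'n) set \<Rightarrow> (complex ^ 'n \<Rightarrow> complex ^ 'n \<Rightarrow> complex) \<Rightarrow> bool" where
  "invariant_nondegenerate_hermitian G H \<longleftrightarrow>
     (\<forall>w. Vector_Spaces.linear (*s) (*) (\<lambda>v. H v w)) \<and>
     (\<forall>v w. H w v = cnj (H v w)) \<and>
     (\<forall>v. (\<forall>w. H v w = 0) \<longrightarrow> v = 0) \<and>
     (\<forall>g \<in> G. \<forall>v w. H (g *v v) (g *v w) = H v w)"

definition orth_compl ::
  "(complex ^ 'n \<Rightarrow> complex ^ 'n \<Rightarrow> complex) \<Rightarrow> (complex ^ 'n) set \<Rightarrow> (complex ^ 'n) set" where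
  "orth_compl H W = {v. \<forall>w \<in> W. H v w = 0}"

text \<open>Of interest for \<open>v\<close> in \<open>(V\<^sup>g)\<^sup>\<bottom>\<close>: the representative of \<open>h v + V\<^sup>g\<close> in \<open>(V\<^sup>g)\<^sup>\<bottom>\<close>.\<close>

definition perp_map ::
  "(complex ^ 'n \<Rightarrow> complex ^ 'n \<Rightarrow> complex) \<Rightarrow> complex ^ 'n ^ 'n \<Rightarrow> complex ^ 'n ^ 'n
     \<Rightarrow> complex ^ 'n \<Rightarrow> complex ^ 'n" where
  "perp_map H g h v =
     (THE w. w \<in> orth_compl H (fixed_space g) \<and> h *v v - w \<in> fixed_space g)"

text \<open>
  Determinant of a linear endomorphism \<open>f\<close> of a subspace \<open>W\<close>: the Leibniz formula for the
  matrix of \<open>f\<close> in a basis of \<open>W\<close>. The value does not depend on the basis chosen.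
\<close>

definition basis_list :: "(complex ^ 'n) set \<Rightarrow> (complex ^ 'n) list \<Rightarrow> bool" where
  "basis_list W bs \<longleftrightarrow> distinct bs \<and> vec.independent (set bs) \<and> vec.span (set bs) = W"

definition det_on :: "(complex ^ 'n) set \<Rightarrow> (complex ^ 'n \<Rightarrow> complex ^ 'n) \<Rightarrow> complex" where
  "det_on W f = (let bs = (SOME bs. basis_list W bs) in
     \<Sum>p | p permutes {..<length bs}. of_int (sign p) *
       (\<Prod>i<length bs. vec.representation (set bs) (f (bs ! i)) (bs ! p i)))"

end

theory Submission
  imports Defs
begin

text \<open>
  The quotient \<open>A\<close> is a twisted graded Hecke algebra iff the forms satisfy two conditions:
  equivariance \<open>\<alpha>(hxh\<^sup>-\<^sup>1, h) a\<^bsub>hxh\<^sup>-\<^sup>1\<^esub>(hv, hw) = \<alpha>(h, x) a\<^sub>x(v, w)\<close>, obtained by moving \<open>h\<close> past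
  a relation, and a Jacobi identity, obtained from the cyclic sum of the \<open>[[u, v], w]\<close>. They are
  necessary because they come from elements of the ideal of degree at most one. Conversely,
  under them there is a functional on \<open>T(V) #\<^sub>\<alpha> G[t]\<close> that kills the ideal and is, in top
  degree, a coefficient in the symmetric algebra. On words it is defined by bubble sort: sorting
  a word changes the value by a sum of contributions of lower degree, one for each swap of
  neighbours, and the two conditions say that the sum is independent of the order of the swaps.

  For the given \<open>a\<^sub>g\<close> the Jacobi identity and equivariance under \<open>g\<close> itself force the kernel to
  be \<open>V\<^sup>g\<close> of codimension two, so that \<open>h\<close> in \<open>C(g)\<close> acts on the form by the determinant of
  \<open>h\<^sup>\<bottom>\<close>. Conversely, such a form extends to an equivariant family by averaging its transports
  to the conjugates of \<open>g\<close>.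
\<close>

section \<open>Sorting words by swaps of neighbours\<close>

text \<open>A relation trades two letters for a group element and a factor \<open>t\<close>, so the
  correction made by a swap involves only words two letters shorter, and the functional can be
  defined by recursion on the length. Whether the corrections fit together is a closedness question
  on the graph of words under swaps of neighbours, whose basic cycles are the Coxeter relations of
  the symmetric group. Hexagons close by the Jacobi identity. Squares, that is, swaps in two
  disjoint places, are the obstacle: each swap emits a group element that must pass the other pair,
  and comparing the two orders takes equivariance, the cocycle identity and the swap rule for
  shorter words. Hence the swap rule is proved by induction on the length.

  Values lie in the twisted group algebra over polynomials in \<open>t\<close>, with group elements
  pushed to the right. By right linearity only products of the form tensor, relation, tensor remain
  to be checked for the two-sided ideal.

  A graded section is forced in degree at most one, which serves necessity; homogeneous components
  of its values are again values, which lets top degrees be compared.\<close>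

primrec bubble :: "('a \<Rightarrow> nat) \<Rightarrow> ('a list \<Rightarrow> 'a \<Rightarrow> 'a \<Rightarrow> 'a list \<Rightarrow> complex)
    \<Rightarrow> 'a list \<Rightarrow> 'a \<Rightarrow> 'a list \<Rightarrow> complex" where
  "bubble r c u a [] = 0"
| "bubble r c u a (b # y) = (if r a \<le> r b then 0 else c u a b y + bubble r c (u @ [b]) a y)"

text \<open>If \<open>c u a b y\<close> is the increment
  \<open>f (u @ a # b # y) - f (u @ b # a # y)\<close> of a function \<open>f\<close> on words, then
  \<open>bubble\<close> telescopes to \<open>f (u @ a # s) - f (u @ insort_key r a s)\<close> and
  \<open>sort_potential\<close> to \<open>f (u @ w) - f (u @ sort_key r w)\<close>. The letters to
  the left are carried in \<open>u\<close> because an increment depends on the whole word.\<close>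

primrec sort_potential :: "('a \<Rightarrow> nat) \<Rightarrow> ('a list \<Rightarrow> 'a \<Rightarrow> 'a \<Rightarrow> 'a list \<Rightarrow> complex)
    \<Rightarrow> 'a list \<Rightarrow> 'a list \<Rightarrow> complex" where
  "sort_potential r c u [] = 0"
| "sort_potential r c u (a # w) =
     sort_potential r c (u @ [a]) w + bubble r c u a (sort_key r w)"

lemma sort_key_mset_eq: "inj r \<Longrightarrow> mset v = mset w \<Longrightarrow> sort_key r v = sort_key r w"
  by (rule sort_key_inj_key_eq) (auto intro: inj_on_subset)

text \<open>With words of length \<open>L\<close> as vertices and swaps of neighbours as edges, the
  three conditions on \<open>c\<close> say that it sums to zero around the cycles given by the
  Coxeter relations: an edge run back and forth, the square of two disjoint swaps, and the hexagon
  of three adjacent letters. The length is fixed because the instance below obtains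
  \<open>far\<close> at one length from the swap rule at a smaller one.\<close>

locale swap_cocycle =
  fixes r :: "'a \<Rightarrow> nat" and c :: "'a list \<Rightarrow> 'a \<Rightarrow> 'a \<Rightarrow> 'a list \<Rightarrow> complex" and L :: nat
  assumes inj_r: "inj r"
    and anti: "\<And>u a b y. length u + length y + 2 = L \<Longrightarrow> c u b a y = - c u a b y"
    and far: "\<And>u a b x d e y. length u + length x + length y + 4 = L \<Longrightarrow>
       c u a b (x @ d # e # y) - c u a b (x @ e # d # y)
         = c (u @ a # b # x) d e y - c (u @ b # a # x) d e y"
    and braid: "\<And>u a b d y. length u + length y + 3 = L \<Longrightarrow>
       c u a b (d # y) + c (u @ [b]) a d y + c u b d (a # y)
         = c (u @ [a]) b d y + c u a d (b # y) + c (u @ [d]) a b y"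
begin

lemma c_same: "length u + length y + 2 = L \<Longrightarrow> c u a a y = 0"
  using anti[of u y a a] by simp

text \<open>Each step of \<open>d\<close> through \<open>s\<close> contributes one square
  \<open>far\<close>, and the corrections telescope between the first and the last position of
  \<open>d\<close>. The next lemma sums this over all letters of an insertion sort.\<close>

lemma bubble_prefix_swap:
  "length u + length x + length s + 3 = L \<Longrightarrow>
   bubble r c (u @ a # b # x) d s - bubble r c (u @ b # a # x) d s
     = c u a b (x @ d # s) - c u a b (x @ insort_key r d s)"
proof (induction s arbitrary: x)
  case Nil
  then show ?case by simp
next
  case (Cons e s)
  have *: "bubble r c (u @ a # b # x @ [e]) d s - bubble r c (u @ b # a # x @ [e]) d s
     = c u a b ((x @ [e]) @ d # s) - c u a b ((x @ [e]) @ insort_key r d s)"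
    using Cons.prems Cons.IH[of "x @ [e]"] by simp
  have "c u a b (x @ d # e # s) - c u a b (x @ e # d # s)
         = c (u @ a # b # x) d e s - c (u @ b # a # x) d e s"
    using Cons.prems by (intro far) simp
  with * show ?case by (simp add: complex_eq_iff)
qed

lemma sort_potential_prefix_swap:
  "length u + length x + length y + 2 = L \<Longrightarrow>
   sort_potential r c (u @ a # b # x) y - sort_potential r c (u @ b # a # x) y
     = c u a b (x @ y) - c u a b (x @ sort_key r y)"
proof (induction y arbitrary: x)
  case Nil
  then show ?case by simp
next
  case (Cons d y)
  have *: "sort_potential r c (u @ a # b # x @ [d]) y - sort_potential r c (u @ b # a # x @ [d]) y
     = c u a b ((x @ [d]) @ y) - c u a b ((x @ [d]) @ sort_key r y)"
    using Cons.prems Cons.IH[of "x @ [d]"] by simp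
  have "bubble r c (u @ a # b # x) d (sort_key r y) - bubble r c (u @ b # a # x) d (sort_key r y)
     = c u a b (x @ d # sort_key r y) - c u a b (x @ insort_key r d (sort_key r y))"
    using Cons.prems by (intro bubble_prefix_swap) simp
  with * show ?case by (simp add: complex_eq_iff)
qed

text \<open>Two insertion paths from \<open>a # b # s\<close> and \<open>b # a # s\<close> end in
  the same sorted word. Letters \<open>d\<close> smaller than both are passed by both; such a
  \<open>d\<close> costs one hexagon \<open>braid\<close> and two squares, the latter moving the
  increments of \<open>d\<close> past the rest of the paths. At the first \<open>d\<close> that is
  not smaller than \<open>b\<close> the paths visibly agree.\<close>

lemma bubble_insort_swap_aux:
  "length u + length s + 2 = L \<Longrightarrow> sorted (map r s) \<Longrightarrow> r b < r a \<Longrightarrow>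
   bubble r c (u @ [a]) b s + bubble r c u a (insort_key r b s)
     = c u a b s + bubble r c (u @ [b]) a s + bubble r c u b (insort_key r a s)"
proof (induction s arbitrary: u)
  case Nil
  then show ?case by simp
next
  case (Cons d s)
  show ?case
  proof (cases "r b \<le> r d")
    case True
    with Cons.prems show ?thesis by simp
  next
    case False
    have IH: "bubble r c (u @ [d, a]) b s + bubble r c (u @ [d]) a (insort_key r b s)
     = c (u @ [d]) a b s + bubble r c (u @ [d, b]) a s + bubble r c (u @ [d]) b (insort_key r a s)"
      using Cons.IH[of "u @ [d]"] Cons.prems by simp
    have 1: "bubble r c (u @ a # d # []) b s - bubble r c (u @ d # a # []) b s
        = c u a d ([] @ b # s) - c u a d ([] @ insort_key r b s)"
      using Cons.prems by (intro bubble_prefix_swap) simp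
    have 2: "bubble r c (u @ b # d # []) a s - bubble r c (u @ d # b # []) a s
        = c u b d ([] @ a # s) - c u b d ([] @ insort_key r a s)"
      using Cons.prems by (intro bubble_prefix_swap) simp
    have 3: "c u a b (d # s) + c (u @ [b]) a d s + c u b d (a # s)
         = c (u @ [a]) b d s + c u a d (b # s) + c (u @ [d]) a b s"
      using Cons.prems by (intro braid) simp
    show ?thesis
      using False Cons.prems(3) IH 1 2 3 by (simp add: complex_eq_iff)
  qed
qed

lemma bubble_insort_swap:
  assumes "length u + length s + 2 = L" "sorted (map r s)"
  shows "bubble r c (u @ [a]) b s + bubble r c u a (insort_key r b s)
     = c u a b s + bubble r c (u @ [b]) a s + bubble r c u b (insort_key r a s)"
proof (cases "r a" "r b" rule: linorder_cases)
  case less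
  show ?thesis
    using bubble_insort_swap_aux[OF assms less] anti[OF assms(1), of b a] by (simp add: complex_eq_iff)
next
  case equal
  then have "a = b" using inj_r by (auto dest: injD)
  then show ?thesis using c_same[OF assms(1)] by simp
next
  case greater
  show ?thesis by (rule bubble_insort_swap_aux[OF assms greater])
qed

lemma sort_swap: "sort_key r (x @ a # b # y) = sort_key r (x @ b # a # y)"
  by (rule sort_key_mset_eq[OF inj_r]) simp

text \<open>This is the path independence that was sought: \<open>sort_potential\<close> has the
  prescribed increments. Letters in front of the swapped pair are inserted into the same sorted word
  on both sides, so only the case of the pair at the head has content.\<close>

lemma sort_potential_swap:
  "length u + length x + length y + 2 = L \<Longrightarrow>
   sort_potential r c u (x @ a # b # y) - sort_potential r c u (x @ b # a # y)
     = c (u @ x) a b y"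
proof (induction x arbitrary: u)
  case Nil
  have "sort_potential r c (u @ a # b # []) y - sort_potential r c (u @ b # a # []) y
     = c u a b ([] @ y) - c u a b ([] @ sort_key r y)"
    using Nil by (intro sort_potential_prefix_swap) simp
  moreover have "bubble r c (u @ [a]) b (sort_key r y) + bubble r c u a (insort_key r b (sort_key r y))
     = c u a b (sort_key r y) + bubble r c (u @ [b]) a (sort_key r y)
        + bubble r c u b (insort_key r a (sort_key r y))"
    using Nil by (intro bubble_insort_swap) simp_all
  ultimately show ?case by (simp add: complex_eq_iff)
next
  case (Cons d x)
  have "sort_potential r c (u @ [d]) (x @ a # b # y) - sort_potential r c (u @ [d]) (x @ b # a # y)
     = c ((u @ [d]) @ x) a b y"
    using Cons.prems by (intro Cons.IH) simp
  then show ?case using sort_swap[of x a b y] by simp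
qed

end

lemma bubble_cong:
  "(\<And>u a b y. length u + length y + 2 = L \<Longrightarrow> c u a b y = c' u a b y) \<Longrightarrow>
   length u + length s + 1 = L \<Longrightarrow> bubble r c u a s = bubble r c' u a s"
  by (induction s arbitrary: u) auto

lemma sort_potential_cong:
  "(\<And>u a b y. length u + length y + 2 = L \<Longrightarrow> c u a b y = c' u a b y) \<Longrightarrow>
   length u + length w = L \<Longrightarrow> sort_potential r c u w = sort_potential r c' u w"
proof (induction w arbitrary: u)
  case (Cons a w)
  then show ?case using bubble_cong[of L c c' u "sort_key r w" r a] by simp
qed simp

section \<open>The tensor algebra in coordinates\<close>

definition tmul :: "('n list \<Rightarrow> complex) \<Rightarrow> ('n list \<Rightarrow> complex) \<Rightarrow> 'n list \<Rightarrow> complex" where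
  "tmul f f' w = (\<Sum>i\<le>length w. f (take i w) * f' (drop i w))"

definition word :: "'n list \<Rightarrow> 'n list \<Rightarrow> complex" where
  "word w v = (if v = w then 1 else 0)"

definition tensors :: "('n list \<Rightarrow> complex) set" where
  "tensors = {f. finite {w. f w \<noteq> 0}}"

lemma tmul_Nil [simp]: "tmul f g [] = f [] * g []"
  by (simp add: tmul_def)

text \<open>The left factor takes either no letter or the first letter \<open>a\<close>. With this
  recursion associativity and compatibility with the group action become inductions on the word,
  with the left factor arbitrary, in place of reindexing sums over splittings.\<close>

lemma tmul_Cons: "tmul f g (a # w) = f [] * g (a # w) + tmul (\<lambda>v. f (a # v)) g w"
  unfolding tmul_def by (simp add: sum.atMost_Suc_shift del: sum.atMost_Suc)

lemma tmul_add_left: "tmul (\<lambda>w. f w + g w) h w = tmul f h w + tmul g h w"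
  by (simp add: tmul_def distrib_right sum.distrib)

lemma tmul_add_right: "tmul f (\<lambda>w. g w + h w) w = tmul f g w + tmul f h w"
  by (simp add: tmul_def distrib_left sum.distrib)

lemma tmul_scale_left: "tmul (\<lambda>w. c * f w) h w = c * tmul f h w"
  by (simp add: tmul_def sum_distrib_left mult_ac)

lemma tmul_scale_right: "tmul f (\<lambda>w. c * h w) w = c * tmul f h w"
  by (simp add: tmul_def sum_distrib_left mult_ac)

lemma tmul_diff_left: "tmul (\<lambda>w. f w - g w) h w = tmul f h w - tmul g h w"
  by (simp add: tmul_def left_diff_distrib sum_subtractf)

lemma tmul_diff_right: "tmul f (\<lambda>w. g w - h w) w = tmul f g w - tmul f h w"
  by (simp add: tmul_def right_diff_distrib sum_subtractf)

lemma tmul_0_left [simp]: "tmul (\<lambda>w. 0) h w = 0"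
  by (simp add: tmul_def)

lemma tmul_0_right [simp]: "tmul h (\<lambda>w. 0) w = 0"
  by (simp add: tmul_def)

lemma tmul_sum_left: "tmul (\<lambda>w. \<Sum>x\<in>A. f x w) h w = (\<Sum>x\<in>A. tmul (f x) h w)"
  by (induction A rule: infinite_finite_induct) (auto simp: tmul_add_left)

lemma tmul_sum_right: "tmul h (\<lambda>w. \<Sum>x\<in>A. f x w) w = (\<Sum>x\<in>A. tmul h (f x) w)"
  by (induction A rule: infinite_finite_induct) (auto simp: tmul_add_right)

lemma tmul_assoc: "tmul (tmul f g) h = tmul f (tmul g h)"
proof
  fix w show "tmul (tmul f g) h w = tmul f (tmul g h) w"
    by (induction w arbitrary: f)
       (simp_all add: tmul_Cons tmul_add_left tmul_scale_left algebra_simps)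
qed

lemma tmul_word_left: "tmul (word u) f v = (if \<exists>w. v = u @ w then f (drop (length u) v) else 0)"
proof (induction u arbitrary: v)
  case Nil
  show ?case
  proof (cases v)
    case (Cons a w)
    have "(\<lambda>v. word [] (a # v)) = (\<lambda>v. 0)" by (auto simp: word_def)
    then show ?thesis using Cons by (simp add: tmul_Cons word_def)
  qed (simp add: word_def)
next
  case (Cons b u)
  show ?case
  proof (cases v)
    case Nil
    then show ?thesis by (simp add: word_def)
  next
    case (Cons a w)
    have "(\<lambda>v. word (b # u) (a # v)) = (\<lambda>v. (if a = b then 1 else 0) * word u v)"
      by (auto simp: word_def)
    then have "tmul (word (b # u)) f v = (if a = b then 1 else 0) * tmul (word u) f w"
      using Cons by (simp only: tmul_Cons tmul_scale_left) (simp add: word_def[of "b # u"])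
    then show ?thesis using Cons Cons.IH[of w] by auto
  qed
qed

lemma tmul_word_word: "tmul (word u) (word v) = word (u @ v)"
  by (auto simp: fun_eq_iff tmul_word_left word_def)

lemma tmul_one_left [simp]: "tmul (word []) f = f"
  by (simp add: tmul_word_left fun_eq_iff)

lemma tmul_one_right [simp]: "tmul f (word []) = f"
proof
  fix w show "tmul f (word []) w = f w"
    by (induction w arbitrary: f) (simp_all add: tmul_Cons word_def)
qed

lemma finite_words_length: "finite {u :: 'n::finite list. length u = n}"
  using finite_lists_length_eq[of "UNIV :: 'n set" n] by simp

lemma sum_words_Suc:
  "(\<Sum>u | length u = Suc n. F u) = (\<Sum>b\<in>UNIV. \<Sum>u | length u = n. F (b # u :: 'n::finite list))"
proof -
  have "(\<Sum>b\<in>UNIV. \<Sum>u | length u = n. F (b # u))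
     = (\<Sum>p \<in> UNIV \<times> {u. length u = n}. F (fst p # snd p))"
    by (simp add: sum.cartesian_product case_prod_beta)
  also have "\<dots> = (\<Sum>u | length u = Suc n. F u)"
    by (rule sum.reindex_bij_witness[where i = "\<lambda>u. (hd u, tl u)" and j = "\<lambda>p. fst p # snd p"])
       (auto simp: length_Suc_conv)
  finally show ?thesis by simp
qed

lemma sum_words_append:
  "(\<Sum>u | length u = m + n. F u)
     = (\<Sum>x | length x = m. \<Sum>y | length y = n. F (x @ y :: 'n::finite list))"
proof (induction m arbitrary: F)
  case (Suc m)
  have "(\<Sum>u | length u = Suc m + n. F u) = (\<Sum>b\<in>UNIV. \<Sum>u | length u = m + n. F (b # u))"
    using sum_words_Suc[of F "m + n"] by simp
  also have "\<dots> = (\<Sum>b\<in>UNIV. \<Sum>x | length x = m. \<Sum>y | length y = n. F (b # x @ y))"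
    by (simp add: Suc.IH)
  finally show ?case by (simp add: sum_words_Suc)
qed simp

section \<open>The diagonal group action in coordinates\<close>

definition act_coeff :: "complex ^ 'n ^ 'n \<Rightarrow> 'n::finite list \<Rightarrow> 'n list \<Rightarrow> complex" where
  "act_coeff h w u = (\<Prod>i<length w. h $ (w ! i) $ (u ! i))"

lemma act_coeff_Nil [simp]: "act_coeff h [] u = 1"
  by (simp add: act_coeff_def)

lemma act_coeff_Cons [simp]: "act_coeff h (a # w) (b # u) = h $ a $ b * act_coeff h w u"
  by (simp add: act_coeff_def prod.lessThan_Suc_shift del: prod.lessThan_Suc)

lemma act_coeff_append:
  "length x = length u \<Longrightarrow> act_coeff h (x @ y) (u @ v) = act_coeff h x u * act_coeff h y v"
  by (induction x u rule: list_induct2) auto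

lemma tensor_act_coeff: "tensor_act h f w = (\<Sum>u | length u = length w. act_coeff h w u * f u)"
  by (simp add: tensor_act_def act_coeff_def)

lemma tensor_act_Nil [simp]: "tensor_act h f [] = f []"
  by (simp add: tensor_act_coeff)

lemma tensor_act_Cons:
  "tensor_act h f (a # w) = (\<Sum>b\<in>UNIV. h $ a $ b * tensor_act h (\<lambda>v. f (b # v)) w)"
  by (simp add: tensor_act_coeff sum_words_Suc sum_distrib_left mult.assoc)

lemma tensor_act_add: "tensor_act h (\<lambda>w. f w + g w) w = tensor_act h f w + tensor_act h g w"
  by (simp add: tensor_act_coeff distrib_left sum.distrib)

lemma tensor_act_diff: "tensor_act h (\<lambda>w. f w - g w) w = tensor_act h f w - tensor_act h g w"
  by (simp add: tensor_act_coeff right_diff_distrib sum_subtractf)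

lemma tensor_act_scale: "tensor_act h (\<lambda>w. c * f w) w = c * tensor_act h f w"
  by (simp add: tensor_act_coeff sum_distrib_left mult_ac)

lemma tensor_act_0 [simp]: "tensor_act h (\<lambda>w. 0) w = 0"
  by (simp add: tensor_act_coeff)

lemma tensor_act_sum: "tensor_act h (\<lambda>w. \<Sum>x\<in>A. f x w) w = (\<Sum>x\<in>A. tensor_act h (f x) w)"
  by (induction A rule: infinite_finite_induct) (auto simp: tensor_act_add)

lemma tensor_act_word: "length u = length w \<Longrightarrow> tensor_act h (word u) w = act_coeff h w u"
  by (simp add: tensor_act_coeff word_def finite_words_length if_distrib[of "\<lambda>x. _ * x"] cong: if_cong)

lemma tensor_act_word_other: "length u \<noteq> length w \<Longrightarrow> tensor_act h (word u) w = 0"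
  by (auto simp: tensor_act_coeff word_def intro!: sum.neutral)

lemma tensor_act_one [simp]: "tensor_act h (word []) = word []"
proof
  fix w show "tensor_act h (word []) w = word [] w"
    by (cases w) (auto simp: tensor_act_word_other word_def)
qed

lemma tensor_act_tmul: "tensor_act h (tmul f g) = tmul (tensor_act h f) (tensor_act h g)"
proof
  fix w show "tensor_act h (tmul f g) w = tmul (tensor_act h f) (tensor_act h g) w"
    by (induction w arbitrary: f)
       (simp_all add: tmul_Cons tensor_act_Cons tensor_act_add tensor_act_scale
        tmul_sum_left tmul_scale_left distrib_left sum.distrib sum_distrib_left mult_ac)
qed

lemma tensor_act_mult: "tensor_act (h ** k) f = tensor_act h (tensor_act k f)"
proof
  fix w show "tensor_act (h ** k) f w = tensor_act h (tensor_act k f) w"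
  proof (induction w arbitrary: f)
    case (Cons a w)
    have "tensor_act h (tensor_act k f) (a # w) = (\<Sum>c\<in>UNIV. \<Sum>b\<in>UNIV.
        h $ a $ c * (k $ c $ b * tensor_act h (tensor_act k (\<lambda>v. f (b # v))) w))"
      by (simp add: tensor_act_Cons tensor_act_sum tensor_act_scale sum_distrib_left)
    also have "\<dots> = (\<Sum>b\<in>UNIV. \<Sum>c\<in>UNIV.
        h $ a $ c * (k $ c $ b * tensor_act h (tensor_act k (\<lambda>v. f (b # v))) w))"
      by (rule sum.swap)
    finally show ?case
      by (simp add: tensor_act_Cons Cons.IH)
         (simp add: matrix_matrix_mult_def sum_distrib_right mult.assoc)
  qed simp
qed

lemma tensor_act_mat1 [simp]: "tensor_act (mat 1) f = f"
proof
  fix w show "tensor_act (mat 1) f w = f w"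
    by (induction w arbitrary: f)
       (simp_all add: tensor_act_Cons mat_def if_distrib[of "\<lambda>x. x * _"] cong: if_cong)
qed

section \<open>Tensors as finitely supported functions\<close>

lemma tensorsI: "finite {w. f w \<noteq> 0} \<Longrightarrow> f \<in> tensors"
  by (simp add: tensors_def)

lemma tensors_0 [simp]: "(\<lambda>w. 0) \<in> tensors"
  by (simp add: tensors_def)

lemma tensors_word [simp]: "word u \<in> tensors"
  by (auto simp: tensors_def word_def)

lemma tensors_add: "f \<in> tensors \<Longrightarrow> g \<in> tensors \<Longrightarrow> (\<lambda>w. f w + g w) \<in> tensors"
  unfolding tensors_def mem_Collect_eq by (drule (1) finite_UnI, erule rev_finite_subset) auto

lemma tensors_scale: "f \<in> tensors \<Longrightarrow> (\<lambda>w. c * f w) \<in> tensors"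
  unfolding tensors_def mem_Collect_eq by (erule rev_finite_subset) auto

lemma tensors_minus: "f \<in> tensors \<Longrightarrow> (\<lambda>w. - f w) \<in> tensors"
  unfolding tensors_def by simp

lemma tensors_diff: "f \<in> tensors \<Longrightarrow> g \<in> tensors \<Longrightarrow> (\<lambda>w. f w - g w) \<in> tensors"
  using tensors_add[OF _ tensors_minus, of f g] by simp

lemma tensors_sum: "(\<And>x. x \<in> A \<Longrightarrow> f x \<in> tensors) \<Longrightarrow> (\<lambda>w. \<Sum>x\<in>A. f x w) \<in> tensors"
  by (induction A rule: infinite_finite_induct) (auto intro: tensors_add)

lemma tensors_tmul: assumes "f \<in> tensors" "g \<in> tensors" shows "tmul f g \<in> tensors"
proof (rule tensorsI, rule finite_subset)
  show "{w. tmul f g w \<noteq> 0} \<subseteq> (\<lambda>(u, v). u @ v) ` ({w. f w \<noteq> 0} \<times> {w. g w \<noteq> 0})"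
  proof safe
    fix w assume "tmul f g w \<noteq> 0"
    then obtain i where "f (take i w) \<noteq> 0" "g (drop i w) \<noteq> 0"
      unfolding tmul_def by (rule sum.not_neutral_contains_not_neutral) auto
    then show "w \<in> (\<lambda>(u, v). u @ v) ` ({w. f w \<noteq> 0} \<times> {w. g w \<noteq> 0})"
      by (intro image_eqI[of _ _ "(take i w, drop i w)"]) auto
  qed
qed (use assms in \<open>auto simp: tensors_def\<close>)

lemma tensors_act:
  fixes f :: "'n::finite list \<Rightarrow> complex"
  assumes "f \<in> tensors"
  shows "tensor_act h f \<in> tensors"
proof (rule tensorsI, rule finite_subset)
  show "{w. tensor_act h f w \<noteq> 0} \<subseteq> (\<Union>u\<in>{w. f w \<noteq> 0}. {w. length w = length u})"
  proof safe
    fix w assume "tensor_act h f w \<noteq> 0"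
    then obtain u where "length u = length w" "f u \<noteq> 0"
      unfolding tensor_act_coeff by (rule sum.not_neutral_contains_not_neutral) auto
    then show "w \<in> (\<Union>u\<in>{w. f w \<noteq> 0}. {w. length w = length u})"
      by (intro UN_I[of u]) simp_all
  qed
  show "finite (\<Union>u\<in>{w. f w \<noteq> 0}. {w :: 'n list. length w = length u})"
    using assms by (intro finite_UN_I) (simp_all add: tensors_def finite_words_length)
qed

lemma tensor_vec_Cons: "tensor_vec v w = (\<Sum>a\<in>UNIV. v $ a * word [a] w)"
proof (cases w)
  case (Cons b w')
  show ?thesis
  proof (cases w')
    case Nil
    then show ?thesis using Cons
      by (simp add: tensor_vec_def word_def if_distrib[of "\<lambda>x. _ * x"] cong: if_cong)
  qed (use Cons in \<open>simp add: tensor_vec_def word_def\<close>)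
qed (simp add: tensor_vec_def word_def)

lemma tensor_vec_in_tensors [simp]: "tensor_vec v \<in> tensors"
  unfolding tensor_vec_Cons[abs_def] by (intro tensors_sum tensors_scale tensors_word)

lemma tensor_vec_axis: "tensor_vec (axis a 1) = word [a]"
  by (rule ext) (auto simp: tensor_vec_def word_def axis_def split: list.splits)

lemma tensor_act_vec: "tensor_act h (tensor_vec v) = tensor_vec (h *v v)"
proof
  fix w show "tensor_act h (tensor_vec v) w = tensor_vec (h *v v) w"
  proof (cases "length w = 1")
    case True
    then obtain a where "w = [a]" by (auto simp: length_Suc_conv)
    then show ?thesis
      by (simp add: tensor_act_Cons tensor_vec_def matrix_vector_mult_def)
  next
    case False
    have "tensor_vec v w = 0" if "length w \<noteq> 1" for v :: "complex ^ 'a" and w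
      unfolding tensor_vec_Cons using that by (intro sum.neutral) (auto simp: word_def)
    with False show ?thesis
      by (simp add: tensor_act_coeff)
  qed
qed

lemma carrier_tensor_algebra [simp]: "carrier tensor_algebra = tensors"
  by (simp add: tensor_algebra_def tensors_def)

lemma mult_tensor_algebra [simp]: "f \<otimes>\<^bsub>tensor_algebra\<^esub> g = tmul f g"
  by (simp add: tensor_algebra_def tmul_def fun_eq_iff)

lemma one_tensor_algebra [simp]: "\<one>\<^bsub>tensor_algebra\<^esub> = word []"
  by (simp add: tensor_algebra_def word_def fun_eq_iff)

lemma zero_tensor_algebra [simp]: "\<zero>\<^bsub>tensor_algebra\<^esub> = (\<lambda>w. 0)"
  by (simp add: tensor_algebra_def)

lemma add_tensor_algebra [simp]: "f \<oplus>\<^bsub>tensor_algebra\<^esub> g = (\<lambda>w. f w + g w)"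
  by (simp add: tensor_algebra_def)

lemma smult_tensor_algebra [simp]: "c \<odot>\<^bsub>tensor_algebra\<^esub> g = (\<lambda>w. c * g w)"
  by (simp add: tensor_algebra_def)

lemma ring_tensor_algebra: "ring (tensor_algebra :: (complex, 'n::finite list \<Rightarrow> complex) module)"
proof (rule ringI)
  show "abelian_group (tensor_algebra :: (complex, 'n::finite list \<Rightarrow> complex) module)"
  proof (rule abelian_groupI)
    fix x :: "'n list \<Rightarrow> complex" assume "x \<in> carrier tensor_algebra"
    then show "\<exists>y\<in>carrier tensor_algebra. y \<oplus>\<^bsub>tensor_algebra\<^esub> x = \<zero>\<^bsub>tensor_algebra\<^esub>"
      by (intro bexI[of _ "\<lambda>w. - x w"]) (simp_all add: tensors_minus)
  qed (simp_all add: tensors_add ac_simps)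
  show "Group.monoid (tensor_algebra :: (complex, 'n::finite list \<Rightarrow> complex) module)"
    by (rule monoidI) (simp_all add: tensors_tmul tmul_assoc)
qed (simp_all add: tmul_add_left[abs_def] tmul_add_right[abs_def])

lemma minus_tensor_algebra:
  assumes "f \<in> tensors" "g \<in> tensors"
  shows "f \<ominus>\<^bsub>tensor_algebra\<^esub> g = (\<lambda>w. f w - g w)"
proof -
  interpret ring tensor_algebra by (rule ring_tensor_algebra)
  have "\<ominus>\<^bsub>tensor_algebra\<^esub> g = (\<lambda>w. - g w)"
    using assms by (intro minus_equality) (simp_all add: tensors_minus)
  then show ?thesis unfolding a_minus_def add_tensor_algebra by simp
qed

lemma finsum_tensor_algebra:
  assumes "finite A" "\<And>x. x \<in> A \<Longrightarrow> F x \<in> tensors"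
  shows "(\<Oplus>\<^bsub>tensor_algebra\<^esub>x\<in>A. F x) = (\<lambda>w. \<Sum>x\<in>A. F x w)"
proof -
  interpret ring tensor_algebra by (rule ring_tensor_algebra)
  show ?thesis using assms
  proof (induction A rule: finite_induct)
    case empty
    then show ?case by (simp add: finsum_empty)
  next
    case (insert x A)
    then have "(\<Oplus>\<^bsub>tensor_algebra\<^esub>x\<in>insert x A. F x)
        = F x \<oplus>\<^bsub>tensor_algebra\<^esub> (\<Oplus>\<^bsub>tensor_algebra\<^esub>x\<in>A. F x)"
      by (intro finsum_insert) (auto simp: Pi_def)
    with insert show ?case by simp
  qed
qed

lemma tensors_induct [consumes 1, case_names word add]:
  assumes f: "f \<in> tensors"
    and w: "\<And>c w. Q (\<lambda>v. c * word w v)"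
    and add: "\<And>f g. f \<in> tensors \<Longrightarrow> g \<in> tensors \<Longrightarrow> Q f \<Longrightarrow> Q g \<Longrightarrow> Q (\<lambda>v. f v + g v)"
  shows "Q f"
proof -
  have *: "finite S \<Longrightarrow> Q (\<lambda>v. \<Sum>w\<in>S. f w * word w v)" for S
  proof (induction S rule: finite_induct)
    case empty
    then show ?case using w[of 0 "[]"] by simp
  next
    case (insert x S)
    have "(\<lambda>v. \<Sum>w\<in>S. f w * word w v) \<in> tensors" "(\<lambda>v. f x * word x v) \<in> tensors"
      by (auto intro!: tensors_sum tensors_scale)
    then show ?case using insert add[OF _ _ w] by simp
  qed
  have "(\<lambda>v. \<Sum>w | f w \<noteq> 0. f w * word w v) = f"
    using f by (auto simp: tensors_def word_def fun_eq_iff if_distrib[of "\<lambda>x. _ * x"] cong: if_cong)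
  with *[of "{w. f w \<noteq> 0}"] f show ?thesis by (simp add: tensors_def)
qed

section \<open>The algebra of polynomials over the crossed product\<close>

lemma invertible_mat_1: "invertible (mat 1 :: complex ^ 'n ^ 'n)"
  unfolding invertible_def by (rule exI[of _ "mat 1"]) simp

lemma group_GL: "Group.group (GL :: (complex ^ 'n ^ 'n) monoid)"
proof (rule groupI)
  fix x :: "complex ^ 'n ^ 'n" assume "x \<in> carrier GL"
  then show "\<exists>y\<in>carrier GL. y \<otimes>\<^bsub>GL\<^esub> x = \<one>\<^bsub>GL\<^esub>"
    by (auto simp: GL_def invertible_def)
qed (auto simp: GL_def invertible_mult matrix_mul_assoc invertible_mat_1)

section \<open>The group, its cocycle and the twisted convolution product\<close>

locale cocycle_group =
  fixes G :: "(complex ^ 'n ^ 'n) set"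
    and \<alpha> :: "complex ^ 'n ^ 'n \<Rightarrow> complex ^ 'n ^ 'n \<Rightarrow> complex"
  assumes subgroup: "subgroup G GL" and finite_G [simp]: "finite G"
    and cocycle: "normalized_two_cocycle (GL\<lparr>carrier := G\<rparr>) \<alpha>"
begin

abbreviation "R \<equiv> tensor_crossed G \<alpha>"
abbreviation "P \<equiv> poly_algebra R"

lemma one_G [simp]: "mat 1 \<in> G"
  using subgroup.one_closed[OF subgroup] by (simp add: GL_def)

lemma mult_G [simp]: "g \<in> G \<Longrightarrow> h \<in> G \<Longrightarrow> g ** h \<in> G"
  using subgroup.m_closed[OF subgroup] by (simp add: GL_def)

lemma invertible_G: "g \<in> G \<Longrightarrow> invertible g"
  using subgroup.mem_carrier[OF subgroup] by (simp add: GL_def)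

lemma inv_right [simp]: "g \<in> G \<Longrightarrow> g ** matrix_inv g = mat 1"
  and inv_left [simp]: "g \<in> G \<Longrightarrow> matrix_inv g ** g = mat 1"
  using someI_ex[of "\<lambda>A'. g ** A' = mat 1 \<and> A' ** g = mat 1"] invertible_G[of g]
  by (auto simp: matrix_inv_def invertible_def)

lemma inv_G [simp]: assumes "g \<in> G" shows "matrix_inv g \<in> G"
proof -
  have *: "inv\<^bsub>GL\<^esub> g \<in> G" using subgroup.m_inv_closed[OF subgroup] assms by simp
  have "g \<otimes>\<^bsub>GL\<^esub> inv\<^bsub>GL\<^esub> g = \<one>\<^bsub>GL\<^esub>"
    using assms group.r_inv[OF group_GL] subgroup.mem_carrier[OF subgroup] by blast
  then have "matrix_inv g ** (g ** inv\<^bsub>GL\<^esub> g) = matrix_inv g" by (simp add: GL_def)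
  then have "matrix_inv g = inv\<^bsub>GL\<^esub> g" using assms by (simp add: matrix_mul_assoc)
  with * show ?thesis by simp
qed

lemma inv_cancel_left [simp]: "g \<in> G \<Longrightarrow> matrix_inv g ** (g ** h) = h"
  by (simp add: matrix_mul_assoc)

lemma inv_cancel_left' [simp]: "g \<in> G \<Longrightarrow> g ** (matrix_inv g ** h) = h"
  by (simp add: matrix_mul_assoc)

lemma inv_cancel_right [simp]: "g \<in> G \<Longrightarrow> h ** matrix_inv g ** g = h"
  by (simp add: matrix_mul_assoc[symmetric])

lemma inv_cancel_right' [simp]: "g \<in> G \<Longrightarrow> h ** g ** matrix_inv g = h"
  by (simp add: matrix_mul_assoc[symmetric])

lemma inv_eqI: "g \<in> G \<Longrightarrow> h ** g = mat 1 \<Longrightarrow> matrix_inv g = h"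
  by (metis inv_cancel_right' matrix_mul_lid)

lemma inv_mult: "g \<in> G \<Longrightarrow> h \<in> G \<Longrightarrow> matrix_inv (g ** h) = matrix_inv h ** matrix_inv g"
  by (intro inv_eqI) (simp_all add: matrix_mul_assoc[symmetric])

lemma inv_one [simp]: "matrix_inv (mat 1) = (mat 1 :: complex ^ 'n ^ 'n)"
  by (rule inv_eqI) simp_all

lemma inv_inv [simp]: "g \<in> G \<Longrightarrow> matrix_inv (matrix_inv g) = g"
  by (rule inv_eqI) simp_all

lemma inv_vec_right [simp]: "g \<in> G \<Longrightarrow> g *v (matrix_inv g *v v) = v"
  by (simp add: matrix_vector_mul_assoc)

lemma sum_left_translate: "m \<in> G \<Longrightarrow> (\<Sum>g\<in>G. F (m ** g)) = (\<Sum>g\<in>G. F g)"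
  by (rule sum.reindex_bij_witness[where i = "\<lambda>g. matrix_inv m ** g" and j = "\<lambda>g. m ** g"]) auto

lemma sum_right_translate: "m \<in> G \<Longrightarrow> (\<Sum>g\<in>G. F (g ** m)) = (\<Sum>g\<in>G. F g)"
  by (rule sum.reindex_bij_witness[where i = "\<lambda>g. g ** matrix_inv m" and j = "\<lambda>g. g ** m"]) auto

lemma alpha_nonzero [simp]: "g \<in> G \<Longrightarrow> h \<in> G \<Longrightarrow> \<alpha> g h \<noteq> 0"
  using cocycle by (simp add: normalized_two_cocycle_def)

lemma alpha_cocycle:
  "g \<in> G \<Longrightarrow> h \<in> G \<Longrightarrow> k \<in> G \<Longrightarrow> \<alpha> g h * \<alpha> (g ** h) k = \<alpha> h k * \<alpha> g (h ** k)"
  using cocycle by (simp add: normalized_two_cocycle_def GL_def)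

lemma alpha_one [simp]: "g \<in> G \<Longrightarrow> \<alpha> (mat 1) g = 1" "g \<in> G \<Longrightarrow> \<alpha> g (mat 1) = 1"
  using cocycle by (simp_all add: normalized_two_cocycle_def GL_def)

text \<open>The product of the crossed product at the component \<open>k\<close>, with the pairs of
  product \<open>k\<close> parametrized by their first member. Working with this sum of numbers
  keeps the computations free of carrier conditions; \<open>mult_R\<close> makes the
  connection.\<close>

definition cmul :: "(complex ^ 'n ^ 'n \<Rightarrow> 'n list \<Rightarrow> complex) \<Rightarrow> (complex ^ 'n ^ 'n \<Rightarrow> 'n list \<Rightarrow> complex)
    \<Rightarrow> complex ^ 'n ^ 'n \<Rightarrow> 'n list \<Rightarrow> complex" where
  "cmul x y k w = (\<Sum>g\<in>G. \<alpha> g (matrix_inv g ** k)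
     * tmul (x g) (tensor_act g (y (matrix_inv g ** k))) w)"

lemma cmul_cong:
  "(\<And>g. g \<in> G \<Longrightarrow> x g = x' g) \<Longrightarrow> (\<And>g. g \<in> G \<Longrightarrow> y g = y' g) \<Longrightarrow> k \<in> G
    \<Longrightarrow> cmul x y k = cmul x' y' k"
  by (rule ext) (auto simp: cmul_def intro!: sum.cong)

text \<open>After the substitution \<open>m = g ** h\<close> both sides are sums over
  \<open>g\<close> and \<open>h\<close> of the same tensors, with
  \<open>l = matrix_inv h ** (matrix_inv g ** k)\<close>. The weights are
  \<open>\<alpha> g h * \<alpha> (g ** h) l\<close> on the left and
  \<open>\<alpha> h l * \<alpha> g (h ** l)\<close> on the right, and these are equated by the
  cocycle identity.\<close>

lemma cmul_assoc:
  assumes k: "k \<in> G"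
  shows "cmul (cmul x y) z k w = cmul x (cmul y z) k w"
proof -
  let ?T = "\<lambda>g h l. tmul (tmul (x g) (tensor_act g (y h))) (tensor_act (g ** h) (z l)) w"
  have "cmul (cmul x y) z k w = (\<Sum>m\<in>G. \<Sum>g\<in>G. \<alpha> m (matrix_inv m ** k)
      * (\<alpha> g (matrix_inv g ** m) * tmul (tmul (x g) (tensor_act g (y (matrix_inv g ** m))))
           (tensor_act m (z (matrix_inv m ** k))) w))"
    unfolding cmul_def by (simp add: tmul_sum_left tmul_scale_left sum_distrib_left)
  also have "\<dots> = (\<Sum>g\<in>G. \<Sum>m\<in>G. \<alpha> m (matrix_inv m ** k)
      * (\<alpha> g (matrix_inv g ** m) * tmul (tmul (x g) (tensor_act g (y (matrix_inv g ** m))))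
           (tensor_act m (z (matrix_inv m ** k))) w))"
    by (rule sum.swap)
  also have "\<dots> = (\<Sum>g\<in>G. \<Sum>h\<in>G. \<alpha> (g ** h) (matrix_inv h ** (matrix_inv g ** k))
      * (\<alpha> g h * ?T g h (matrix_inv h ** (matrix_inv g ** k))))"
    by (rule sum.cong[OF refl], subst sum_left_translate[symmetric])
       (auto simp: inv_mult matrix_mul_assoc[symmetric] intro!: sum.cong)
  also have "\<dots> = (\<Sum>g\<in>G. \<Sum>h\<in>G. \<alpha> g (matrix_inv g ** k)
      * (\<alpha> h (matrix_inv h ** (matrix_inv g ** k)) * ?T g h (matrix_inv h ** (matrix_inv g ** k))))"
  proof (intro sum.cong refl)
    fix g h assume "g \<in> G" "h \<in> G"
    then show "\<alpha> (g ** h) (matrix_inv h ** (matrix_inv g ** k))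
      * (\<alpha> g h * ?T g h (matrix_inv h ** (matrix_inv g ** k)))
      = \<alpha> g (matrix_inv g ** k)
      * (\<alpha> h (matrix_inv h ** (matrix_inv g ** k)) * ?T g h (matrix_inv h ** (matrix_inv g ** k)))"
      using alpha_cocycle[of g h "matrix_inv h ** (matrix_inv g ** k)"] k
      by (simp add: algebra_simps)
  qed
  also have "\<dots> = cmul x (cmul y z) k w"
    unfolding cmul_def
    by (simp add: tmul_sum_right tmul_scale_right tensor_act_sum[abs_def] tensor_act_scale[abs_def]
        sum_distrib_left tensor_act_tmul tensor_act_mult tmul_assoc)
  finally show ?thesis .
qed

lemma carrier_R: "carrier R = G \<rightarrow>\<^sub>E tensors"
  by (simp add: tensor_crossed_def crossed_product_def)

lemma R_tensors: "x \<in> carrier R \<Longrightarrow> g \<in> G \<Longrightarrow> x g \<in> tensors"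
  by (auto simp: carrier_R)

lemma zero_R: "\<zero>\<^bsub>R\<^esub> = (\<lambda>k\<in>G. \<lambda>w. 0)"
  by (simp add: tensor_crossed_def crossed_product_def)

lemma one_R: "\<one>\<^bsub>R\<^esub> = (\<lambda>k\<in>G. if k = mat 1 then word [] else (\<lambda>w. 0))"
  by (simp add: tensor_crossed_def crossed_product_def GL_def cong: if_cong)

lemma add_R: "x \<oplus>\<^bsub>R\<^esub> y = (\<lambda>k\<in>G. \<lambda>w. x k w + y k w)"
  by (simp add: tensor_crossed_def crossed_product_def)

lemma smult_R: "c \<odot>\<^bsub>R\<^esub> x = (\<lambda>k\<in>G. \<lambda>w. c * x k w)"
  by (simp add: tensor_crossed_def crossed_product_def)

lemma mult_R:
  assumes "x \<in> carrier R" "y \<in> carrier R"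
  shows "x \<otimes>\<^bsub>R\<^esub> y = (\<lambda>k\<in>G. cmul x y k)"
proof -
  let ?A = "\<lambda>k. {(g, h). g \<in> G \<and> h \<in> G \<and> g ** h = k}"
  let ?F = "\<lambda>p w. \<alpha> (fst p) (snd p) * tmul (x (fst p)) (tensor_act (fst p) (y (snd p))) w"
  have "(\<Oplus>\<^bsub>tensor_algebra\<^esub>p\<in>?A k. ?F p) = cmul x y k" if k: "k \<in> G" for k
  proof -
    have "finite (?A k)"
      by (rule finite_subset[of _ "G \<times> G"]) auto
    then have "(\<Oplus>\<^bsub>tensor_algebra\<^esub>p\<in>?A k. ?F p) = (\<lambda>w. \<Sum>p\<in>?A k. ?F p w)"
      by (intro finsum_tensor_algebra)
         (auto intro!: tensors_scale tensors_tmul tensors_act assms[THEN R_tensors])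
    also have "\<dots> = cmul x y k"
      unfolding cmul_def
    proof
      fix w
      show "(\<Sum>p\<in>?A k. ?F p w) = (\<Sum>g\<in>G. \<alpha> g (matrix_inv g ** k)
          * tmul (x g) (tensor_act g (y (matrix_inv g ** k))) w)"
        by (rule sum.reindex_bij_witness[where j = fst and i = "\<lambda>g. (g, matrix_inv g ** k)"])
           (use k in auto)
    qed
    finally show ?thesis .
  qed
  then show ?thesis
    by (simp add: tensor_crossed_def crossed_product_def GL_def cong: restrict_cong)
qed

lemma cmul_tensors:
  assumes "x \<in> carrier R" "y \<in> carrier R" "k \<in> G"
  shows "cmul x y k \<in> tensors"
  unfolding cmul_def
  by (intro tensors_sum tensors_scale tensors_tmul tensors_act assms(1,2)[THEN R_tensors])
     (simp_all add: assms(3))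

lemma mult_R_closed: "x \<in> carrier R \<Longrightarrow> y \<in> carrier R \<Longrightarrow> x \<otimes>\<^bsub>R\<^esub> y \<in> carrier R"
  by (simp add: mult_R) (simp add: carrier_R cmul_tensors[unfolded carrier_R])

lemma R_eqI:
  "x \<in> carrier R \<Longrightarrow> y \<in> carrier R \<Longrightarrow> (\<And>g w. g \<in> G \<Longrightarrow> x g w = y g w) \<Longrightarrow> x = y"
  unfolding carrier_R by (rule PiE_ext) (auto simp: fun_eq_iff)

lemma add_R_closed: "x \<in> carrier R \<Longrightarrow> y \<in> carrier R \<Longrightarrow> x \<oplus>\<^bsub>R\<^esub> y \<in> carrier R"
  by (auto simp: add_R carrier_R intro!: tensors_add)

lemma zero_R_closed: "\<zero>\<^bsub>R\<^esub> \<in> carrier R"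
  by (auto simp: zero_R carrier_R)

lemma one_R_closed: "\<one>\<^bsub>R\<^esub> \<in> carrier R"
  by (auto simp: one_R carrier_R)

lemma smult_R_closed: "x \<in> carrier R \<Longrightarrow> c \<odot>\<^bsub>R\<^esub> x \<in> carrier R"
  by (auto simp: smult_R carrier_R intro!: tensors_scale)

lemma cmul_delta_left:
  assumes "h \<in> G" "k \<in> G"
  shows "cmul (\<lambda>g\<in>G. if g = h then f else (\<lambda>w. 0)) y k w
    = \<alpha> h (matrix_inv h ** k) * tmul f (tensor_act h (y (matrix_inv h ** k))) w"
proof -
  have "cmul (\<lambda>g\<in>G. if g = h then f else (\<lambda>w. 0)) y k w
     = (\<Sum>g\<in>G. if g = h then \<alpha> h (matrix_inv h ** k)
          * tmul f (tensor_act h (y (matrix_inv h ** k))) w else 0)"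
    unfolding cmul_def by (rule sum.cong) auto
  then show ?thesis using assms by simp
qed

lemma cmul_delta_right:
  assumes "h \<in> G" "k \<in> G"
  shows "cmul x (\<lambda>g\<in>G. if g = h then f else (\<lambda>w. 0)) k w
    = \<alpha> (k ** matrix_inv h) h * tmul (x (k ** matrix_inv h)) (tensor_act (k ** matrix_inv h) f) w"
proof -
  let ?y = "\<lambda>g\<in>G. if g = h then f else (\<lambda>w. 0)"
  have "\<alpha> g (matrix_inv g ** k) * tmul (x g) (tensor_act g (?y (matrix_inv g ** k))) w
      = (if g = k ** matrix_inv h then \<alpha> (k ** matrix_inv h) h
         * tmul (x (k ** matrix_inv h)) (tensor_act (k ** matrix_inv h) f) w else 0)"
    if g: "g \<in> G" for g
  proof (cases "matrix_inv g ** k = h")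
    case True
    then have "g ** h = k" using g by auto
    then have "g = k ** matrix_inv h" using inv_cancel_right'[OF assms(1), of g] by simp
    with True show ?thesis using g assms by simp
  next
    case False
    then have "g \<noteq> k ** matrix_inv h" using assms by (auto simp: inv_mult matrix_mul_assoc[symmetric])
    with False show ?thesis using g assms by (simp add: tensor_act_0[abs_def])
  qed
  then have "cmul x ?y k w
     = (\<Sum>g\<in>G. if g = k ** matrix_inv h then \<alpha> (k ** matrix_inv h) h
         * tmul (x (k ** matrix_inv h)) (tensor_act (k ** matrix_inv h) f) w else 0)"
    unfolding cmul_def by (intro sum.cong) auto
  then show ?thesis using assms by simp
qed

lemma cmul_one_left: "k \<in> G \<Longrightarrow> cmul (\<lambda>g\<in>G. if g = mat 1 then word [] else (\<lambda>w. 0)) y k = y k"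
  by (rule ext) (simp add: cmul_delta_left)

lemma cmul_one_right: "k \<in> G \<Longrightarrow> cmul x (\<lambda>g\<in>G. if g = mat 1 then word [] else (\<lambda>w. 0)) k = x k"
  by (rule ext) (simp add: cmul_delta_right)

lemma cmul_add_left: "k \<in> G \<Longrightarrow> cmul (\<lambda>g\<in>G. \<lambda>w. x g w + y g w) z k w = cmul x z k w + cmul y z k w"
  by (simp add: cmul_def tmul_add_left distrib_left sum.distrib)

lemma cmul_add_right: "k \<in> G \<Longrightarrow> cmul z (\<lambda>g\<in>G. \<lambda>w. x g w + y g w) k w = cmul z x k w + cmul z y k w"
  by (simp add: cmul_def tensor_act_add[abs_def] tmul_add_right distrib_left sum.distrib)

lemma ring_R: "ring R"
proof (rule ringI)
  show "abelian_group R"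
  proof (rule abelian_groupI)
    fix x assume x: "x \<in> carrier R"
    show "\<exists>y\<in>carrier R. y \<oplus>\<^bsub>R\<^esub> x = \<zero>\<^bsub>R\<^esub>"
      by (rule bexI[OF _ smult_R_closed[OF x, of "-1"]])
         (simp add: smult_R add_R zero_R cong: restrict_cong)
  next
    fix x assume x: "x \<in> carrier R"
    then show "\<zero>\<^bsub>R\<^esub> \<oplus>\<^bsub>R\<^esub> x = x"
      by (intro R_eqI add_R_closed zero_R_closed) (simp_all add: add_R zero_R)
  qed (simp_all add: zero_R_closed add_R_closed, simp_all add: add_R ac_simps cong: restrict_cong)
  show "Group.monoid R"
  proof (rule monoidI)
    fix x y z assume c: "x \<in> carrier R" "y \<in> carrier R" "z \<in> carrier R"
    show "x \<otimes>\<^bsub>R\<^esub> y \<otimes>\<^bsub>R\<^esub> z = x \<otimes>\<^bsub>R\<^esub> (y \<otimes>\<^bsub>R\<^esub> z)"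
    proof (rule R_eqI)
      fix k w assume k: "k \<in> G"
      have "(x \<otimes>\<^bsub>R\<^esub> y \<otimes>\<^bsub>R\<^esub> z) k w = cmul (x \<otimes>\<^bsub>R\<^esub> y) z k w"
        using c k by (simp add: mult_R[of "x \<otimes>\<^bsub>R\<^esub> y"] mult_R_closed)
      also have "\<dots> = cmul (cmul x y) z k w"
        using c k by (subst cmul_cong[of _ "cmul x y" z z]) (simp_all add: mult_R)
      also have "\<dots> = cmul x (cmul y z) k w" using k by (rule cmul_assoc)
      also have "\<dots> = cmul x (y \<otimes>\<^bsub>R\<^esub> z) k w"
        using c k by (subst cmul_cong[of x x _ "y \<otimes>\<^bsub>R\<^esub> z"]) (simp_all add: mult_R)
      also have "\<dots> = (x \<otimes>\<^bsub>R\<^esub> (y \<otimes>\<^bsub>R\<^esub> z)) k w"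
        using c k by (simp add: mult_R[of x] mult_R_closed)
      finally show "(x \<otimes>\<^bsub>R\<^esub> y \<otimes>\<^bsub>R\<^esub> z) k w = (x \<otimes>\<^bsub>R\<^esub> (y \<otimes>\<^bsub>R\<^esub> z)) k w" .
    qed (simp_all add: mult_R_closed c)
  next
    fix x assume x: "x \<in> carrier R"
    show "\<one>\<^bsub>R\<^esub> \<otimes>\<^bsub>R\<^esub> x = x"
      by (intro R_eqI mult_R_closed one_R_closed x, simp add: one_R_closed x mult_R)
         (simp add: one_R cmul_one_left)
    show "x \<otimes>\<^bsub>R\<^esub> \<one>\<^bsub>R\<^esub> = x"
      by (intro R_eqI mult_R_closed one_R_closed x, simp add: one_R_closed x mult_R)
         (simp add: one_R cmul_one_right)
  qed (simp_all add: mult_R_closed one_R_closed)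
next
  fix x y z assume c: "x \<in> carrier R" "y \<in> carrier R" "z \<in> carrier R"
  show "(x \<oplus>\<^bsub>R\<^esub> y) \<otimes>\<^bsub>R\<^esub> z = x \<otimes>\<^bsub>R\<^esub> z \<oplus>\<^bsub>R\<^esub> y \<otimes>\<^bsub>R\<^esub> z"
    by (intro R_eqI mult_R_closed add_R_closed c, simp add: c add_R_closed mult_R)
       (simp add: add_R cmul_add_left c mult_R)
  show "z \<otimes>\<^bsub>R\<^esub> (x \<oplus>\<^bsub>R\<^esub> y) = z \<otimes>\<^bsub>R\<^esub> x \<oplus>\<^bsub>R\<^esub> z \<otimes>\<^bsub>R\<^esub> y"
    by (intro R_eqI mult_R_closed add_R_closed c, simp add: c add_R_closed mult_R)
       (simp add: add_R cmul_add_right c mult_R)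
qed

lemma finsum_R:
  assumes "finite A" "\<And>x. x \<in> A \<Longrightarrow> F x \<in> carrier R"
  shows "(\<Oplus>\<^bsub>R\<^esub>x\<in>A. F x) = (\<lambda>k\<in>G. \<lambda>w. \<Sum>x\<in>A. F x k w)"
proof -
  interpret R: ring R by (rule ring_R)
  show ?thesis using assms
  proof (induction A rule: finite_induct)
    case empty
    then show ?case by (simp add: R.finsum_empty zero_R cong: restrict_cong)
  next
    case (insert x A)
    then have "(\<Oplus>\<^bsub>R\<^esub>x\<in>insert x A. F x) = F x \<oplus>\<^bsub>R\<^esub> (\<Oplus>\<^bsub>R\<^esub>x\<in>A. F x)"
      by (intro R.finsum_insert) (auto simp: Pi_def)
    with insert show ?case by (simp add: add_R cong: restrict_cong)
  qed
qed

section \<open>Polynomials in the central indeterminate\<close>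

lemma carrier_P: "carrier P = up R"
  by (simp add: poly_algebra_def UP_def)

lemma P_R: "x \<in> carrier P \<Longrightarrow> x i \<in> carrier R"
  by (auto simp: carrier_P)

lemma P_tensors: "x \<in> carrier P \<Longrightarrow> g \<in> G \<Longrightarrow> x i g \<in> tensors"
  by (rule R_tensors[OF P_R])

lemma P_bound: "x \<in> carrier P \<Longrightarrow> \<exists>n. \<forall>i>n. x i = \<zero>\<^bsub>R\<^esub>"
  unfolding carrier_P up_def bound_def by simp

lemma P_I: "(\<And>i. x i \<in> carrier R) \<Longrightarrow> (\<And>i. n < i \<Longrightarrow> x i = \<zero>\<^bsub>R\<^esub>) \<Longrightarrow> x \<in> carrier P"
  unfolding carrier_P by (intro mem_upI exI[of _ n] bound.intro) auto

lemma P_eqI: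
  "x \<in> carrier P \<Longrightarrow> y \<in> carrier P \<Longrightarrow> (\<And>i g w. g \<in> G \<Longrightarrow> x i g w = y i g w) \<Longrightarrow> x = y"
  by (rule ext, rule R_eqI) (auto intro: P_R)

lemma ring_UP: "ring (UP R)"
  by (rule UP_ring.UP_ring) (simp add: UP_ring_def ring_R)

lemma ring_P: "ring P"
proof -
  interpret U: ring "UP R" by (rule ring_UP)
  have eqs: "carrier P = carrier (UP R)" "mult P = mult (UP R)" "one P = one (UP R)"
    "zero P = zero (UP R)" "add P = add (UP R)"
    by (simp_all add: poly_algebra_def)
  show ?thesis
  proof (rule ringI)
    show "abelian_group P"
    proof (rule abelian_groupI)
      fix x assume "x \<in> carrier P"
      then show "\<exists>y\<in>carrier P. y \<oplus>\<^bsub>P\<^esub> x = \<zero>\<^bsub>P\<^esub>"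
        by (intro bexI[of _ "\<ominus>\<^bsub>UP R\<^esub> x"]) (simp_all add: eqs U.l_neg)
    qed (simp_all add: eqs U.add.m_ac)
    show "Group.monoid P"
      by (rule monoidI) (auto simp: eqs U.m_assoc)
  qed (auto simp: eqs U.l_distr U.r_distr)
qed

lemma add_P:
  "x \<in> carrier P \<Longrightarrow> y \<in> carrier P \<Longrightarrow> x \<oplus>\<^bsub>P\<^esub> y = (\<lambda>i. \<lambda>k\<in>G. \<lambda>w. x i k w + y i k w)"
  unfolding carrier_P by (simp add: poly_algebra_def UP_def add_R)

lemma zero_P: "\<zero>\<^bsub>P\<^esub> = (\<lambda>i. \<lambda>k\<in>G. \<lambda>w. 0)"
  by (simp add: poly_algebra_def UP_def zero_R)

lemma mult_P:
  assumes "x \<in> carrier P" "y \<in> carrier P" "k \<in> G"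
  shows "(x \<otimes>\<^bsub>P\<^esub> y) n k w = (\<Sum>j\<le>n. cmul (x j) (y (n - j)) k w)"
proof -
  have "(x \<otimes>\<^bsub>P\<^esub> y) n = (\<Oplus>\<^bsub>R\<^esub>j\<in>{..n}. x j \<otimes>\<^bsub>R\<^esub> y (n - j))"
    using assms unfolding carrier_P by (simp add: poly_algebra_def UP_def)
  also have "\<dots> = (\<lambda>k\<in>G. \<lambda>w. \<Sum>j\<le>n. (x j \<otimes>\<^bsub>R\<^esub> y (n - j)) k w)"
    using assms by (intro finsum_R mult_R_closed P_R) auto
  finally show ?thesis using assms by (simp add: mult_R P_R)
qed

lemma smult_P:
  assumes "x \<in> carrier P"
  shows "p \<odot>\<^bsub>P\<^esub> x = (\<lambda>n. \<lambda>k\<in>G. \<lambda>w. \<Sum>i\<le>n. Polynomial.coeff p i * x (n - i) k w)"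
proof
  fix n
  have "(p \<odot>\<^bsub>P\<^esub> x) n = (\<Oplus>\<^bsub>R\<^esub>i\<in>{..n}. Polynomial.coeff p i \<odot>\<^bsub>R\<^esub> x (n - i))"
    by (simp add: poly_algebra_def)
  also have "\<dots> = (\<lambda>k\<in>G. \<lambda>w. \<Sum>i\<le>n. (Polynomial.coeff p i \<odot>\<^bsub>R\<^esub> x (n - i)) k w)"
    using assms by (intro finsum_R smult_R_closed P_R) auto
  finally show "(p \<odot>\<^bsub>P\<^esub> x) n = (\<lambda>k\<in>G. \<lambda>w. \<Sum>i\<le>n. Polynomial.coeff p i * x (n - i) k w)"
    by (simp add: smult_R cong: restrict_cong)
qed

lemma add_P_closed: "x \<in> carrier P \<Longrightarrow> y \<in> carrier P \<Longrightarrow> x \<oplus>\<^bsub>P\<^esub> y \<in> carrier P"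
  using ring_P by (simp add: ring.ring_simprules)

lemma mult_P_closed: "x \<in> carrier P \<Longrightarrow> y \<in> carrier P \<Longrightarrow> x \<otimes>\<^bsub>P\<^esub> y \<in> carrier P"
  using ring_P by (simp add: ring.ring_simprules)

lemma finsum_P:
  assumes "finite A" "\<And>a. a \<in> A \<Longrightarrow> F a \<in> carrier P"
  shows "(\<Oplus>\<^bsub>P\<^esub>a\<in>A. F a) = (\<lambda>i. \<lambda>k\<in>G. \<lambda>w. \<Sum>a\<in>A. F a i k w)"
proof -
  interpret P: ring P by (rule ring_P)
  show ?thesis using assms
  proof (induction A rule: finite_induct)
    case empty
    then show ?case by (simp add: P.finsum_empty zero_P cong: restrict_cong)
  next
    case (insert x A)
    then have "(\<Oplus>\<^bsub>P\<^esub>a\<in>insert x A. F a) = F x \<oplus>\<^bsub>P\<^esub> (\<Oplus>\<^bsub>P\<^esub>a\<in>A. F a)"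
      by (intro P.finsum_insert) (auto simp: Pi_def)
    also have "\<dots> = (\<lambda>i. \<lambda>k\<in>G. \<lambda>w. F x i k w + (\<Oplus>\<^bsub>P\<^esub>a\<in>A. F a) i k w)"
      using insert by (intro add_P P.finsum_closed) auto
    finally show ?case using insert by (simp cong: restrict_cong)
  qed
qed

text \<open>The monomial with tensor \<open>f\<close>, group element \<open>h\<close> and power
  \<open>n\<close> of the indeterminate. Such elements generate the polynomial algebra additively
  (\<open>P_induct\<close>) and are closed under products (\<open>tmon_mult\<close>), so identities
  and ideal membership are checked on them.\<close>

definition tmon :: "nat \<Rightarrow> complex ^ 'n ^ 'n \<Rightarrow> ('n list \<Rightarrow> complex) \<Rightarrow> nat \<Rightarrow> complex ^ 'n ^ 'n \<Rightarrow> 'n list \<Rightarrow> complex" where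
  "tmon n h f = (\<lambda>i. \<lambda>g\<in>G. if i = n \<and> g = h then f else (\<lambda>w. 0))"

lemma tmon_closed: "f \<in> tensors \<Longrightarrow> tmon n h f \<in> carrier P"
  by (rule P_I[of _ n]) (auto simp: tmon_def carrier_R zero_R)

lemma tmon_apply: "g \<in> G \<Longrightarrow> tmon n h f i g w = (if i = n \<and> g = h then f w else 0)"
  by (simp add: tmon_def)

lemma tmon_add:
  "f \<in> tensors \<Longrightarrow> f' \<in> tensors \<Longrightarrow> tmon n h f \<oplus>\<^bsub>P\<^esub> tmon n h f' = tmon n h (\<lambda>w. f w + f' w)"
  by (intro P_eqI add_P_closed tmon_closed tensors_add) (simp_all add: add_P tmon_closed tmon_apply)

lemma tmon_eq: "tmon n h f i = (if i = n then \<lambda>g\<in>G. if g = h then f else (\<lambda>w. 0) else (\<lambda>g\<in>G. \<lambda>w. 0))"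
  by (auto simp: tmon_def)

lemma cmul_zero_left: "k \<in> G \<Longrightarrow> cmul (\<lambda>g\<in>G. \<lambda>w. 0) y k w = 0"
  by (simp add: cmul_def)

lemma cmul_zero_right: "k \<in> G \<Longrightarrow> cmul y (\<lambda>g\<in>G. \<lambda>w. 0) k w = 0"
  by (simp add: cmul_def tensor_act_0[abs_def])

lemma tmon_mult_left:
  assumes "f \<in> tensors" "h \<in> G" "y \<in> carrier P" "k \<in> G"
  shows "(tmon m h f \<otimes>\<^bsub>P\<^esub> y) n k w = (if m \<le> n then \<alpha> h (matrix_inv h ** k)
     * tmul f (tensor_act h (y (n - m) (matrix_inv h ** k))) w else 0)"
proof -
  have "(tmon m h f \<otimes>\<^bsub>P\<^esub> y) n k w = (\<Sum>j\<le>n. cmul (tmon m h f j) (y (n - j)) k w)"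
    using assms by (intro mult_P tmon_closed) auto
  also have "\<dots> = (\<Sum>j\<le>n. if j = m then \<alpha> h (matrix_inv h ** k)
     * tmul f (tensor_act h (y (n - m) (matrix_inv h ** k))) w else 0)"
    using assms by (intro sum.cong) (auto simp: tmon_eq cmul_delta_left cmul_zero_left)
  finally show ?thesis by simp
qed

lemma tmon_mult_right:
  assumes "f \<in> tensors" "h \<in> G" "x \<in> carrier P" "k \<in> G"
  shows "(x \<otimes>\<^bsub>P\<^esub> tmon m h f) n k w = (if m \<le> n then \<alpha> (k ** matrix_inv h) h
     * tmul (x (n - m) (k ** matrix_inv h)) (tensor_act (k ** matrix_inv h) f) w else 0)"
proof -
  have "(x \<otimes>\<^bsub>P\<^esub> tmon m h f) n k w = (\<Sum>j\<le>n. cmul (x j) (tmon m h f (n - j)) k w)"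
    using assms by (intro mult_P tmon_closed) auto
  also have "\<dots> = (\<Sum>j\<le>n. cmul (x (n - j)) (tmon m h f j) k w)"
    by (subst sum.nat_diff_reindex[symmetric, of _ "Suc n", unfolded lessThan_Suc_atMost]) simp
  also have "\<dots> = (\<Sum>j\<le>n. if j = m then \<alpha> (k ** matrix_inv h) h
     * tmul (x (n - m) (k ** matrix_inv h)) (tensor_act (k ** matrix_inv h) f) w else 0)"
    using assms by (intro sum.cong) (auto simp: tmon_eq cmul_delta_right cmul_zero_right)
  finally show ?thesis by simp
qed

lemma tmon_mult:
  assumes "f \<in> tensors" "f' \<in> tensors" "h \<in> G" "k \<in> G"
  shows "tmon n h f \<otimes>\<^bsub>P\<^esub> tmon m k f'
    = tmon (n + m) (h ** k) (\<lambda>w. \<alpha> h k * tmul f (tensor_act h f') w)"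
proof (intro P_eqI mult_P_closed tmon_closed tensors_scale tensors_tmul tensors_act assms)
  fix i g w assume g: "g \<in> G"
  have "matrix_inv h ** g = k \<longleftrightarrow> g = h ** k"
    using assms(3) inv_cancel_left'[of h g] by auto
  then show "(tmon n h f \<otimes>\<^bsub>P\<^esub> tmon m k f') i g w
      = tmon (n + m) (h ** k) (\<lambda>w. \<alpha> h k * tmul f (tensor_act h f') w) i g w"
    using g assms
    by (auto simp: tmon_mult_left tmon_closed tmon_apply tmon_eq tensor_act_0[abs_def])
qed

lemma hecke_vec_eq: "hecke_vec G \<alpha> v = tmon 0 (mat 1) (tensor_vec v)"
proof -
  have "pure_tensor (GL\<lparr>carrier := G\<rparr>) tensor_algebra (tensor_vec v) (mat 1) \<in> carrier R"
    by (auto simp: pure_tensor_def carrier_R)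
  then show ?thesis
    by (auto simp: hecke_vec_def UP_def tmon_def pure_tensor_def zero_R fun_eq_iff)
qed

lemma hecke_group_eq: "hecke_group G \<alpha> c g = tmon 1 g (\<lambda>w. c * word [] w)"
proof -
  have "c \<odot>\<^bsub>R\<^esub> pure_tensor (GL\<lparr>carrier := G\<rparr>) tensor_algebra \<one>\<^bsub>tensor_algebra\<^esub> g \<in> carrier R"
    by (rule smult_R_closed) (auto simp: pure_tensor_def carrier_R)
  then show ?thesis
    by (auto simp: hecke_group_def UP_def tmon_def pure_tensor_def smult_R zero_R fun_eq_iff)
qed

lemma tmon_induct:
  assumes f: "f \<in> tensors"
    and w: "\<And>c w. Q (tmon n h (\<lambda>v. c * word w v))"
    and add: "\<And>x y. x \<in> carrier P \<Longrightarrow> y \<in> carrier P \<Longrightarrow> Q x \<Longrightarrow> Q y \<Longrightarrow> Q (x \<oplus>\<^bsub>P\<^esub> y)"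
  shows "Q (tmon n h f)"
  using f
proof (induction f rule: tensors_induct)
  case (add f g)
  then show ?case using assms(3)[of "tmon n h f" "tmon n h g"] by (simp add: tmon_add tmon_closed)
qed (rule w)

text \<open>Truncations of \<open>x\<close> to finite sets of pairs of a power and a group element
  are built up one pair at a time. As the degree in the indeterminate is bounded and the group is
  finite, some truncation is \<open>x\<close> itself.\<close>

lemma P_induct [consumes 1, case_names tmon add]:
  assumes x: "x \<in> carrier P"
    and w: "\<And>n h c w. h \<in> G \<Longrightarrow> Q (tmon n h (\<lambda>v. c * word w v))"
    and add: "\<And>x y. x \<in> carrier P \<Longrightarrow> y \<in> carrier P \<Longrightarrow> Q x \<Longrightarrow> Q y \<Longrightarrow> Q (x \<oplus>\<^bsub>P\<^esub> y)"
  shows "Q x"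
proof -
  let ?X = "\<lambda>S i. \<lambda>g\<in>G. if (i, g) \<in> S then x i g else (\<lambda>w. 0)"
  have clo: "?X S \<in> carrier P" for S
  proof -
    obtain n where n: "\<And>i. n < i \<Longrightarrow> x i = \<zero>\<^bsub>R\<^esub>" using P_bound[OF x] by blast
    show ?thesis
      by (rule P_I[of _ n]) (auto simp: carrier_R n zero_R P_tensors[OF x])
  qed
  have *: "finite S \<Longrightarrow> S \<subseteq> UNIV \<times> G \<Longrightarrow> Q (?X S)" for S
  proof (induction S rule: finite_induct)
    case empty
    have "?X {} = tmon 0 (mat 1) (\<lambda>v. 0 * word [] v)" by (auto simp: tmon_def fun_eq_iff)
    then show ?case using w[OF one_G, of 0 0 "[]"] by (simp only:)
  next
    case (insert p S)
    obtain n h where p: "p = (n, h)" by fastforce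
    have h: "h \<in> G" using insert p by auto
    have "?X (insert p S) = ?X S \<oplus>\<^bsub>P\<^esub> tmon n h (x n h)"
      using insert p
      by (intro P_eqI add_P_closed clo tmon_closed P_tensors[OF x] h)
         (auto simp: add_P clo tmon_closed P_tensors[OF x] tmon_apply)
    moreover have "Q (tmon n h (x n h))"
      by (rule tmon_induct[of _ Q, OF P_tensors[OF x h] w[OF h] add])
    moreover have "Q (?X S)" using insert(4) by (intro insert(3)) blast
    ultimately show ?case
      using add[OF clo tmon_closed[OF P_tensors[OF x h]]] by (simp only:)
  qed
  obtain n where n: "\<And>i. n < i \<Longrightarrow> x i = \<zero>\<^bsub>R\<^esub>" using P_bound[OF x] by blast
  have "?X ({..n} \<times> G) = x"
    by (intro P_eqI clo x) (auto simp: n zero_R not_le)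
  moreover have "Q (?X ({..n} \<times> G))" by (rule *) auto
  ultimately show ?thesis by simp
qed

lemma minus_P:
  assumes "x \<in> carrier P" "y \<in> carrier P" "k \<in> G"
  shows "(x \<ominus>\<^bsub>P\<^esub> y) i k w = x i k w - y i k w"
proof -
  interpret P: ring P by (rule ring_P)
  have *: "x \<ominus>\<^bsub>P\<^esub> y \<in> carrier P" using assms by simp
  have "(x \<ominus>\<^bsub>P\<^esub> y) \<oplus>\<^bsub>P\<^esub> y = x"
    using assms by (simp add: a_minus_def P.a_assoc P.l_neg)
  then have "((x \<ominus>\<^bsub>P\<^esub> y) \<oplus>\<^bsub>P\<^esub> y) i k w = x i k w" by simp
  then show ?thesis using assms * by (simp add: add_P algebra_simps)
qed

lemma minus_P_closed: "x \<in> carrier P \<Longrightarrow> y \<in> carrier P \<Longrightarrow> x \<ominus>\<^bsub>P\<^esub> y \<in> carrier P"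
  using ring_P by (simp add: ring.ring_simprules)

text \<open>A scalar polynomial acts as multiplication by its image in the algebra, supported at the
  identity matrix. Consequently every two-sided ideal is closed under scalars, which the quotient
  algebra requires.\<close>

lemma smult_P_mult:
  assumes "x \<in> carrier P"
  shows "\<exists>c\<in>carrier P. p \<odot>\<^bsub>P\<^esub> x = c \<otimes>\<^bsub>P\<^esub> x"
proof
  let ?c = "\<lambda>i. \<lambda>g\<in>G. if g = mat 1 then (\<lambda>w. Polynomial.coeff p i * word [] w) else (\<lambda>w. 0)"
  show c: "?c \<in> carrier P"
    by (rule P_I[of _ "degree p"]) (auto simp: carrier_R zero_R coeff_eq_0 intro!: tensors_scale)
  have tm: "tmul (\<lambda>w. a * word [] w) f w = a * f w" for a f w
    by (simp add: tmul_scale_left)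
  show "p \<odot>\<^bsub>P\<^esub> x = ?c \<otimes>\<^bsub>P\<^esub> x"
  proof (rule ext, rule R_eqI)
    fix n
    show "(?c \<otimes>\<^bsub>P\<^esub> x) n \<in> carrier R" by (intro P_R mult_P_closed c assms)
    show "(p \<odot>\<^bsub>P\<^esub> x) n \<in> carrier R"
      using assms
      by (auto simp: smult_P carrier_R intro!: tensors_sum tensors_scale P_tensors[OF assms])
    fix g w assume "g \<in> G"
    then show "(p \<odot>\<^bsub>P\<^esub> x) n g w = (?c \<otimes>\<^bsub>P\<^esub> x) n g w"
      using assms by (simp add: smult_P mult_P c cmul_delta_left tm)
  qed
qed

end

section \<open>Quotient algebras\<close>

lemma (in ring) ideal_intro:
  assumes sub: "I \<subseteq> carrier R" and z: "\<zero> \<in> I"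
    and a: "\<And>x y. x \<in> I \<Longrightarrow> y \<in> I \<Longrightarrow> x \<oplus> y \<in> I"
    and l: "\<And>x y. x \<in> I \<Longrightarrow> y \<in> carrier R \<Longrightarrow> y \<otimes> x \<in> I"
    and r: "\<And>x y. x \<in> I \<Longrightarrow> y \<in> carrier R \<Longrightarrow> x \<otimes> y \<in> I"
  shows "ideal I R"
proof (rule idealI)
  show "subgroup I (add_monoid R)"
  proof (rule add.subgroupI)
    fix x assume x: "x \<in> I"
    have "\<ominus> x = (\<ominus> \<one>) \<otimes> x" using x sub by (simp add: l_minus subset_iff)
    then show "\<ominus> x \<in> I" using l[OF x, of "\<ominus> \<one>"] by simp
  qed (use sub z a in auto)
qed (use l r ring_axioms in auto)

lemma carrier_quotient_algebra:
  "carrier (quotient_algebra M I) = (\<lambda>f. I +>\<^bsub>M\<^esub> f) ` carrier M"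
  by (auto simp: quotient_algebra_def FactRing_def A_RCOSETS_def')

lemma add_quotient_algebra:
  assumes "ideal I M" "f \<in> carrier M" "g \<in> carrier M"
  shows "(I +>\<^bsub>M\<^esub> f) \<oplus>\<^bsub>quotient_algebra M I\<^esub> (I +>\<^bsub>M\<^esub> g) = I +>\<^bsub>M\<^esub> (f \<oplus>\<^bsub>M\<^esub> g)"
proof -
  interpret ideal I M by fact
  show ?thesis using assms by (simp add: quotient_algebra_def FactRing_def a_rcos_sum)
qed

text \<open>The scalar multiple of a coset is defined as a union over all its members. Closure of
  the ideal under scalars makes every member contribute the same coset.\<close>

lemma smult_quotient_algebra:
  assumes I: "ideal I M" and f: "f \<in> carrier M"
    and clo: "\<And>x. x \<in> carrier M \<Longrightarrow> c \<odot>\<^bsub>M\<^esub> x \<in> carrier M"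
    and add: "\<And>x y. x \<in> carrier M \<Longrightarrow> y \<in> carrier M \<Longrightarrow> c \<odot>\<^bsub>M\<^esub> (x \<oplus>\<^bsub>M\<^esub> y) = c \<odot>\<^bsub>M\<^esub> x \<oplus>\<^bsub>M\<^esub> c \<odot>\<^bsub>M\<^esub> y"
    and inI: "\<And>x. x \<in> I \<Longrightarrow> c \<odot>\<^bsub>M\<^esub> x \<in> I"
  shows "c \<odot>\<^bsub>quotient_algebra M I\<^esub> (I +>\<^bsub>M\<^esub> f) = I +>\<^bsub>M\<^esub> (c \<odot>\<^bsub>M\<^esub> f)"
proof -
  interpret ideal I M by fact
  have const: "I +>\<^bsub>M\<^esub> (c \<odot>\<^bsub>M\<^esub> x) = I +>\<^bsub>M\<^esub> (c \<odot>\<^bsub>M\<^esub> f)" if x: "x \<in> I +>\<^bsub>M\<^esub> f" for x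
  proof -
    from x obtain h where h: "h \<in> I" and x: "x = h \<oplus>\<^bsub>M\<^esub> f" by (auto simp: a_r_coset_def')
    have hc: "h \<in> carrier M" using h by (rule a_Hcarr)
    have "c \<odot>\<^bsub>M\<^esub> x = c \<odot>\<^bsub>M\<^esub> h \<oplus>\<^bsub>M\<^esub> c \<odot>\<^bsub>M\<^esub> f" using x add[OF hc f] by simp
    then have "c \<odot>\<^bsub>M\<^esub> x \<in> I +>\<^bsub>M\<^esub> (c \<odot>\<^bsub>M\<^esub> f)"
      using inI[OF h] by (auto simp: a_r_coset_def')
    from a_repr_independence[OF this clo[OF f] a_subgroup] show ?thesis by simp
  qed
  have "f \<in> I +>\<^bsub>M\<^esub> f" using f by (rule a_rcos_self)
  then have ne: "I +>\<^bsub>M\<^esub> f \<noteq> {}" by (metis empty_iff)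
  have "c \<odot>\<^bsub>quotient_algebra M I\<^esub> (I +>\<^bsub>M\<^esub> f) = (\<Union>x\<in>I +>\<^bsub>M\<^esub> f. I +>\<^bsub>M\<^esub> (c \<odot>\<^bsub>M\<^esub> x))"
    by (simp add: quotient_algebra_def)
  also have "\<dots> = I +>\<^bsub>M\<^esub> (c \<odot>\<^bsub>M\<^esub> f)" by (rule SUP_eq_const[OF ne const])
  finally show ?thesis .
qed

section \<open>The symmetric algebra\<close>

text \<open>Swaps of neighbours connect any two arrangements of a multiset: a letter travels to its
  place one swap at a time (\<open>move\<close>), and the remaining letters are arranged by
  induction behind a growing prefix \<open>p\<close>.\<close>

lemma mset_swap_induct:
  assumes refl: "\<And>w. E w w" and trans: "\<And>u v w. E u v \<Longrightarrow> E v w \<Longrightarrow> E u w"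
    and swap: "\<And>x a b y. E (x @ a # b # y) (x @ b # a # y)"
    and m: "mset v = mset w"
  shows "E v w"
proof -
  have move: "E (p @ a # x @ y) (p @ x @ a # y)" for p a x y
  proof (induction x arbitrary: p)
    case (Cons d x)
    have "E (p @ a # d # x @ y) (p @ d # a # x @ y)" by (rule swap)
    moreover have "E ((p @ [d]) @ a # x @ y) ((p @ [d]) @ x @ a # y)" by (rule Cons)
    ultimately show ?case using trans by auto
  qed (simp add: refl)
  have "mset v = mset w \<Longrightarrow> E (p @ v) (p @ w)" for p
  proof (induction v arbitrary: p w)
    case (Cons a v)
    then have "a \<in> set w" by (metis list.set_intros(1) set_mset_mset)
    then obtain x y where w: "w = x @ a # y" by (auto simp: in_set_conv_decomp)
    have "mset v = mset (x @ y)" using Cons.prems w by simp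
    from Cons.IH[OF this, of "p @ [a]"] have "E (p @ a # v) (p @ a # x @ y)" by simp
    then show ?case using trans[OF _ move] w by simp
  qed (simp add: refl)
  from this[of "[]"] m show ?thesis by simp
qed

text \<open>The coefficient of the commutative monomial \<open>M\<close> in the image of
  \<open>f\<close> in a polynomial ring. These numbers are coordinates on the symmetric algebra,
  which is given only as a quotient; see \<open>sym_ideal_iff\<close>.\<close>

definition symsum :: "('n list \<Rightarrow> complex) \<Rightarrow> 'n multiset \<Rightarrow> complex" where
  "symsum f M = (\<Sum>w | mset w = M. f w)"

lemma finite_mset_words: "finite {w :: 'n::finite list. mset w = M}"
proof (rule finite_subset)
  show "{w. mset w = M} \<subseteq> {w. length w = size M}" by auto
qed (rule finite_words_length)

lemma symsum_0 [simp]: "symsum (\<lambda>w. 0) = (\<lambda>M. 0)"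
  by (simp add: symsum_def fun_eq_iff)

lemma symsum_add: "symsum (\<lambda>w. f w + g w) = (\<lambda>M. symsum f M + symsum g M)"
  by (simp add: symsum_def sum.distrib fun_eq_iff)

lemma symsum_diff: "symsum (\<lambda>w. f w - g w) = (\<lambda>M. symsum f M - symsum g M)"
  by (simp add: symsum_def sum_subtractf fun_eq_iff)

lemma symsum_scale: "symsum (\<lambda>w. c * f w) = (\<lambda>M. c * symsum f M)"
  by (simp add: symsum_def sum_distrib_left fun_eq_iff)

lemma symsum_sum: "symsum (\<lambda>w. \<Sum>x\<in>A. f x w) = (\<lambda>M. \<Sum>x\<in>A. symsum (f x) M)"
  by (induction A rule: infinite_finite_induct) (simp_all add: symsum_add)

lemma symsum_word:
  "symsum (word (w :: 'n::finite list)) M = (if mset w = M then 1 else 0)"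
  using finite_mset_words[of M] by (simp add: symsum_def word_def)

lemma mset_cong_short: "length w \<le> 1 \<Longrightarrow> {v. mset v = mset w} = {w}"
  by (cases w) auto

lemma symsum_short: "length w \<le> 1 \<Longrightarrow> symsum f (mset w) = f w"
  by (simp add: symsum_def mset_cong_short)

lemma tmul_word_right:
  "tmul f (word y) v = (if \<exists>u. v = u @ y then f (take (length v - length y) v) else 0)"
proof (cases "\<exists>u. v = u @ y")
  case True
  then obtain u where v: "v = u @ y" by blast
  have "drop i v = y \<longleftrightarrow> i = length u" if "i \<le> length v" for i
  proof
    assume "drop i v = y"
    then have "length v - i = length y" using length_drop[of i v] by simp
    then show "i = length u" using that v by simp
  qed (simp add: v)
  then have "tmul f (word y) v = (\<Sum>i\<le>length v. if i = length u then f u else 0)"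
    unfolding tmul_def word_def using v by (intro sum.cong) auto
  then show ?thesis using v by simp
next
  case False
  then have "drop i v \<noteq> y" for i by (metis append_take_drop_id)
  then show ?thesis using False by (simp add: tmul_def word_def)
qed

lemma symsum_tmul_word_left:
  fixes f :: "'n::finite list \<Rightarrow> complex"
  shows "symsum (tmul (word u) f) M = (\<Sum>w | mset u + mset w = M. f w)"
proof -
  have "symsum (tmul (word u) f) M = (\<Sum>v \<in> (\<lambda>w. u @ w) ` {w. mset u + mset w = M}. f (drop (length u) v))"
    unfolding symsum_def
    by (rule sum.mono_neutral_cong_right) (auto simp: tmul_word_left finite_mset_words)
  also have "\<dots> = (\<Sum>w | mset u + mset w = M. f w)"
    by (subst sum.reindex) (auto simp: inj_on_def)
  finally show ?thesis .
qed

lemma symsum_tmul_word_right: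
  fixes f :: "'n::finite list \<Rightarrow> complex"
  shows "symsum (tmul f (word y)) M = (\<Sum>w | mset w + mset y = M. f w)"
proof -
  have "symsum (tmul f (word y)) M
      = (\<Sum>v \<in> (\<lambda>w. w @ y) ` {w. mset w + mset y = M}. f (take (length v - length y) v))"
    unfolding symsum_def
    by (rule sum.mono_neutral_cong_right) (auto simp: tmul_word_right finite_mset_words)
  also have "\<dots> = (\<Sum>w | mset w + mset y = M. f w)"
    by (subst sum.reindex) (auto simp: inj_on_def)
  finally show ?thesis .
qed

text \<open>Division of the monomial \<open>M\<close> by the monomial of \<open>u\<close>: either it
  is impossible, or the quotient is some \<open>M'\<close>. Thus multiplying by a word only shifts
  the coefficients \<open>symsum\<close>.\<close>

lemma mset_add_words:
  "{w. mset u + mset w = M} = {} \<or> (\<exists>M'. {w. mset u + mset w = M} = {w. mset w = M'})"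
proof (cases "mset u \<subseteq># M")
  case True
  then obtain M' where "M = mset u + M'" by (auto simp: mset_subset_eq_exists_conv)
  then show ?thesis by auto
qed auto

lemma symsum_tmul_zero_right:
  fixes f :: "'n::finite list \<Rightarrow> complex"
  assumes f: "symsum f = (\<lambda>M. 0)" and g: "g \<in> tensors"
  shows "symsum (tmul f g) = (\<lambda>M. 0)"
  using g
proof (induction g rule: tensors_induct)
  case (word c w)
  show ?case
  proof
    fix M
    have "(\<Sum>v | mset v + mset w = M. f v) = 0"
      using mset_add_words[of w M] f by (auto simp: symsum_def fun_eq_iff add.commute)
    then show "symsum (tmul f (\<lambda>v. c * word w v)) M = 0"
      by (simp add: tmul_scale_right[abs_def] symsum_scale symsum_tmul_word_right)
  qed
qed (simp add: tmul_add_right[abs_def] symsum_add)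

lemma symsum_tmul_zero_left:
  fixes f :: "'n::finite list \<Rightarrow> complex"
  assumes f: "symsum f = (\<lambda>M. 0)" and g: "g \<in> tensors"
  shows "symsum (tmul g f) = (\<lambda>M. 0)"
  using g
proof (induction g rule: tensors_induct)
  case (word c w)
  show ?case
  proof
    fix M
    have "(\<Sum>v | mset w + mset v = M. f v) = 0"
      using mset_add_words[of w M] f by (auto simp: symsum_def fun_eq_iff)
    then show "symsum (tmul (\<lambda>v. c * word w v) f) M = 0"
      by (simp add: tmul_scale_left[abs_def] symsum_scale symsum_tmul_word_left)
  qed
qed (simp add: tmul_add_left[abs_def] symsum_add)

lemma tmul_vec_vec:
  "tmul (tensor_vec v) (tensor_vec w) = (\<lambda>x. \<Sum>a\<in>UNIV. \<Sum>b\<in>UNIV. v $ a * (w $ b * word [a, b] x))"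
proof
  fix x
  show "tmul (tensor_vec v) (tensor_vec w) x = (\<Sum>a\<in>UNIV. \<Sum>b\<in>UNIV. v $ a * (w $ b * word [a, b] x))"
    by (simp add: tensor_vec_Cons[abs_def] tmul_sum_left tmul_sum_right tmul_scale_left tmul_scale_right
        tmul_word_word sum_distrib_left)
qed

lemma symsum_commutator:
  "symsum (\<lambda>x. tmul (tensor_vec v) (tensor_vec w) x - tmul (tensor_vec w) (tensor_vec v) x) = (\<lambda>M. 0)"
proof
  fix M
  have "(\<Sum>a\<in>UNIV. \<Sum>b\<in>UNIV. v $ a * (w $ b * symsum (word [a, b]) M))
     = (\<Sum>b\<in>UNIV. \<Sum>a\<in>UNIV. v $ a * (w $ b * symsum (word [a, b]) M))"
    by (rule sum.swap)
  also have "\<dots> = (\<Sum>b\<in>UNIV. \<Sum>a\<in>UNIV. w $ b * (v $ a * symsum (word [b, a]) M))"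
    by (simp add: symsum_word add_mset_commute mult.left_commute cong: if_cong)
  finally show "symsum (\<lambda>x. tmul (tensor_vec v) (tensor_vec w) x - tmul (tensor_vec w) (tensor_vec v) x) M = 0"
    by (simp add: tmul_vec_vec symsum_diff symsum_sum symsum_scale)
qed

text \<open>For each multiset one arrangement \<open>rep\<close> is chosen, and every word of
  \<open>z\<close> is replaced by its difference from the chosen one. The subtracted terms add up to
  the coefficients \<open>symsum z\<close>, hence to zero. The premise \<open>z v \<noteq> 0\<close>
  in the last case remembers the degrees of the words involved.\<close>

lemma symsum_zero_induct [consumes 2, case_names zero add word]:
  fixes z :: "'n::finite list \<Rightarrow> complex"
  assumes z: "z \<in> tensors" and s: "symsum z = (\<lambda>M. 0)"
    and Q0: "Q (\<lambda>w. 0)"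
    and Qadd: "\<And>f g. f \<in> tensors \<Longrightarrow> g \<in> tensors \<Longrightarrow> Q f \<Longrightarrow> Q g \<Longrightarrow> Q (\<lambda>x. f x + g x)"
    and Qw: "\<And>c v w. z v \<noteq> 0 \<Longrightarrow> mset v = mset w \<Longrightarrow> Q (\<lambda>x. c * (word v x - word w x))"
  shows "Q z"
proof -
  define rep :: "'n multiset \<Rightarrow> 'n list" where "rep M = (SOME w. mset w = M)" for M
  have rep: "mset (rep M) = M" for M
    unfolding rep_def by (rule someI_ex) (rule ex_mset)
  let ?S = "{v. z v \<noteq> 0}"
  have fin: "finite ?S" using z by (simp add: tensors_def)
  have *: "finite S \<Longrightarrow> S \<subseteq> ?S \<Longrightarrow> Q (\<lambda>x. \<Sum>v\<in>S. z v * (word v x - word (rep (mset v)) x))" for S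
  proof (induction S rule: finite_induct)
    case empty
    then show ?case by (simp add: Q0)
  next
    case (insert v S)
    have "(\<lambda>x. \<Sum>v\<in>S. z v * (word v x - word (rep (mset v)) x)) \<in> tensors"
      "(\<lambda>x. z v * (word v x - word (rep (mset v)) x)) \<in> tensors"
      by (intro tensors_sum tensors_scale tensors_diff tensors_word)+
    then show ?case using insert Qadd[OF _ _ Qw] by (simp add: rep)
  qed
  have "(\<lambda>x. \<Sum>v\<in>?S. z v * (word v x - word (rep (mset v)) x)) = z"
  proof
    fix x
    have "(\<Sum>v\<in>?S. z v * word (rep (mset v)) x) = 0"
    proof (cases "rep (mset x) = x")
      case True
      then have e: "word (rep (mset v)) x = (if mset v = mset x then 1 else 0)" for v
        using rep[of "mset v"] by (auto simp: word_def)
      have "(\<Sum>v\<in>?S. z v * word (rep (mset v)) x) = (\<Sum>v\<in>?S. if mset v = mset x then z v else 0)"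
        by (intro sum.cong) (auto simp: e)
      also have "\<dots> = symsum z (mset x)"
        unfolding symsum_def by (rule sum.mono_neutral_cong) (auto simp: fin finite_mset_words)
      finally show ?thesis using s by simp
    next
      case False
      then have "word (rep (mset v)) x = 0" for v
        using rep[of "mset v"] by (auto simp: word_def)
      then show ?thesis by simp
    qed
    moreover have "(\<Sum>v\<in>?S. z v * word v x) = z x"
      using fin by (auto simp: word_def if_distrib[of "\<lambda>x. _ * x"] cong: if_cong)
    ultimately show "(\<Sum>v\<in>?S. z v * (word v x - word (rep (mset v)) x)) = z x"
      by (simp add: right_diff_distrib sum_subtractf)
  qed
  with *[OF fin] show ?thesis by simp
qed

lemma ideal_sym: "ideal (sym_ideal :: ('n::finite list \<Rightarrow> complex) set) tensor_algebra"
proof -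
  interpret T: ring "tensor_algebra :: (complex, 'n list \<Rightarrow> complex) module" by (rule ring_tensor_algebra)
  show ?thesis unfolding sym_ideal_def
    by (rule T.genideal_ideal) (auto simp: minus_tensor_algebra tensors_tmul tensors_diff)
qed

text \<open>Tensors with vanishing \<open>symsum\<close> form an ideal that contains the
  commutators, which gives one inclusion. For the other, a difference of two arrangements of one
  multiset is a sum of differences for single swaps, and each of these is a commutator of basis
  vectors multiplied by words on both sides.\<close>

lemma sym_ideal_iff:
  fixes z :: "'n::finite list \<Rightarrow> complex"
  shows "z \<in> sym_ideal \<longleftrightarrow> z \<in> tensors \<and> symsum z = (\<lambda>M. 0)"
proof
  interpret T: ring "tensor_algebra :: (complex, 'n list \<Rightarrow> complex) module" by (rule ring_tensor_algebra)
  interpret I: ideal "sym_ideal :: ('n list \<Rightarrow> complex) set" tensor_algebra by (rule ideal_sym)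
  let ?J = "{z :: 'n list \<Rightarrow> complex. z \<in> tensors \<and> symsum z = (\<lambda>M. 0)}"
  let ?gen = "\<lambda>(v :: complex ^ 'n) w x. tmul (tensor_vec v) (tensor_vec w) x - tmul (tensor_vec w) (tensor_vec v) x"
  have "ideal ?J tensor_algebra"
    by (rule T.ideal_intro)
       (auto simp: tensors_add symsum_add tensors_tmul symsum_tmul_zero_left symsum_tmul_zero_right)
  then have "sym_ideal \<subseteq> ?J"
    unfolding sym_ideal_def
    by (rule T.genideal_minimal)
       (auto simp: minus_tensor_algebra tensors_tmul tensors_diff symsum_commutator)
  then show "z \<in> sym_ideal \<Longrightarrow> z \<in> tensors \<and> symsum z = (\<lambda>M. 0)" by auto
  have gen: "?gen v w \<in> sym_ideal" for v w :: "complex ^ 'n"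
    unfolding sym_ideal_def
    by (rule subsetD[OF T.genideal_self])
       (auto simp: minus_tensor_algebra tensors_tmul tensors_diff)
  have ladd: "f \<in> sym_ideal \<Longrightarrow> g \<in> sym_ideal \<Longrightarrow> (\<lambda>x. f x + g x) \<in> sym_ideal"
    for f g :: "'n list \<Rightarrow> complex"
    using I.a_closed[of f g] by simp
  have swap: "(\<lambda>x. c * (word v x - word w x)) \<in> sym_ideal" if "mset v = mset w" for v w :: "'n list" and c
  proof (rule mset_swap_induct[where E = "\<lambda>v w. (\<lambda>x. c * (word v x - word w x)) \<in> sym_ideal", OF _ _ _ that])
    fix w :: "'n list"
    show "(\<lambda>x. c * (word w x - word w x)) \<in> sym_ideal" using I.zero_closed by simp
  next
    fix u v w :: "'n list"
    assume "(\<lambda>x. c * (word u x - word v x)) \<in> sym_ideal" "(\<lambda>x. c * (word v x - word w x)) \<in> sym_ideal"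
    from ladd[OF this] show "(\<lambda>x. c * (word u x - word w x)) \<in> sym_ideal"
      by (simp add: algebra_simps)
  next
    fix x y :: "'n list" and a b
    have g: "?gen (axis a 1) (axis b 1) = (\<lambda>x. word [a, b] x - word [b, a] x)"
      by (simp add: tensor_vec_axis tmul_word_word)
    have "(\<lambda>w. c * word x w) \<otimes>\<^bsub>tensor_algebra\<^esub> (?gen (axis a 1) (axis b 1) \<otimes>\<^bsub>tensor_algebra\<^esub> word y) \<in> sym_ideal"
      by (intro I.I_l_closed I.I_r_closed gen) (simp_all add: tensors_scale)
    moreover have "(\<lambda>w. c * word x w) \<otimes>\<^bsub>tensor_algebra\<^esub> (?gen (axis a 1) (axis b 1) \<otimes>\<^bsub>tensor_algebra\<^esub> word y)
        = (\<lambda>w. c * (word (x @ a # b # y) w - word (x @ b # a # y) w))"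
      unfolding g
      by (rule ext) (simp add: tmul_diff_left[abs_def] tmul_diff_right tmul_scale_left tmul_word_word
          right_diff_distrib)
    ultimately show "(\<lambda>w. c * (word (x @ a # b # y) w - word (x @ b # a # y) w)) \<in> sym_ideal" by simp
  qed
  show "z \<in> tensors \<and> symsum z = (\<lambda>M. 0) \<Longrightarrow> z \<in> sym_ideal"
  proof -
    assume "z \<in> tensors \<and> symsum z = (\<lambda>M. 0)"
    then have "z \<in> tensors" "symsum z = (\<lambda>M. 0)" by auto
    then show "z \<in> sym_ideal"
    proof (induction rule: symsum_zero_induct)
      case zero
      show ?case using I.zero_closed by simp
    next
      case (add f g)
      show ?case by (rule ladd) fact+
    next
      case (word c v w)
      then show ?case by (intro swap)
    qed
  qed
qed

lemma sym_proj_eq_iff: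
  fixes f g :: "'n::finite list \<Rightarrow> complex"
  assumes "f \<in> tensors" "g \<in> tensors"
  shows "sym_proj f = sym_proj g \<longleftrightarrow> symsum f = symsum g"
proof -
  interpret T: ring "tensor_algebra :: (complex, 'n list \<Rightarrow> complex) module" by (rule ring_tensor_algebra)
  have "sym_proj f = sym_proj g \<longleftrightarrow> f \<ominus>\<^bsub>tensor_algebra\<^esub> g \<in> sym_ideal"
    unfolding sym_proj_def using assms by (subst T.quotient_eq_iff_same_a_r_cos[OF ideal_sym]) auto
  also have "\<dots> \<longleftrightarrow> symsum f = symsum g"
    using assms by (auto simp: minus_tensor_algebra sym_ideal_iff tensors_diff symsum_diff fun_eq_iff)
  finally show ?thesis .
qed

lemma carrier_sym_algebra: "carrier sym_algebra = sym_proj ` tensors"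
  by (simp add: sym_algebra_def carrier_quotient_algebra sym_proj_def)

lemma add_sym_algebra:
  "f \<in> tensors \<Longrightarrow> g \<in> tensors \<Longrightarrow> sym_proj f \<oplus>\<^bsub>sym_algebra\<^esub> sym_proj g = sym_proj (\<lambda>w. f w + g w)"
  using add_quotient_algebra[OF ideal_sym, of f g] by (simp add: sym_algebra_def sym_proj_def)

lemma smult_sym_algebra:
  "f \<in> tensors \<Longrightarrow> c \<odot>\<^bsub>sym_algebra\<^esub> sym_proj f = sym_proj (\<lambda>w. c * f w)"
  using smult_quotient_algebra[OF ideal_sym, of f c]
  by (simp add: sym_algebra_def sym_proj_def tensors_scale sym_ideal_iff symsum_scale algebra_simps)

lemma zero_sym_algebra:
  "\<zero>\<^bsub>sym_algebra\<^esub> = (sym_proj (\<lambda>w. 0) :: ('n::finite list \<Rightarrow> complex) set)"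
proof -
  interpret T: ring "tensor_algebra :: (complex, 'n::finite list \<Rightarrow> complex) module" by (rule ring_tensor_algebra)
  interpret I: ideal "sym_ideal :: ('n::finite list \<Rightarrow> complex) set" tensor_algebra by (rule ideal_sym)
  have "sym_proj (\<lambda>w. 0) = (sym_ideal :: ('n list \<Rightarrow> complex) set)"
    using I.a_rcos_const[OF I.zero_closed] by (simp add: sym_proj_def)
  then show ?thesis by (simp add: sym_algebra_def quotient_algebra_def FactRing_def)
qed

section \<open>Graded sections\<close>

definition hcomp :: "nat \<Rightarrow> ('n list \<Rightarrow> complex) \<Rightarrow> 'n list \<Rightarrow> complex" where
  "hcomp k f = (\<lambda>w. if length w = k then f w else 0)"

lemma hcomp_tensors: "f \<in> tensors \<Longrightarrow> hcomp k f \<in> tensors"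
  unfolding tensors_def hcomp_def mem_Collect_eq by (erule rev_finite_subset) auto

locale graded_section_locale =
  fixes \<sigma> :: "('n::finite list \<Rightarrow> complex) set \<Rightarrow> 'n list \<Rightarrow> complex"
  assumes graded: "graded_section \<sigma>"
begin

lemma section_tensors: "X \<in> carrier sym_algebra \<Longrightarrow> \<sigma> X \<in> tensors"
  using graded by (auto simp: graded_section_def module_homs_def)

lemma section_proj: "X \<in> carrier sym_algebra \<Longrightarrow> sym_proj (\<sigma> X) = X"
  using graded by (auto simp: graded_section_def)

lemma section_proj_tensors: "f \<in> tensors \<Longrightarrow> \<sigma> (sym_proj f) \<in> tensors"
  by (rule section_tensors) (simp add: carrier_sym_algebra)

lemma section_add:
  "X \<in> carrier sym_algebra \<Longrightarrow> Y \<in> carrier sym_algebra \<Longrightarrow> \<sigma> (X \<oplus>\<^bsub>sym_algebra\<^esub> Y) = (\<lambda>w. \<sigma> X w + \<sigma> Y w)"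
  using graded by (auto simp: graded_section_def module_homs_def)

lemma section_smult: "X \<in> carrier sym_algebra \<Longrightarrow> \<sigma> (c \<odot>\<^bsub>sym_algebra\<^esub> X) = (\<lambda>w. c * \<sigma> X w)"
  using graded by (auto simp: graded_section_def module_homs_def)

lemma section_proj_add:
  "f \<in> tensors \<Longrightarrow> g \<in> tensors \<Longrightarrow> \<sigma> (sym_proj (\<lambda>w. f w + g w)) = (\<lambda>w. \<sigma> (sym_proj f) w + \<sigma> (sym_proj g) w)"
  by (simp add: add_sym_algebra[symmetric] section_add carrier_sym_algebra)

lemma section_proj_scale: "f \<in> tensors \<Longrightarrow> \<sigma> (sym_proj (\<lambda>w. c * f w)) = (\<lambda>w. c * \<sigma> (sym_proj f) w)"
  by (simp add: smult_sym_algebra[symmetric] section_smult carrier_sym_algebra)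

lemma section_proj_0: "\<sigma> (sym_proj (\<lambda>w. 0)) = (\<lambda>w. 0)"
  using section_proj_scale[of "\<lambda>w. 0" 0] by simp

lemma section_zero: "\<sigma> \<zero>\<^bsub>sym_algebra\<^esub> = (\<lambda>w. 0)"
  by (simp add: zero_sym_algebra section_proj_0)

lemma section_degree:
  "f \<in> tensors \<Longrightarrow> (\<And>w. f w \<noteq> 0 \<Longrightarrow> length w = k) \<Longrightarrow> \<sigma> (sym_proj f) w \<noteq> 0 \<Longrightarrow> length w = k"
proof -
  assume "f \<in> tensors" "\<And>w. f w \<noteq> 0 \<Longrightarrow> length w = k" and w: "\<sigma> (sym_proj f) w \<noteq> 0"
  then have "f \<in> tensor_degree k" by (auto simp: tensor_degree_def)
  then have "\<sigma> (sym_proj f) \<in> tensor_degree k"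
    using graded unfolding graded_section_def by blast
  with w show "length w = k" by (auto simp: tensor_degree_def)
qed

lemma symsum_section: "f \<in> tensors \<Longrightarrow> symsum (\<sigma> (sym_proj f)) = symsum f"
  by (subst sym_proj_eq_iff[symmetric])
     (auto simp: section_proj_tensors section_proj carrier_sym_algebra)

text \<open>A multiset of at most one letter has a single arrangement, so in degree at most one the
  projection to the symmetric algebra is injective and the section has no freedom.\<close>

lemma section_short:
  assumes f: "f \<in> tensors" "\<And>w. f w \<noteq> 0 \<Longrightarrow> length w = k" and k: "k \<le> 1"
  shows "\<sigma> (sym_proj f) = f"
proof
  fix w
  show "\<sigma> (sym_proj f) w = f w"
  proof (cases "length w = k")
    case True
    then have "symsum (\<sigma> (sym_proj f)) (mset w) = symsum f (mset w)"
      using f by (simp add: symsum_section)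
    then show ?thesis using True k by (simp add: symsum_short)
  next
    case False
    then have "\<sigma> (sym_proj f) w = 0" "f w = 0" using section_degree[OF f, of w] f(2)[of w] by blast+
    then show ?thesis by simp
  qed
qed

text \<open>Applying the section after the projection fixes \<open>\<sigma> X\<close> and respects
  degrees; comparing the parts of degree \<open>k\<close> shows that it fixes each homogeneous
  component. Hence a component of a value of \<open>\<sigma>\<close> is determined by its image in
  the symmetric algebra.\<close>

lemma section_comp:
  assumes X: "X \<in> carrier sym_algebra"
  shows "\<sigma> (sym_proj (hcomp k (\<sigma> X))) = hcomp k (\<sigma> X)"
proof -
  let ?f = "\<sigma> X"
  have f: "?f \<in> tensors" using X by (rule section_tensors)
  have *: "\<sigma> (sym_proj (\<lambda>w. \<Sum>j\<in>J. hcomp j ?f w)) = (\<lambda>w. \<Sum>j\<in>J. \<sigma> (sym_proj (hcomp j ?f)) w)"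
    if "finite J" for J
    using that
  proof (induction J rule: finite_induct)
    case (insert j J)
    have "(\<lambda>w. \<Sum>j\<in>J. hcomp j ?f w) \<in> tensors" by (intro tensors_sum hcomp_tensors f)
    then show ?case using insert hcomp_tensors[OF f, of j] by (simp add: section_proj_add)
  qed (simp add: section_proj_0)
  have "finite (length ` {w. ?f w \<noteq> 0})" using f by (simp add: tensors_def)
  then obtain N where N: "\<And>w. ?f w \<noteq> 0 \<Longrightarrow> length w \<le> N"
    by (auto simp: finite_nat_set_iff_bounded_le)
  have "(\<lambda>w. \<Sum>j\<le>N. hcomp j ?f w) = ?f"
    using N by (force simp: hcomp_def fun_eq_iff)
  then have eq: "(\<lambda>w. \<Sum>j\<le>N. \<sigma> (sym_proj (hcomp j ?f)) w) = ?f"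
    using *[of "{..N}"] section_proj[OF X] by simp
  have deg: "\<sigma> (sym_proj (hcomp j ?f)) w = 0" if "length w \<noteq> j" for j w
  proof -
    have "\<And>v. hcomp j ?f v \<noteq> 0 \<Longrightarrow> length v = j" by (metis hcomp_def)
    from section_degree[OF hcomp_tensors[OF f] this, where w = w] that show ?thesis by blast
  qed
  show ?thesis
  proof
    fix w
    show "\<sigma> (sym_proj (hcomp k ?f)) w = hcomp k ?f w"
    proof (cases "length w = k")
      case True
      have "?f w = (\<Sum>j\<le>N. \<sigma> (sym_proj (hcomp j ?f)) w)" using eq by (simp add: fun_eq_iff)
      also have "\<dots> = (\<Sum>j\<le>N. if j = k then \<sigma> (sym_proj (hcomp k ?f)) w else 0)"
        using True deg[of w] by (intro sum.cong) auto
      also have "\<dots> = (if k \<le> N then \<sigma> (sym_proj (hcomp k ?f)) w else 0)" by simp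
      finally have a: "?f w = (if k \<le> N then \<sigma> (sym_proj (hcomp k ?f)) w else 0)" .
      have "hcomp k ?f = (\<lambda>w. 0)" if "\<not> k \<le> N" using that N by (auto simp: hcomp_def fun_eq_iff)
      then show ?thesis using a True by (auto simp: hcomp_def section_proj_0)
    next
      case False
      then have "hcomp k ?f w = 0" by (simp add: hcomp_def)
      with deg[OF False] show ?thesis by simp
    qed
  qed
qed

end

section \<open>Coefficient functionals vanishing on the ideal\<close>

lemma
  assumes "skew_bilinear_form b"
  shows skew_form_add_left: "b (v + v') w = b v w + b v' w"
    and skew_form_add_right: "b v (w + w') = b v w + b v w'"
    and skew_form_scale_left: "b (c *s v) w = c * b v w"
    and skew_form_scale_right: "b v (c *s w) = c * b v w"
    and skew_form_swap: "b v w = - b w v"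
proof -
  have l: "Vector_Spaces.linear (*s) (*) (\<lambda>w. b v w)" "Vector_Spaces.linear (*s) (*) (\<lambda>v. b v w)" for v w
    using assms unfolding skew_bilinear_form_def by blast+
  show "b (v + v') w = b v w + b v' w" by (rule module_hom.add[OF Vector_Spaces.linear.axioms(3)[OF l(2)]])
  show "b v (w + w') = b v w + b v w'" by (rule module_hom.add[OF Vector_Spaces.linear.axioms(3)[OF l(1)]])
  show "b (c *s v) w = c * b v w" by (rule module_hom.scale[OF Vector_Spaces.linear.axioms(3)[OF l(2)]])
  show "b v (c *s w) = c * b v w" by (rule module_hom.scale[OF Vector_Spaces.linear.axioms(3)[OF l(1)]])
  show "b v w = - b w v" using assms unfolding skew_bilinear_form_def by blast
qed

lemma skew_form_0: "skew_bilinear_form b \<Longrightarrow> b 0 w = 0" "skew_bilinear_form b \<Longrightarrow> b w 0 = 0"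
  using skew_form_scale_left[of b 0 0 w] skew_form_scale_right[of b w 0 0] by auto

lemma skew_form_self: "skew_bilinear_form b \<Longrightarrow> b v v = 0"
  using skew_form_swap[of b v v] by simp

lemma skew_form_sum_left:
  "skew_bilinear_form b \<Longrightarrow> b (\<Sum>i\<in>I. c i *s f i) w = (\<Sum>i\<in>I. c i * b (f i) w)"
  by (induction I rule: infinite_finite_induct)
     (simp_all add: skew_form_0 skew_form_add_left skew_form_scale_left)

lemma skew_form_sum_right:
  "skew_bilinear_form b \<Longrightarrow> b w (\<Sum>i\<in>I. c i *s f i) = (\<Sum>i\<in>I. c i * b w (f i))"
  by (induction I rule: infinite_finite_induct)
     (simp_all add: skew_form_0 skew_form_add_right skew_form_scale_right)

abbreviation basis_vec :: "'n \<Rightarrow> complex ^ 'n" where "basis_vec i \<equiv> axis i 1"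

lemma mult_basis_vec: "k *v basis_vec d = (\<Sum>e\<in>UNIV. (k $ e $ d) *s basis_vec e)"
  by (simp add: vec_eq_iff matrix_vector_mult_def axis_def if_distrib[of "\<lambda>x. _ * x"] cong: if_cong)

lemma vec_basis_sum: "(v :: complex ^ 'n) = (\<Sum>e\<in>UNIV. (v $ e) *s basis_vec e)"
  by (simp add: vec_eq_iff axis_def if_distrib[of "\<lambda>x. _ * x"] cong: if_cong)

locale hecke_forms = cocycle_group G \<alpha>
  for G :: "(complex ^ 'n ^ 'n) set" and \<alpha> :: "complex ^ 'n ^ 'n \<Rightarrow> complex ^ 'n ^ 'n \<Rightarrow> complex" +
  fixes a :: "complex ^ 'n ^ 'n \<Rightarrow> complex ^ 'n \<Rightarrow> complex ^ 'n \<Rightarrow> complex"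
  assumes skew: "h \<in> G \<Longrightarrow> skew_bilinear_form (a h)"
begin

definition equivariant :: bool where
  "equivariant \<longleftrightarrow> (\<forall>h\<in>G. \<forall>x\<in>G. \<forall>v w.
     \<alpha> (h ** x ** matrix_inv h) h * a (h ** x ** matrix_inv h) (h *v v) (h *v w) = \<alpha> h x * a x v w)"

text \<open>A group element passes a vector by acting on it, so \<open>x *v w - w\<close> is what
  the commutator of \<open>x\<close> with \<open>w\<close> leaves in front of \<open>x\<close>. The
  identity is the component at \<open>x\<close> of the cyclic sum.\<close>

definition jacobi :: bool where
  "jacobi \<longleftrightarrow> (\<forall>x\<in>G. \<forall>u v w.
     a x u v *s (x *v w - w) + a x v w *s (x *v u - u) + a x w u *s (x *v v - v) = 0)"

text \<open>The value of a functional \<open>N\<close> on the tensor \<open>u \<otimes> k z\<close>.\<close>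

definition act_ext :: "('n list \<Rightarrow> nat \<Rightarrow> complex ^ 'n ^ 'n \<Rightarrow> complex) \<Rightarrow> complex ^ 'n ^ 'n
    \<Rightarrow> 'n list \<Rightarrow> 'n list \<Rightarrow> nat \<Rightarrow> complex ^ 'n ^ 'n \<Rightarrow> complex" where
  "act_ext N k u z n g = (\<Sum>z' | length z' = length z. act_coeff k z' z * N (u @ z') n g)"

text \<open>
  The value of \<open>N\<close> on \<open>u (\<Sum>k. a\<^sub>k(e\<^sub>i, e\<^sub>j) t k) y\<close> when values are read as elements of
  \<open>\<complex>G[t]\<close> and \<open>N\<close> is extended to be linear for right multiplication by \<open>\<complex>G[t]\<close>.
\<close>

definition swap_term :: "('n list \<Rightarrow> nat \<Rightarrow> complex ^ 'n ^ 'n \<Rightarrow> complex)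
    \<Rightarrow> nat \<Rightarrow> complex ^ 'n ^ 'n \<Rightarrow> 'n list \<Rightarrow> 'n \<Rightarrow> 'n \<Rightarrow> 'n list \<Rightarrow> complex" where
  "swap_term N n g u i j y = (if n = 0 then 0 else
     \<Sum>k\<in>G. a k (basis_vec i) (basis_vec j) * (\<alpha> (g ** matrix_inv k) k
       * act_ext N k u y (n - 1) (g ** matrix_inv k)))"

lemma act_ext_append:
  "act_ext N k u (x @ y) n g = (\<Sum>x' | length x' = length x. act_coeff k x' x * act_ext N k (u @ x') y n g)"
  unfolding act_ext_def length_append sum_words_append sum_distrib_left
  by (auto simp: act_coeff_append intro!: sum.cong)

lemma act_ext_Cons:
  "act_ext N k u (d # y) n g = (\<Sum>d'\<in>UNIV. k $ d' $ d * act_ext N k (u @ [d']) y n g)"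
  by (simp add: act_ext_def sum_words_Suc sum_distrib_left mult.assoc)

lemma act_coeff_mult:
  "length z = length y \<Longrightarrow>
   act_coeff (h ** k) z y = (\<Sum>y' | length y' = length y. act_coeff h z y' * act_coeff k y' y)"
  using fun_cong[OF tensor_act_mult[of h k "word y"], of z]
  by (simp add: tensor_act_word tensor_act_coeff[of h "tensor_act k (word y)"])

lemma act_ext_mult:
  "(\<Sum>y' | length y' = length y. act_coeff k y' y * act_ext N h u y' n g) = act_ext N (h ** k) u y n g"
proof -
  have "(\<Sum>y' | length y' = length y. act_coeff k y' y * act_ext N h u y' n g)
     = (\<Sum>y' | length y' = length y. \<Sum>z | length z = length y.
          act_coeff k y' y * (act_coeff h z y' * N (u @ z) n g))"
    by (intro sum.cong refl) (simp add: act_ext_def sum_distrib_left)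
  also have "\<dots> = (\<Sum>z | length z = length y. \<Sum>y' | length y' = length y.
          act_coeff k y' y * (act_coeff h z y' * N (u @ z) n g))"
    by (rule sum.swap)
  also have "\<dots> = act_ext N (h ** k) u y n g"
    unfolding act_ext_def
    by (intro sum.cong refl) (simp add: act_coeff_mult sum_distrib_right sum_distrib_left mult_ac)
  finally show ?thesis .
qed

lemma swap_term_anti: "swap_term N n g u j i y = - swap_term N n g u i j y"
proof -
  have "a k (basis_vec j) (basis_vec i) = - a k (basis_vec i) (basis_vec j)" if "k \<in> G" for k
    by (rule skew_form_swap[OF skew[OF that]])
  then show ?thesis by (simp add: swap_term_def sum_negf)
qed

text \<open>In both products the letter not involved in the swap stands either behind or in front of
  the group element that the swap emits. The six terms therefore pair up into three differences, one
  for each letter left over, and their cyclic sum is an instance of the Jacobi identity.\<close>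

lemma swap_term_braid:
  assumes jacobi
  shows "swap_term N n g u i j (d # y) + swap_term N n g (u @ [j]) i d y + swap_term N n g u j d (i # y)
     = swap_term N n g (u @ [i]) j d y + swap_term N n g u i d (j # y) + swap_term N n g (u @ [d]) i j y"
proof (cases "n = 0")
  case False
  let ?A = "\<lambda>k i j. a k (basis_vec i) (basis_vec j)"
  let ?E = "\<lambda>k d'. act_ext N k (u @ [d']) y (n - 1) (g ** matrix_inv k)"
  let ?D = "\<lambda>i j d. \<Sum>k\<in>G. ?A k i j * (\<alpha> (g ** matrix_inv k) k
      * (\<Sum>d'\<in>UNIV. (k *v basis_vec d - basis_vec d) $ d' * ?E k d'))"
  \<comment> \<open>Moving \<open>d\<close> from behind the group element \<open>k\<close> to its
    front replaces \<open>basis_vec d\<close> by \<open>k *v basis_vec d\<close>, so the difference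
    of the two positions sees \<open>k *v basis_vec d - basis_vec d\<close>.\<close>
  have D: "swap_term N n g u i j (d # y) - swap_term N n g (u @ [d]) i j y = ?D i j d" for i j d
  proof -
    have "(k *v basis_vec d - basis_vec d) $ d' = k $ d' $ d - (if d' = d then 1 else 0)" for k :: "complex^'n^'n" and d'
      by (simp add: matrix_vector_mult_def axis_def if_distrib[of "\<lambda>x. _ * x"] cong: if_cong)
    then show ?thesis
      using False
      by (simp add: swap_term_def act_ext_Cons left_diff_distrib right_diff_distrib sum_subtractf
          if_distrib[of "\<lambda>x. x * _"] cong: if_cong)
  qed
  have "?D i j d + ?D j d i + ?D d i j = 0"
  proof -
    have "?A k i j * (c * (\<Sum>d'\<in>UNIV. (k *v basis_vec d - basis_vec d) $ d' * ?E k d'))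
       + ?A k j d * (c * (\<Sum>d'\<in>UNIV. (k *v basis_vec i - basis_vec i) $ d' * ?E k d'))
       + ?A k d i * (c * (\<Sum>d'\<in>UNIV. (k *v basis_vec j - basis_vec j) $ d' * ?E k d')) = 0"
      if k: "k \<in> G" for k c
    proof -
      have "(?A k i j *s (k *v basis_vec d - basis_vec d) + ?A k j d *s (k *v basis_vec i - basis_vec i)
         + ?A k d i *s (k *v basis_vec j - basis_vec j)) $ d' = 0" for d'
        using assms k by (simp only: jacobi_def) simp
      then have *: "?A k i j * (k *v basis_vec d - basis_vec d) $ d'
         + ?A k j d * (k *v basis_vec i - basis_vec i) $ d'
         + ?A k d i * (k *v basis_vec j - basis_vec j) $ d' = 0" for d'
        by (simp only: vector_add_component vector_smult_component)
      have "?A k i j * (c * (\<Sum>d'\<in>UNIV. (k *v basis_vec d - basis_vec d) $ d' * ?E k d'))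
       + ?A k j d * (c * (\<Sum>d'\<in>UNIV. (k *v basis_vec i - basis_vec i) $ d' * ?E k d'))
       + ?A k d i * (c * (\<Sum>d'\<in>UNIV. (k *v basis_vec j - basis_vec j) $ d' * ?E k d'))
       = (\<Sum>d'\<in>UNIV. c * ?E k d' * (?A k i j * (k *v basis_vec d - basis_vec d) $ d'
         + ?A k j d * (k *v basis_vec i - basis_vec i) $ d'
         + ?A k d i * (k *v basis_vec j - basis_vec j) $ d'))"
        unfolding sum_distrib_left sum.distrib[symmetric]
        by (intro sum.cong refl) (simp only: algebra_simps)
      also have "\<dots> = 0" by (simp only: *) simp
      finally show ?thesis .
    qed
    then show ?thesis
      unfolding sum.distrib[symmetric] by (intro sum.neutral ballI)
  qed
  with D[of i j d] D[of j d i] D[of d i j]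
    swap_term_anti[of N n g u d i "j # y"] swap_term_anti[of N n g "u @ [j]" d i y]
  show ?thesis by (simp add: complex_eq_iff)
qed (simp add: swap_term_def)

text \<open>This is a swap that happens behind a group element \<open>k\<close>, so that
  \<open>d\<close>, \<open>e\<close> and the tail \<open>y\<close> have already been transformed by
  \<open>k\<close>. Bilinearity absorbs the sums over the transformed letters into the arguments of
  the forms, and the tail is acted on by the product \<open>h ** k\<close>.\<close>

lemma swap_term_act:
  assumes k: "k \<in> G"
  shows "(\<Sum>d'\<in>UNIV. \<Sum>e'\<in>UNIV. k $ d' $ d * (k $ e' $ e * (\<Sum>y' | length y' = length y.
      act_coeff k y' y * swap_term N n g u d' e' y')))
    = (if n = 0 then 0 else \<Sum>h\<in>G. a h (k *v basis_vec d) (k *v basis_vec e)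
        * (\<alpha> (g ** matrix_inv h) h * act_ext N (h ** k) u y (n - 1) (g ** matrix_inv h)))"
proof (cases "n = 0")
  case False
  let ?X = "\<lambda>h. \<alpha> (g ** matrix_inv h) h * act_ext N (h ** k) u y (n - 1) (g ** matrix_inv h)"
  have 1: "(\<Sum>y' | length y' = length y. act_coeff k y' y * swap_term N n g u d' e' y')
     = (\<Sum>h\<in>G. a h (basis_vec d') (basis_vec e') * ?X h)" for d' e'
  proof -
    have "(\<Sum>y' | length y' = length y. act_coeff k y' y * swap_term N n g u d' e' y')
      = (\<Sum>y' | length y' = length y. \<Sum>h\<in>G. a h (basis_vec d') (basis_vec e') * (\<alpha> (g ** matrix_inv h) h *
           (act_coeff k y' y * act_ext N h u y' (n - 1) (g ** matrix_inv h))))"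
      using False by (simp add: swap_term_def sum_distrib_left mult_ac)
    also have "\<dots> = (\<Sum>h\<in>G. \<Sum>y' | length y' = length y. a h (basis_vec d') (basis_vec e') * (\<alpha> (g ** matrix_inv h) h *
           (act_coeff k y' y * act_ext N h u y' (n - 1) (g ** matrix_inv h))))"
      by (rule sum.swap)
    also have "\<dots> = (\<Sum>h\<in>G. a h (basis_vec d') (basis_vec e') * ?X h)"
      by (simp only: sum_distrib_left[symmetric] act_ext_mult)
    finally show ?thesis .
  qed
  have "(\<Sum>d'\<in>UNIV. \<Sum>e'\<in>UNIV. k $ d' $ d * (k $ e' $ e * (\<Sum>h\<in>G. a h (basis_vec d') (basis_vec e') * ?X h)))
     = (\<Sum>d'\<in>UNIV. \<Sum>h\<in>G. \<Sum>e'\<in>UNIV. k $ d' $ d * (k $ e' $ e * (a h (basis_vec d') (basis_vec e') * ?X h)))"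
    unfolding sum_distrib_left by (intro sum.cong refl sum.swap)
  also have "\<dots> = (\<Sum>h\<in>G. \<Sum>d'\<in>UNIV. \<Sum>e'\<in>UNIV. k $ d' $ d * (k $ e' $ e * (a h (basis_vec d') (basis_vec e') * ?X h)))"
    by (rule sum.swap)
  also have "\<dots> = (\<Sum>h\<in>G. a h (k *v basis_vec d) (k *v basis_vec e) * ?X h)"
  proof (rule sum.cong[OF refl])
    fix h assume h: "h \<in> G"
    have "a h (k *v basis_vec d) (k *v basis_vec e)
        = (\<Sum>d'\<in>UNIV. k $ d' $ d * (\<Sum>e'\<in>UNIV. k $ e' $ e * a h (basis_vec d') (basis_vec e')))"
      unfolding mult_basis_vec[of k d] skew_form_sum_left[OF skew[OF h]]
      unfolding mult_basis_vec[of k e] skew_form_sum_right[OF skew[OF h]] ..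
    then show "(\<Sum>d'\<in>UNIV. \<Sum>e'\<in>UNIV. k $ d' $ d * (k $ e' $ e * (a h (basis_vec d') (basis_vec e') * ?X h)))
        = a h (k *v basis_vec d) (k *v basis_vec e) * ?X h"
      by (simp only: sum_distrib_left sum_distrib_right mult.assoc)
  qed
  finally show ?thesis using False by (simp only: 1 if_False)
qed (simp add: swap_term_def)

text \<open>Two applications of the cocycle identity, to the triples \<open>?q, ?m, k\<close> and
  \<open>?q, k, h\<close>, share the factor \<open>\<alpha> ?q (k ** h)\<close> because
  \<open>?m ** k = k ** h\<close>. What is left over is the equivariance of the forms.\<close>

lemma twisted_reindex:
  assumes equivariant and g: "g \<in> G" and k: "k \<in> G" and h: "h \<in> G"
  shows "a (k ** h ** matrix_inv k) (k *v v) (k *v w) * (\<alpha> (g ** matrix_inv k) k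
      * \<alpha> (g ** matrix_inv k ** matrix_inv (k ** h ** matrix_inv k)) (k ** h ** matrix_inv k))
    = a h v w * (\<alpha> (g ** matrix_inv h) h * \<alpha> (g ** matrix_inv h ** matrix_inv k) k)"
proof -
  let ?m = "k ** h ** matrix_inv k" and ?q = "g ** matrix_inv h ** matrix_inv k"
  have m: "?m \<in> G" and q: "?q \<in> G" using g k h by simp_all
  have q': "g ** matrix_inv k ** matrix_inv ?m = ?q"
    using g k h by (simp add: inv_mult matrix_mul_assoc[symmetric])
  have qm: "?q ** ?m = g ** matrix_inv k" and qk: "?q ** k = g ** matrix_inv h" and mk: "?m ** k = k ** h"
    using g k h by (simp_all add: matrix_mul_assoc[symmetric])
  have E: "\<alpha> ?m k * a ?m (k *v v) (k *v w) = \<alpha> k h * a h v w"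
    using assms by (simp add: equivariant_def)
  have C1: "\<alpha> ?q ?m * \<alpha> (g ** matrix_inv k) k = \<alpha> ?m k * \<alpha> ?q (k ** h)"
    using alpha_cocycle[OF q m k] by (simp only: qm mk)
  have C2: "\<alpha> ?q k * \<alpha> (g ** matrix_inv h) h = \<alpha> k h * \<alpha> ?q (k ** h)"
    using alpha_cocycle[OF q k h] by (simp only: qk)
  have "a ?m (k *v v) (k *v w) * (\<alpha> (g ** matrix_inv k) k * \<alpha> ?q ?m)
      = (\<alpha> ?m k * a ?m (k *v v) (k *v w)) * \<alpha> ?q (k ** h)"
    using C1 by (simp add: mult_ac)
  also have "\<dots> = a h v w * (\<alpha> (g ** matrix_inv h) h * \<alpha> ?q k)"
    unfolding E using C2 by (simp add: mult_ac)
  finally show ?thesis by (simp only: q')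
qed

lemma sum_conj: "k \<in> G \<Longrightarrow> (\<Sum>h\<in>G. F (k ** h ** matrix_inv k)) = (\<Sum>h\<in>G. F h)"
  using sum_left_translate[of k "\<lambda>h. F (h ** matrix_inv k)"] sum_right_translate[of "matrix_inv k" F]
  by simp

text \<open>Both sides contract the pairs \<open>i, j\<close> and \<open>d, e\<close>, in opposite
  orders. Contracting \<open>i, j\<close> first emits some \<open>k\<close> that acts on
  \<open>d\<close> and \<open>e\<close>; contracting \<open>d, e\<close> first emits some
  \<open>h\<close> in front of which \<open>k\<close> is emitted later. The double sums correspond
  when the second element of the first order is the conjugate of \<open>h\<close> by
  \<open>k\<close>. The inner difference is one of values on words two letters shorter, where
  \<open>IH\<close> supplies the swap rule.\<close>

lemma swap_term_far:
  assumes eq: equivariant and g: "g \<in> G"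
    and IH: "\<And>v i j z m h. length v + length z + 2 = length u + length x + length y + 2 \<Longrightarrow> h \<in> G \<Longrightarrow>
      N (v @ i # j # z) m h - N (v @ j # i # z) m h = swap_term N m h v i j z"
  shows "swap_term N n g u i j (x @ d # e # y) - swap_term N n g u i j (x @ e # d # y)
     = swap_term N n g (u @ i # j # x) d e y - swap_term N n g (u @ j # i # x) d e y"
proof -
  let ?A = "\<lambda>k i j. a k (basis_vec i) (basis_vec j)"
  \<comment> \<open>The common summand once both pairs are gone: \<open>x\<close> has been passed by
    \<open>k\<close> alone, \<open>y\<close> by the product \<open>m\<close> of both group elements,
    and two powers of the indeterminate are used up.\<close>
  define S where "S k m h = (\<Sum>x' | length x' = length x. act_coeff k x' x * act_ext N m (u @ x') y (n - 2) h)"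
    for k m h
  have L1: "act_ext N k u (x @ d # e # y) m h - act_ext N k u (x @ e # d # y) m h
     = (\<Sum>x' | length x' = length x. act_coeff k x' x * (\<Sum>d'\<in>UNIV. \<Sum>e'\<in>UNIV. k $ d' $ d * (k $ e' $ e *
         (\<Sum>y' | length y' = length y. act_coeff k y' y * swap_term N m h (u @ x') d' e' y'))))"
    if h: "h \<in> G" for k m h
  proof -
    have "act_ext N k v (d # e # y) m h - act_ext N k v (e # d # y) m h
       = (\<Sum>d'\<in>UNIV. \<Sum>e'\<in>UNIV. k $ d' $ d * (k $ e' $ e *
         (\<Sum>y' | length y' = length y. act_coeff k y' y * swap_term N m h v d' e' y')))"
      if v: "length v = length u + length x" for v
    proof -
      have "act_ext N k v (e # d # y) m h
          = (\<Sum>e'\<in>UNIV. \<Sum>d'\<in>UNIV. k $ d' $ d * (k $ e' $ e * act_ext N k (v @ [e', d']) y m h))"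
        by (simp add: act_ext_Cons sum_distrib_left mult_ac)
      also have "\<dots> = (\<Sum>d'\<in>UNIV. \<Sum>e'\<in>UNIV. k $ d' $ d * (k $ e' $ e * act_ext N k (v @ [e', d']) y m h))"
        by (rule sum.swap)
      finally have "act_ext N k v (d # e # y) m h - act_ext N k v (e # d # y) m h
         = (\<Sum>d'\<in>UNIV. \<Sum>e'\<in>UNIV. k $ d' $ d * (k $ e' $ e *
            (act_ext N k (v @ [d', e']) y m h - act_ext N k (v @ [e', d']) y m h)))"
        by (simp add: act_ext_Cons[of N k v] act_ext_Cons[of N k "v @ [_]"] sum_distrib_left
            right_diff_distrib sum_subtractf)
      moreover have "act_ext N k (v @ [d', e']) y m h - act_ext N k (v @ [e', d']) y m h
         = (\<Sum>y' | length y' = length y. act_coeff k y' y * swap_term N m h v d' e' y')" for d' e'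
        unfolding act_ext_def sum_subtractf[symmetric] right_diff_distrib[symmetric]
        using v h by (intro sum.cong refl) (simp add: IH[symmetric])
      ultimately show ?thesis by simp
    qed
    then show ?thesis
      unfolding act_ext_append sum_subtractf[symmetric] right_diff_distrib[symmetric]
      by (intro sum.cong refl) simp
  qed
  have S1: "act_ext N k u (x @ d # e # y) m h - act_ext N k u (x @ e # d # y) m h
     = (if m = 0 then 0 else \<Sum>l\<in>G. a l (k *v basis_vec d) (k *v basis_vec e) * (\<alpha> (h ** matrix_inv l) l *
         (\<Sum>x' | length x' = length x. act_coeff k x' x * act_ext N (l ** k) (u @ x') y (m - 1) (h ** matrix_inv l))))"
    if h: "h \<in> G" and k: "k \<in> G" for k m h
  proof (cases "m = 0")
    case True
    then show ?thesis unfolding L1[OF h] swap_term_act[OF k] by simp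
  next
    case False
    have "(\<Sum>x' | length x' = length x. \<Sum>l\<in>G. a l (k *v basis_vec d) (k *v basis_vec e) * (\<alpha> (h ** matrix_inv l) l *
         (act_coeff k x' x * act_ext N (l ** k) (u @ x') y (m - 1) (h ** matrix_inv l))))
      = (\<Sum>l\<in>G. \<Sum>x' | length x' = length x. a l (k *v basis_vec d) (k *v basis_vec e) * (\<alpha> (h ** matrix_inv l) l *
         (act_coeff k x' x * act_ext N (l ** k) (u @ x') y (m - 1) (h ** matrix_inv l))))"
      by (rule sum.swap)
    then show ?thesis
      using False unfolding L1[OF h] swap_term_act[OF k]
      by (simp add: sum_distrib_left mult_ac)
  qed
  have R1: "act_ext N h (u @ i # j # x) y m l - act_ext N h (u @ j # i # x) y m l
     = (if m = 0 then 0 else \<Sum>k\<in>G. ?A k i j * (\<alpha> (l ** matrix_inv k) k *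
         (\<Sum>x' | length x' = length x. act_coeff k x' x * act_ext N (k ** h) (u @ x') y (m - 1) (l ** matrix_inv k))))"
    if l: "l \<in> G" for h m l
  proof (cases "m = 0")
    case True
    have "act_ext N h (u @ i # j # x) y m l - act_ext N h (u @ j # i # x) y m l
      = (\<Sum>y' | length y' = length y. act_coeff h y' y * swap_term N m l u i j (x @ y'))"
      unfolding act_ext_def sum_subtractf[symmetric] right_diff_distrib[symmetric]
      using l by (intro sum.cong refl) (simp add: IH[symmetric])
    then show ?thesis using True by (simp add: swap_term_def)
  next
    case False
    have "act_ext N h (u @ i # j # x) y m l - act_ext N h (u @ j # i # x) y m l
      = (\<Sum>y' | length y' = length y. act_coeff h y' y * swap_term N m l u i j (x @ y'))"
      unfolding act_ext_def sum_subtractf[symmetric] right_diff_distrib[symmetric]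
      using l by (intro sum.cong refl) (simp add: IH[symmetric])
    also have "\<dots> = (\<Sum>y' | length y' = length y. \<Sum>k\<in>G. ?A k i j * (\<alpha> (l ** matrix_inv k) k *
         (act_coeff h y' y * act_ext N k u (x @ y') (m - 1) (l ** matrix_inv k))))"
      using False by (simp add: swap_term_def sum_distrib_left mult_ac)
    also have "\<dots> = (\<Sum>k\<in>G. \<Sum>y' | length y' = length y. ?A k i j * (\<alpha> (l ** matrix_inv k) k *
         (act_coeff h y' y * act_ext N k u (x @ y') (m - 1) (l ** matrix_inv k))))"
      by (rule sum.swap)
    also have "\<dots> = (\<Sum>k\<in>G. ?A k i j * (\<alpha> (l ** matrix_inv k) k *
         (\<Sum>x' | length x' = length x. act_coeff k x' x * act_ext N (k ** h) (u @ x') y (m - 1) (l ** matrix_inv k))))"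
    proof (intro sum.cong refl)
      fix k
      have "(\<Sum>y' | length y' = length y. act_coeff h y' y * act_ext N k u (x @ y') (m - 1) (l ** matrix_inv k))
        = (\<Sum>y' | length y' = length y. \<Sum>x' | length x' = length x. act_coeff k x' x *
            (act_coeff h y' y * act_ext N k (u @ x') y' (m - 1) (l ** matrix_inv k)))"
        by (simp add: act_ext_append sum_distrib_left mult_ac)
      also have "\<dots> = (\<Sum>x' | length x' = length x. \<Sum>y' | length y' = length y. act_coeff k x' x *
            (act_coeff h y' y * act_ext N k (u @ x') y' (m - 1) (l ** matrix_inv k)))"
        by (rule sum.swap)
      also have "\<dots> = (\<Sum>x' | length x' = length x. act_coeff k x' x * act_ext N (k ** h) (u @ x') y (m - 1) (l ** matrix_inv k))"
        by (simp only: sum_distrib_left[symmetric] act_ext_mult)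
      finally show "(\<Sum>y' | length y' = length y. ?A k i j * (\<alpha> (l ** matrix_inv k) k *
         (act_coeff h y' y * act_ext N k u (x @ y') (m - 1) (l ** matrix_inv k))))
        = ?A k i j * (\<alpha> (l ** matrix_inv k) k *
         (\<Sum>x' | length x' = length x. act_coeff k x' x * act_ext N (k ** h) (u @ x') y (m - 1) (l ** matrix_inv k)))"
        by (simp only: sum_distrib_left[symmetric])
    qed
    finally show ?thesis using False by simp
  qed
  \<comment> \<open>Each contraction costs one power of the indeterminate, so for
    \<open>n < 2\<close> there is no room for two of them and both sides vanish.\<close>
  show ?thesis
  proof (cases "n < 2")
    case True
    then have "n - 1 = 0" by simp
    show ?thesis
    proof (cases "n = 0")
      case True
      then show ?thesis by (simp add: swap_term_def)
    next
      case False
      have "swap_term N n g u i j (x @ d # e # y) - swap_term N n g u i j (x @ e # d # y) = 0"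
        unfolding swap_term_def if_not_P[OF False] \<open>n - 1 = 0\<close> sum_subtractf[symmetric] right_diff_distrib[symmetric]
        by (intro sum.neutral ballI) (simp only: S1[of _ _ 0] g inv_G mult_G if_True mult_zero_right refl)
      moreover have "swap_term N n g (u @ i # j # x) d e y - swap_term N n g (u @ j # i # x) d e y = 0"
        unfolding swap_term_def if_not_P[OF False] \<open>n - 1 = 0\<close> sum_subtractf[symmetric] right_diff_distrib[symmetric]
        by (intro sum.neutral ballI) (simp only: R1[of _ _ 0] g inv_G mult_G if_True mult_zero_right refl)
      ultimately show ?thesis by simp
    qed
  next
    case False
    then have n: "n \<noteq> 0" "n - 1 \<noteq> 0" "n - 1 - 1 = n - 2" by auto
    have "swap_term N n g u i j (x @ d # e # y) - swap_term N n g u i j (x @ e # d # y)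
      = (\<Sum>k\<in>G. ?A k i j * (\<alpha> (g ** matrix_inv k) k * (\<Sum>h\<in>G. a h (k *v basis_vec d) (k *v basis_vec e)
          * (\<alpha> (g ** matrix_inv k ** matrix_inv h) h * S k (h ** k) (g ** matrix_inv k ** matrix_inv h)))))"
      unfolding swap_term_def if_not_P[OF n(1)] sum_subtractf[symmetric] right_diff_distrib[symmetric]
      by (intro sum.cong refl) (simp only: S1 g inv_G mult_G n if_False S_def)
    also have "\<dots> = (\<Sum>k\<in>G. \<Sum>h\<in>G. ?A k i j * (a h (k *v basis_vec d) (k *v basis_vec e)
          * (\<alpha> (g ** matrix_inv k) k * \<alpha> (g ** matrix_inv k ** matrix_inv h) h) * S k (h ** k) (g ** matrix_inv k ** matrix_inv h)))"
      unfolding sum_distrib_left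
      by (intro sum.cong refl) (simp only: mult_ac)
    \<comment> \<open>The inner summation variable is conjugated by \<open>k\<close>; this is where
      equivariance enters.\<close>
    also have "\<dots> = (\<Sum>k\<in>G. \<Sum>h\<in>G. ?A k i j * (?A h d e *
          (\<alpha> (g ** matrix_inv h) h * \<alpha> (g ** matrix_inv h ** matrix_inv k) k) * S k (k ** h) (g ** matrix_inv h ** matrix_inv k)))"
    proof (rule sum.cong[OF refl])
      fix k assume k: "k \<in> G"
      show "(\<Sum>h\<in>G. ?A k i j * (a h (k *v basis_vec d) (k *v basis_vec e)
          * (\<alpha> (g ** matrix_inv k) k * \<alpha> (g ** matrix_inv k ** matrix_inv h) h) * S k (h ** k) (g ** matrix_inv k ** matrix_inv h)))
        = (\<Sum>h\<in>G. ?A k i j * (?A h d e *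
          (\<alpha> (g ** matrix_inv h) h * \<alpha> (g ** matrix_inv h ** matrix_inv k) k) * S k (k ** h) (g ** matrix_inv h ** matrix_inv k)))"
      proof (subst sum_conj[OF k, symmetric], rule sum.cong[OF refl])
        fix h assume h: "h \<in> G"
        have eqs: "k ** h ** matrix_inv k ** k = k ** h"
          "g ** matrix_inv k ** matrix_inv (k ** h ** matrix_inv k) = g ** matrix_inv h ** matrix_inv k"
          using k h by (simp_all add: inv_mult matrix_mul_assoc[symmetric])
        show "?A k i j * (a (k ** h ** matrix_inv k) (k *v basis_vec d) (k *v basis_vec e)
          * (\<alpha> (g ** matrix_inv k) k * \<alpha> (g ** matrix_inv k ** matrix_inv (k ** h ** matrix_inv k)) (k ** h ** matrix_inv k))
          * S k (k ** h ** matrix_inv k ** k) (g ** matrix_inv k ** matrix_inv (k ** h ** matrix_inv k)))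
        = ?A k i j * (?A h d e *
          (\<alpha> (g ** matrix_inv h) h * \<alpha> (g ** matrix_inv h ** matrix_inv k) k) * S k (k ** h) (g ** matrix_inv h ** matrix_inv k))"
          by (simp only: twisted_reindex[OF eq g k h, unfolded eqs(2)] eqs)
      qed
    qed
    also have "\<dots> = (\<Sum>h\<in>G. \<Sum>k\<in>G. ?A k i j * (?A h d e *
          (\<alpha> (g ** matrix_inv h) h * \<alpha> (g ** matrix_inv h ** matrix_inv k) k) * S k (k ** h) (g ** matrix_inv h ** matrix_inv k)))"
      by (rule sum.swap)
    also have "\<dots> = (\<Sum>h\<in>G. ?A h d e * (\<alpha> (g ** matrix_inv h) h * (\<Sum>k\<in>G. ?A k i j *
          (\<alpha> (g ** matrix_inv h ** matrix_inv k) k * S k (k ** h) (g ** matrix_inv h ** matrix_inv k)))))"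
      unfolding sum_distrib_left
      by (intro sum.cong refl) (simp only: mult_ac)
    also have "\<dots> = swap_term N n g (u @ i # j # x) d e y - swap_term N n g (u @ j # i # x) d e y"
      unfolding swap_term_def if_not_P[OF n(1)] sum_subtractf[symmetric] right_diff_distrib[symmetric]
      by (intro sum.cong refl) (simp only: R1 g inv_G mult_G n if_False S_def)
    finally show ?thesis .
  qed
qed

lemma swap_term_cong:
  "(\<And>v. length v = length u + length y \<Longrightarrow> N v = N' v) \<Longrightarrow> swap_term N n g u i j y = swap_term N' n g u i j y"
  unfolding swap_term_def act_ext_def by (intro if_cong sum.cong refl arg_cong2[where f = "(*)"]) simp

text \<open>The recursive calls go to words that are not parts of \<open>w\<close>, since a group
  element has acted on some letters, so the recursion is on a bound \<open>m\<close>. It stabilizes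
  as soon as \<open>m\<close> is at least the length of \<open>w\<close>, because a swap term refers
  to words two letters shorter.\<close>

primrec coef_approx :: "('n \<Rightarrow> nat) \<Rightarrow> ('n multiset \<Rightarrow> nat \<Rightarrow> complex ^ 'n ^ 'n \<Rightarrow> complex)
    \<Rightarrow> nat \<Rightarrow> 'n list \<Rightarrow> nat \<Rightarrow> complex ^ 'n ^ 'n \<Rightarrow> complex" where
  "coef_approx r b 0 w = b (mset w)"
| "coef_approx r b (Suc m) w = (\<lambda>n g. b (mset w) n g + sort_potential r (swap_term (coef_approx r b m) n g) [] w)"

text \<open>
  For \<open>b\<close> supported on one multiset this is the coefficient of a sorted word in the normal form
  of \<open>w\<close>.
\<close>

definition coef :: "('n \<Rightarrow> nat) \<Rightarrow> ('n multiset \<Rightarrow> nat \<Rightarrow> complex ^ 'n ^ 'n \<Rightarrow> complex)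
    \<Rightarrow> 'n list \<Rightarrow> nat \<Rightarrow> complex ^ 'n ^ 'n \<Rightarrow> complex" where
  "coef r b w = coef_approx r b (length w) w"

lemma coef_approx_stable:
  "length w \<le> m \<Longrightarrow> coef_approx r b m w
     = (\<lambda>n g. b (mset w) n g + sort_potential r (swap_term (coef r b) n g) [] w)"
proof (induction "length w" arbitrary: m w rule: less_induct)
  case less
  have eq: "coef_approx r b m' v = coef r b v" if "length v < length w" "length v \<le> m'" for m' v
    using less.hyps[OF that(1) that(2)] less.hyps[OF that(1) order.refl] by (simp add: coef_def)
  show ?case
  proof (cases m)
    case 0
    then show ?thesis using less.prems by simp
  next
    case (Suc m')
    have "sort_potential r (swap_term (coef_approx r b m') n g) [] w
        = sort_potential r (swap_term (coef r b) n g) [] w" for n g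
    proof (rule sort_potential_cong[of "length w"])
      fix u y :: "'n list" and i j assume "length u + length y + 2 = length w"
      then show "swap_term (coef_approx r b m') n g u i j y = swap_term (coef r b) n g u i j y"
        using less.prems Suc by (intro swap_term_cong eq) auto
    qed simp
    then show ?thesis using Suc by simp
  qed
qed

lemma coef_unfold:
  "coef r b w n g = b (mset w) n g + sort_potential r (swap_term (coef r b) n g) [] w"
  unfolding coef_def[of r b w] by (subst coef_approx_stable) (simp_all add: coef_def[abs_def])

text \<open>Strong induction on the length: the swap rule at smaller lengths yields
  \<open>far\<close> at length \<open>L\<close>, so the swap terms form a cocycle there and
  \<open>sort_potential\<close> has them as increments. The summand \<open>b\<close> depends on the
  multiset only and cancels.\<close>

lemma coef_swap:
  assumes r: "inj r" and eq: equivariant and jac: jacobi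
  shows "g \<in> G \<Longrightarrow> length u + length y + 2 = L \<Longrightarrow>
    coef r b (u @ i # j # y) n g - coef r b (u @ j # i # y) n g = swap_term (coef r b) n g u i j y"
proof (induction L arbitrary: g u i j y n rule: less_induct)
  case (less L)
  interpret swap_cocycle r "swap_term (coef r b) n g" L
  proof
    show "inj r" by (rule r)
  next
    fix u :: "'n list" and y a b'
    show "swap_term (coef r b) n g u b' a y = - swap_term (coef r b) n g u a b' y"
      by (rule swap_term_anti)
  next
    fix u x y :: "'n list" and i j d e
    assume L: "length u + length x + length y + 4 = L"
    show "swap_term (coef r b) n g u i j (x @ d # e # y) - swap_term (coef r b) n g u i j (x @ e # d # y)
       = swap_term (coef r b) n g (u @ i # j # x) d e y - swap_term (coef r b) n g (u @ j # i # x) d e y"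
    proof (rule swap_term_far[OF eq less.prems(1)])
      fix v z :: "'n list" and i j m h
      assume "length v + length z + 2 = length u + length x + length y + 2" and h: "h \<in> G"
      then have "length v + length z + 2 < L" using L by simp
      from less.IH[OF this h refl]
      show "coef r b (v @ i # j # z) m h - coef r b (v @ j # i # z) m h = swap_term (coef r b) m h v i j z" .
    qed
  qed (rule swap_term_braid[OF jac])
  show ?case
    using sort_potential_swap[of "[]" u y i j] less.prems
    by (simp add: coef_unfold[of r b "u @ i # j # y"] coef_unfold[of r b "u @ j # i # y"] add_mset_commute)
qed

lemma sort_potential_zero: "sort_potential r (\<lambda>u i j y. 0) u w = 0"
proof -
  have "bubble r (\<lambda>u i j y. 0) u i s = 0" for u i s
    by (induction s arbitrary: u) simp_all
  then show ?thesis by (induction w arbitrary: u) simp_all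
qed

text \<open>Corrections for a word of length at most \<open>k\<close> involve values at lengths
  below \<open>k\<close>, and these vanish because \<open>b\<close> is concentrated in size
  \<open>k\<close>. So up to degree \<open>k\<close> the functional is the plain commutative
  coefficient.\<close>

lemma coef_low:
  assumes b: "\<And>M n g. size M \<noteq> k \<Longrightarrow> b M n g = 0"
  shows "length w \<le> k \<Longrightarrow> coef r b w n g = b (mset w) n g"
proof (induction "length w" arbitrary: w n g rule: less_induct)
  case less
  have "sort_potential r (swap_term (coef r b) n g) [] w = sort_potential r (\<lambda>u i j y. 0) [] w"
  proof (rule sort_potential_cong[of "length w"])
    fix u y :: "'n list" and i j assume L: "length u + length y + 2 = length w"
    have "coef r b v = (\<lambda>n g. 0)" if "length v = length u + length y" for v
    proof (intro ext)
      fix n g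
      have "coef r b v n g = b (mset v) n g" using that L less.prems by (intro less.hyps) auto
      also have "\<dots> = 0" using that L less.prems by (intro b) auto
      finally show "coef r b v n g = 0" .
    qed
    then have "swap_term (coef r b) n g u i j y = swap_term (\<lambda>w n g. 0) n g u i j y"
      by (rule swap_term_cong)
    then show "swap_term (coef r b) n g u i j y = 0" by (simp add: swap_term_def act_ext_def)
  qed simp
  then show ?case by (simp add: coef_unfold[of r b w] sort_potential_zero)
qed

section \<open>The defining relations as elements of the polynomial algebra\<close>

abbreviation "hideal \<equiv> hecke_ideal G \<alpha> a"

definition hecke_rel :: "complex ^ 'n \<Rightarrow> complex ^ 'n \<Rightarrow> nat \<Rightarrow> complex ^ 'n ^ 'n \<Rightarrow> 'n list \<Rightarrow> complex" where
  "hecke_rel v w = hecke_vec G \<alpha> v \<otimes>\<^bsub>P\<^esub> hecke_vec G \<alpha> w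
       \<ominus>\<^bsub>P\<^esub> hecke_vec G \<alpha> w \<otimes>\<^bsub>P\<^esub> hecke_vec G \<alpha> v
       \<ominus>\<^bsub>P\<^esub> (\<Oplus>\<^bsub>P\<^esub>g \<in> G. hecke_group G \<alpha> (a g v w) g)"

definition commutator :: "complex ^ 'n \<Rightarrow> complex ^ 'n \<Rightarrow> 'n list \<Rightarrow> complex" where
  "commutator v w = (\<lambda>x. tmul (tensor_vec v) (tensor_vec w) x - tmul (tensor_vec w) (tensor_vec v) x)"

lemma commutator_tensors: "commutator v w \<in> tensors"
  unfolding commutator_def by (intro tensors_diff tensors_tmul tensor_vec_in_tensors)

lemma tensor_act_commutator: "tensor_act h (commutator v w) = commutator (h *v v) (h *v w)"
  unfolding commutator_def by (simp add: tensor_act_diff[abs_def] tensor_act_tmul tensor_act_vec)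

lemma commutator_sum:
  "commutator v w = (\<lambda>x. \<Sum>i\<in>UNIV. \<Sum>j\<in>UNIV. v $ i * (w $ j * (word [i, j] x - word [j, i] x)))"
proof
  fix x
  have "tmul (tensor_vec w) (tensor_vec v) x = (\<Sum>j\<in>UNIV. \<Sum>i\<in>UNIV. v $ i * (w $ j * word [j, i] x))"
    unfolding tmul_vec_vec by (intro sum.cong refl) (simp only: mult_ac)
  also have "\<dots> = (\<Sum>i\<in>UNIV. \<Sum>j\<in>UNIV. v $ i * (w $ j * word [j, i] x))"
    by (rule sum.swap)
  finally show "commutator v w x = (\<Sum>i\<in>UNIV. \<Sum>j\<in>UNIV. v $ i * (w $ j * (word [i, j] x - word [j, i] x)))"
    unfolding commutator_def tmul_vec_vec[of v w] by (simp only: right_diff_distrib sum_subtractf)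
qed

lemma vec_vec: "hecke_vec G \<alpha> v \<otimes>\<^bsub>P\<^esub> hecke_vec G \<alpha> w = tmon 0 (mat 1) (tmul (tensor_vec v) (tensor_vec w))"
  by (simp add: hecke_vec_eq tmon_mult)

lemma group_sum_closed: "(\<Oplus>\<^bsub>P\<^esub>g \<in> G. hecke_group G \<alpha> (c g) g) \<in> carrier P"
proof -
  interpret P: ring P by (rule ring_P)
  show ?thesis
    by (intro P.finsum_closed) (auto simp: hecke_group_eq intro!: tmon_closed tensors_scale)
qed

lemma group_sum: "k \<in> G \<Longrightarrow> (\<Oplus>\<^bsub>P\<^esub>g \<in> G. hecke_group G \<alpha> (c g) g) i k w = (if i = 1 then c k * word [] w else 0)"
proof -
  assume k: "k \<in> G"
  have "(\<Oplus>\<^bsub>P\<^esub>g \<in> G. hecke_group G \<alpha> (c g) g) = (\<lambda>i. \<lambda>k\<in>G. \<lambda>w. \<Sum>g\<in>G. hecke_group G \<alpha> (c g) g i k w)"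
    by (rule finsum_P) (auto simp: hecke_group_eq intro!: tmon_closed tensors_scale)
  then show ?thesis using k by (simp add: hecke_group_eq tmon_apply)
qed

lemma hecke_rel_closed: "hecke_rel v w \<in> carrier P"
  unfolding hecke_rel_def vec_vec
  by (intro minus_P_closed group_sum_closed tmon_closed tensors_tmul tensor_vec_in_tensors)

lemma hecke_rel_apply:
  assumes "g \<in> G"
  shows "hecke_rel v w i g = (if i = 0 \<and> g = mat 1 then commutator v w
    else if i = 1 then (\<lambda>x. - a g v w * word [] x) else (\<lambda>x. 0))"
proof
  fix x
  have "hecke_rel v w i g x = tmon 0 (mat 1) (tmul (tensor_vec v) (tensor_vec w)) i g x
      - tmon 0 (mat 1) (tmul (tensor_vec w) (tensor_vec v)) i g x
      - (\<Oplus>\<^bsub>P\<^esub>g \<in> G. hecke_group G \<alpha> (a g v w) g) i g x"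
    unfolding hecke_rel_def vec_vec using assms
    by (simp only: minus_P minus_P_closed group_sum_closed tmon_closed tensors_tmul tensor_vec_in_tensors)
  then show "hecke_rel v w i g x = (if i = 0 \<and> g = mat 1 then commutator v w
    else if i = 1 then (\<lambda>x. - a g v w * word [] x) else (\<lambda>x. 0)) x"
    using assms by (simp add: group_sum tmon_apply commutator_def)
qed

lemma hecke_ideal_Idl: "hideal = Idl\<^bsub>P\<^esub> {hecke_rel v w | v w. True}"
  by (simp add: hecke_ideal_def hecke_rel_def Let_def)

lemma ideal_hideal: "ideal hideal P"
  unfolding hecke_ideal_Idl
  by (rule ring.genideal_ideal[OF ring_P]) (auto intro: hecke_rel_closed)

lemma hecke_rel_in: "hecke_rel v w \<in> hideal"
  unfolding hecke_ideal_Idl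
  by (rule subsetD[OF ring.genideal_self[OF ring_P]]) (auto intro: hecke_rel_closed)

lemma hideal_closed: "x \<in> hideal \<Longrightarrow> x \<in> carrier P"
  using ideal.Icarr[OF ideal_hideal] .

lemma tmon_hecke_rel:
  assumes h: "h \<in> G" and k: "k \<in> G" and f: "f \<in> tensors"
  shows "(tmon n h f \<otimes>\<^bsub>P\<^esub> hecke_rel v w) i k x = (if i = n \<and> k = h then tmul f (commutator (h *v v) (h *v w)) x
    else if i = n + 1 then - \<alpha> h (matrix_inv h ** k) * a (matrix_inv h ** k) v w * f x else 0)"
proof -
  have kh: "matrix_inv h ** k = mat 1 \<longleftrightarrow> k = h"
    by (metis h inv_cancel_left' inv_left matrix_mul_rid)
  have s: "tmul f (tensor_act h (\<lambda>x. - (c * word [] x))) x = - (c * f x)" for c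
  proof -
    have "tensor_act h (\<lambda>x. - (c * word [] x)) = (\<lambda>x. - (c * word [] x))"
      using tensor_act_scale[of h "- c" "word []"] by (intro HOL.ext) simp
    then show ?thesis using tmul_scale_right[of f "- c" "word []" x] by simp
  qed
  show ?thesis
    using h k f kh
    by (auto simp: tmon_mult_left hecke_rel_closed hecke_rel_apply tensor_act_commutator
        tensor_act_0[abs_def] s)
qed

lemma hecke_rel_tmon:
  assumes h: "h \<in> G" and k: "k \<in> G"
  shows "(hecke_rel v w \<otimes>\<^bsub>P\<^esub> tmon n h (word [])) i k x = (if i = n \<and> k = h then commutator v w x
    else if i = n + 1 then - \<alpha> (k ** matrix_inv h) h * a (k ** matrix_inv h) v w * word [] x else 0)"
proof -
  have kh: "k ** matrix_inv h = mat 1 \<longleftrightarrow> k = h"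
    by (metis h inv_cancel_right inv_right matrix_mul_lid)
  show ?thesis
    using h k kh by (auto simp: tmon_mult_right hecke_rel_closed hecke_rel_apply)
qed

lemma equivariantD:
  assumes equivariant "h \<in> G" "k \<in> G"
  shows "\<alpha> (k ** matrix_inv h) h * a (k ** matrix_inv h) (h *v v) (h *v w)
    = \<alpha> h (matrix_inv h ** k) * a (matrix_inv h ** k) v w"
  using assms unfolding equivariant_def
  by (metis inv_G inv_cancel_left' mult_G)

text \<open>Conjugation by a group element permutes the relations exactly when the forms are
  equivariant. This lets the group part of a left factor be carried across a relation to the
  right.\<close>

lemma group_hecke_rel:
  assumes eq: equivariant and h: "h \<in> G"
  shows "tmon 0 h (word []) \<otimes>\<^bsub>P\<^esub> hecke_rel v w = hecke_rel (h *v v) (h *v w) \<otimes>\<^bsub>P\<^esub> tmon 0 h (word [])"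
  by (intro P_eqI mult_P_closed tmon_closed tensors_word hecke_rel_closed)
     (simp add: tmon_hecke_rel hecke_rel_tmon h equivariantD[OF eq h])

section \<open>Linear and right linear extension of a functional on words\<close>

definition lin :: "('n list \<Rightarrow> nat \<Rightarrow> complex ^ 'n ^ 'n \<Rightarrow> complex) \<Rightarrow> ('n list \<Rightarrow> complex)
    \<Rightarrow> nat \<Rightarrow> complex ^ 'n ^ 'n \<Rightarrow> complex" where
  "lin F f n k = (\<Sum>w | f w \<noteq> 0. f w * F w n k)"

lemma lin_superset: "finite S \<Longrightarrow> {w. f w \<noteq> 0} \<subseteq> S \<Longrightarrow> lin F f n k = (\<Sum>w\<in>S. f w * F w n k)"
  unfolding lin_def by (rule sum.mono_neutral_left) auto

lemma lin_0 [simp]: "lin F (\<lambda>w. 0) n k = 0"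
  by (simp add: lin_def)

lemma lin_add:
  assumes "f \<in> tensors" "g \<in> tensors"
  shows "lin F (\<lambda>w. f w + g w) n k = lin F f n k + lin F g n k"
proof -
  let ?S = "{w. f w \<noteq> 0} \<union> {w. g w \<noteq> 0}"
  have S: "finite ?S" using assms by (simp add: tensors_def)
  show ?thesis
    by (subst (1 2 3) lin_superset[OF S]) (auto simp: distrib_right sum.distrib)
qed

lemma lin_scale: "lin F (\<lambda>w. c * f w) n k = c * lin F f n k"
  by (cases "c = 0") (simp_all add: lin_def sum_distrib_left mult.assoc)

lemma lin_word [simp]: "lin F (word w) n k = F w n k"
  by (simp add: lin_def word_def)

lemma lin_sum:
  "(\<And>x. x \<in> A \<Longrightarrow> f x \<in> tensors) \<Longrightarrow> lin F (\<lambda>w. \<Sum>x\<in>A. f x w) n k = (\<Sum>x\<in>A. lin F (f x) n k)"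
  by (induction A rule: infinite_finite_induct) (simp_all add: lin_add tensors_sum)

lemma lin_diff:
  assumes "f \<in> tensors" "g \<in> tensors"
  shows "lin F (\<lambda>w. f w - g w) n k = lin F f n k - lin F g n k"
  using lin_add[OF assms(1) tensors_scale[OF assms(2)], of F "-1" n k] lin_scale[of F "-1" g n k] by simp

lemma lin_word_act: "lin F (tmul (word u) (tensor_act k (word y))) n g = act_ext F k u y n g"
proof -
  have "tensor_act k (word y) = (\<lambda>x. \<Sum>z | length z = length y. act_coeff k z y * word z x)"
  proof
    fix x
    have "(\<Sum>z | length z = length y. act_coeff k z y * word z x)
       = (\<Sum>z | length z = length y. if z = x then act_coeff k x y else 0)"
      by (intro sum.cong) (auto simp: word_def)
    then show "tensor_act k (word y) x = (\<Sum>z | length z = length y. act_coeff k z y * word z x)"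
      by (cases "length x = length y")
         (simp_all add: tensor_act_word tensor_act_word_other finite_words_length)
  qed
  then have "tmul (word u) (tensor_act k (word y)) = (\<lambda>x. \<Sum>z | length z = length y. act_coeff k z y * word (u @ z) x)"
    by (simp add: tmul_sum_right[abs_def] tmul_scale_right[abs_def] tmul_word_word)
  then show ?thesis
    by (simp add: lin_sum tensors_scale lin_scale act_ext_def)
qed

text \<open>
  The extension of \<open>F\<close> to \<open>T(V) #\<^sub>\<alpha> G[t]\<close> that is linear for right multiplication by
  \<open>\<complex>G[t]\<close>; its values are elements of \<open>\<complex>G[t]\<close> given by their coefficients.
\<close>

definition rext :: "('n list \<Rightarrow> nat \<Rightarrow> complex ^ 'n ^ 'n \<Rightarrow> complex) \<Rightarrow> (nat \<Rightarrow> complex ^ 'n ^ 'n \<Rightarrow> 'n list \<Rightarrow> complex)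
    \<Rightarrow> nat \<Rightarrow> complex ^ 'n ^ 'n \<Rightarrow> complex" where
  "rext F x n k = (\<Sum>i\<le>n. \<Sum>g\<in>G. \<alpha> (k ** matrix_inv g) g * lin F (x i g) (n - i) (k ** matrix_inv g))"

lemma rext_add:
  assumes "x \<in> carrier P" "y \<in> carrier P"
  shows "rext F (x \<oplus>\<^bsub>P\<^esub> y) n k = rext F x n k + rext F y n k"
proof -
  have "lin F ((x \<oplus>\<^bsub>P\<^esub> y) i g) m l = lin F (x i g) m l + lin F (y i g) m l" if "g \<in> G" for i g m l
    using that assms by (simp add: add_P lin_add P_tensors)
  then show ?thesis
    by (simp add: rext_def distrib_left sum.distrib)
qed

text \<open>Right linearity over the twisted group algebra. Reindexing by \<open>g ** l\<close>
  leaves the weights of the two products of three group elements, and the cocycle identity for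
  \<open>?p g\<close>, \<open>g\<close>, \<open>l\<close> equates them.\<close>

lemma rext_mult_group:
  assumes x: "x \<in> carrier P" and l: "l \<in> G" and k: "k \<in> G"
  shows "rext F (x \<otimes>\<^bsub>P\<^esub> tmon m l (\<lambda>w. c * word [] w)) n k
    = (if m \<le> n then c * (\<alpha> (k ** matrix_inv l) l * rext F x (n - m) (k ** matrix_inv l)) else 0)"
proof -
  let ?p = "\<lambda>g. k ** matrix_inv l ** matrix_inv g"
  have *: "(x \<otimes>\<^bsub>P\<^esub> tmon m l (\<lambda>w. c * word [] w)) i g
      = (if m \<le> i then (\<lambda>w. c * (\<alpha> (g ** matrix_inv l) l * x (i - m) (g ** matrix_inv l) w)) else (\<lambda>w. 0))"
    if "g \<in> G" for i g
    by (rule ext) (use that l x in \<open>simp add: tmon_mult_right tensors_scale tensor_act_scale[abs_def] tmul_scale_right\<close>)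
  have inner: "(\<Sum>g\<in>G. \<alpha> (k ** matrix_inv g) g
      * lin F ((x \<otimes>\<^bsub>P\<^esub> tmon m l (\<lambda>w. c * word [] w)) i g) q (k ** matrix_inv g))
     = (if m \<le> i then c * (\<alpha> (k ** matrix_inv l) l * (\<Sum>g\<in>G. \<alpha> (?p g) g * lin F (x (i - m) g) q (?p g))) else 0)"
    for i q
  proof (cases "m \<le> i")
    case True
    have "(\<Sum>g\<in>G. \<alpha> (k ** matrix_inv g) g
      * lin F ((x \<otimes>\<^bsub>P\<^esub> tmon m l (\<lambda>w. c * word [] w)) i g) q (k ** matrix_inv g))
      = (\<Sum>g\<in>G. c * (\<alpha> (k ** matrix_inv g) g * \<alpha> (g ** matrix_inv l) l * lin F (x (i - m) (g ** matrix_inv l)) q (k ** matrix_inv g)))"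
      using True by (intro sum.cong refl) (simp add: * lin_scale mult_ac)
    also have "\<dots> = (\<Sum>g\<in>G. c * (\<alpha> (k ** matrix_inv (g ** l)) (g ** l) * \<alpha> g l * lin F (x (i - m) g) q (k ** matrix_inv (g ** l))))"
      using l by (subst sum_right_translate[OF l, symmetric]) simp
    also have "\<dots> = (\<Sum>g\<in>G. c * (\<alpha> (k ** matrix_inv l) l * (\<alpha> (?p g) g * lin F (x (i - m) g) q (?p g))))"
    proof (rule sum.cong[OF refl])
      fix g assume g: "g \<in> G"
      have e: "k ** matrix_inv (g ** l) = ?p g" "?p g ** g = k ** matrix_inv l"
        using g l by (simp_all add: inv_mult matrix_mul_assoc)
      have "\<alpha> (?p g) g * \<alpha> (k ** matrix_inv l) l = \<alpha> g l * \<alpha> (?p g) (g ** l)"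
        using alpha_cocycle[of "?p g" g l] g k l by (simp only: e(2) inv_G mult_G)
      then show "c * (\<alpha> (k ** matrix_inv (g ** l)) (g ** l) * \<alpha> g l * lin F (x (i - m) g) q (k ** matrix_inv (g ** l)))
        = c * (\<alpha> (k ** matrix_inv l) l * (\<alpha> (?p g) g * lin F (x (i - m) g) q (?p g)))"
        unfolding e(1) by (simp add: mult_ac)
    qed
    finally show ?thesis using True by (simp add: sum_distrib_left)
  next
    case False
    then show ?thesis by (simp add: *)
  qed
  have "rext F (x \<otimes>\<^bsub>P\<^esub> tmon m l (\<lambda>w. c * word [] w)) n k
    = (\<Sum>i\<le>n. if m \<le> i then c * (\<alpha> (k ** matrix_inv l) l * (\<Sum>g\<in>G. \<alpha> (?p g) g * lin F (x (i - m) g) (n - i) (?p g))) else 0)"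
    unfolding rext_def inner ..
  also have "\<dots> = (\<Sum>i\<in>{m..n}. c * (\<alpha> (k ** matrix_inv l) l * (\<Sum>g\<in>G. \<alpha> (?p g) g * lin F (x (i - m) g) (n - i) (?p g))))"
    by (rule sum.mono_neutral_cong_right) auto
  also have "\<dots> = (if m \<le> n then c * (\<alpha> (k ** matrix_inv l) l * rext F x (n - m) (k ** matrix_inv l)) else 0)"
  proof (cases "m \<le> n")
    case True
    have "(\<Sum>i\<in>{m..n}. c * (\<alpha> (k ** matrix_inv l) l * (\<Sum>g\<in>G. \<alpha> (?p g) g * lin F (x (i - m) g) (n - i) (?p g))))
      = (\<Sum>i\<le>n - m. c * (\<alpha> (k ** matrix_inv l) l * (\<Sum>g\<in>G. \<alpha> (?p g) g * lin F (x i g) (n - m - i) (?p g))))"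
      by (rule sum.reindex_bij_witness[where i = "\<lambda>i. i + m" and j = "\<lambda>i. i - m"]) (use True in auto)
    then show ?thesis using True by (simp add: rext_def sum_distrib_left)
  qed simp
  finally show ?thesis .
qed

lemma lin_commutator_word:
  assumes F: "\<And>u i j y n. F (u @ i # j # y) n q - F (u @ j # i # y) n q = swap_term F n q u i j y"
  shows "lin F (tmul (word u) (tmul (commutator v w) (word y))) n q = (if n = 0 then 0 else
     \<Sum>k\<in>G. a k v w * (\<alpha> (q ** matrix_inv k) k * act_ext F k u y (n - 1) (q ** matrix_inv k)))"
proof -
  have "tmul (word u) (tmul (commutator v w) (word y))
     = (\<lambda>x. \<Sum>i\<in>UNIV. \<Sum>j\<in>UNIV. v $ i * (w $ j * (word (u @ i # j # y) x - word (u @ j # i # y) x)))"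
    unfolding commutator_sum
    by (simp add: tmul_sum_left[abs_def] tmul_scale_left[abs_def] tmul_diff_left[abs_def] tmul_word_word
        tmul_sum_right[abs_def] tmul_scale_right[abs_def] tmul_diff_right[abs_def])
  then have "lin F (tmul (word u) (tmul (commutator v w) (word y))) n q
     = (\<Sum>i\<in>UNIV. \<Sum>j\<in>UNIV. v $ i * (w $ j * swap_term F n q u i j y))"
    by (simp add: lin_sum tensors_sum tensors_scale tensors_diff lin_scale lin_diff F)
  also have "\<dots> = (if n = 0 then 0 else
     \<Sum>k\<in>G. a k v w * (\<alpha> (q ** matrix_inv k) k * act_ext F k u y (n - 1) (q ** matrix_inv k)))"
  proof (cases "n = 0")
    case False
    let ?X = "\<lambda>k. \<alpha> (q ** matrix_inv k) k * act_ext F k u y (n - 1) (q ** matrix_inv k)"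
    have "(\<Sum>i\<in>UNIV. \<Sum>j\<in>UNIV. v $ i * (w $ j * swap_term F n q u i j y))
       = (\<Sum>i\<in>UNIV. \<Sum>j\<in>UNIV. \<Sum>k\<in>G. v $ i * (w $ j * (a k (basis_vec i) (basis_vec j) * ?X k)))"
      unfolding swap_term_def if_not_P[OF False] sum_distrib_left ..
    also have "\<dots> = (\<Sum>i\<in>UNIV. \<Sum>k\<in>G. \<Sum>j\<in>UNIV. v $ i * (w $ j * (a k (basis_vec i) (basis_vec j) * ?X k)))"
      by (intro sum.cong refl sum.swap)
    also have "\<dots> = (\<Sum>k\<in>G. \<Sum>i\<in>UNIV. \<Sum>j\<in>UNIV. v $ i * (w $ j * (a k (basis_vec i) (basis_vec j) * ?X k)))"
      by (rule sum.swap)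
    also have "\<dots> = (\<Sum>k\<in>G. a k v w * ?X k)"
    proof (rule sum.cong[OF refl])
      fix k assume k: "k \<in> G"
      have "a k v w = a k (\<Sum>i\<in>UNIV. (v $ i) *s basis_vec i) (\<Sum>j\<in>UNIV. (w $ j) *s basis_vec j)"
        by (simp only: vec_basis_sum[symmetric])
      also have "\<dots> = (\<Sum>i\<in>UNIV. v $ i * (\<Sum>j\<in>UNIV. w $ j * a k (basis_vec i) (basis_vec j)))"
        unfolding skew_form_sum_left[OF skew[OF k]] unfolding skew_form_sum_right[OF skew[OF k]] ..
      finally show "(\<Sum>i\<in>UNIV. \<Sum>j\<in>UNIV. v $ i * (w $ j * (a k (basis_vec i) (basis_vec j) * ?X k))) = a k v w * ?X k"
        by (simp only: sum_distrib_left sum_distrib_right mult.assoc)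
    qed
    finally show ?thesis using False by simp
  qed (simp add: swap_term_def)
  finally show ?thesis .
qed

text \<open>The swap rule for basis letters, extended bilinearly to vectors \<open>v\<close>,
  \<open>w\<close> and linearly to the tensor \<open>z\<close> behind them. The group element
  emitted by the commutator acts on \<open>z\<close>.\<close>

lemma lin_commutator:
  assumes F: "\<And>u i j y n. F (u @ i # j # y) n q - F (u @ j # i # y) n q = swap_term F n q u i j y"
    and z: "z \<in> tensors"
  shows "lin F (tmul (word u) (tmul (commutator v w) z)) n q = (if n = 0 then 0 else
     \<Sum>k\<in>G. a k v w * (\<alpha> (q ** matrix_inv k) k * lin F (tmul (word u) (tensor_act k z)) (n - 1) (q ** matrix_inv k)))"
  using z
proof (induction z rule: tensors_induct)
  case (word c y)
  show ?case
    using lin_commutator_word[OF F, of u v w y n]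
    by (simp add: tmul_scale_right[abs_def] tensor_act_scale[abs_def] lin_scale lin_word_act
        sum_distrib_left mult_ac)
next
  case (add f g)
  have t: "tmul (word u) (tmul (commutator v w) h) \<in> tensors" "tmul (word u) (tensor_act k h) \<in> tensors"
    if "h \<in> tensors" for h k
    using that by (auto intro!: tensors_tmul tensors_act commutator_tensors)
  show ?case
    using add
    by (simp add: tmul_add_right[abs_def] tensor_act_add[abs_def] lin_add t sum.distrib distrib_left)
qed

text \<open>The largest two-sided ideal on which the functional vanishes. Since arbitrary factors on
  both sides are built in, the whole Hecke ideal lies in it as soon as the generators do.\<close>

definition annih :: "('n list \<Rightarrow> nat \<Rightarrow> complex ^ 'n ^ 'n \<Rightarrow> complex) \<Rightarrow> (nat \<Rightarrow> complex ^ 'n ^ 'n \<Rightarrow> 'n list \<Rightarrow> complex) set" where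
  "annih F = {x \<in> carrier P. \<forall>y\<in>carrier P. \<forall>z\<in>carrier P. \<forall>n. \<forall>k\<in>G. rext F (y \<otimes>\<^bsub>P\<^esub> (x \<otimes>\<^bsub>P\<^esub> z)) n k = 0}"

lemma ideal_annih: "ideal (annih F) P"
proof -
  interpret P: ring P by (rule ring_P)
  have zero: "rext F \<zero>\<^bsub>P\<^esub> n k = 0" for n k
    by (simp add: rext_def zero_P)
  show ?thesis
  proof (rule P.ideal_intro)
    show "annih F \<subseteq> carrier P" by (auto simp: annih_def)
    show "\<zero>\<^bsub>P\<^esub> \<in> annih F" by (simp add: annih_def zero)
  next
    fix x y assume "x \<in> annih F" "y \<in> annih F"
    then show "x \<oplus>\<^bsub>P\<^esub> y \<in> annih F" by (simp add: annih_def P.l_distr P.r_distr rext_add)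
  next
    fix x y assume x: "x \<in> annih F" and y: "y \<in> carrier P"
    have "rext F (p \<otimes>\<^bsub>P\<^esub> (y \<otimes>\<^bsub>P\<^esub> x \<otimes>\<^bsub>P\<^esub> q)) n k = 0"
      if "p \<in> carrier P" "q \<in> carrier P" "k \<in> G" for p q n k
    proof -
      have "p \<otimes>\<^bsub>P\<^esub> (y \<otimes>\<^bsub>P\<^esub> x \<otimes>\<^bsub>P\<^esub> q) = (p \<otimes>\<^bsub>P\<^esub> y) \<otimes>\<^bsub>P\<^esub> (x \<otimes>\<^bsub>P\<^esub> q)"
        using that x y by (simp add: annih_def P.m_assoc)
      then show ?thesis using that x y by (simp add: annih_def)
    qed
    then show "y \<otimes>\<^bsub>P\<^esub> x \<in> annih F" using x y by (simp add: annih_def)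
    have "rext F (p \<otimes>\<^bsub>P\<^esub> (x \<otimes>\<^bsub>P\<^esub> y \<otimes>\<^bsub>P\<^esub> q)) n k = 0"
      if "p \<in> carrier P" "q \<in> carrier P" "k \<in> G" for p q n k
    proof -
      have "p \<otimes>\<^bsub>P\<^esub> (x \<otimes>\<^bsub>P\<^esub> y \<otimes>\<^bsub>P\<^esub> q) = p \<otimes>\<^bsub>P\<^esub> (x \<otimes>\<^bsub>P\<^esub> (y \<otimes>\<^bsub>P\<^esub> q))"
        using that x y by (simp add: annih_def P.m_assoc)
      then show ?thesis using that x y by (simp add: annih_def)
    qed
    then show "x \<otimes>\<^bsub>P\<^esub> y \<in> annih F" using x y by (simp add: annih_def)
  qed
qed

lemma tmul_minus_left: "tmul (\<lambda>w. - f w) h x = - tmul f h x"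
  using tmul_scale_left[of "-1" f h x] by simp

lemma lin_minus: "lin F (\<lambda>w. - f w) n k = - lin F f n k"
  using lin_scale[of F "-1" f n k] by simp

lemma tmon_rel_tmon:
  assumes "f \<in> tensors" "z \<in> tensors" "g \<in> G"
  shows "(tmon n (mat 1) f \<otimes>\<^bsub>P\<^esub> hecke_rel v w \<otimes>\<^bsub>P\<^esub> tmon 0 (mat 1) z) i g =
    (if i = n \<and> g = mat 1 then tmul f (tmul (commutator v w) z)
     else if i = n + 1 then (\<lambda>x. - a g v w * tmul f (tensor_act g z) x) else (\<lambda>x. 0))"
proof -
  have A: "(tmon n (mat 1) f \<otimes>\<^bsub>P\<^esub> hecke_rel v w) i g =
     (if i = n \<and> g = mat 1 then tmul f (commutator v w)
      else if i = n + 1 then (\<lambda>x. - a g v w * f x) else (\<lambda>x. 0))"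
    by (rule HOL.ext) (simp add: tmon_hecke_rel assms)
  show ?thesis
    by (rule HOL.ext)
       (simp add: tmon_mult_right mult_P_closed tmon_closed hecke_rel_closed assms A tmul_assoc
         tmul_minus_left tmul_scale_left)
qed

text \<open>The product has a part with power \<open>n\<close>, containing the commutator, and a
  part with power \<open>n + 1\<close>, containing the forms. Their contributions \<open>?A\<close>
  and \<open>?B\<close> cancel by the swap rule; for \<open>m = n\<close> the first vanishes and the
  second does not occur.\<close>

lemma rext_rel_core:
  assumes F: "\<And>u i j y n q. q \<in> G \<Longrightarrow> F (u @ i # j # y) n q - F (u @ j # i # y) n q = swap_term F n q u i j y"
    and z: "z \<in> tensors" and q: "q \<in> G"
  shows "rext F (tmon n (mat 1) (\<lambda>x. c * word u x) \<otimes>\<^bsub>P\<^esub> hecke_rel v w \<otimes>\<^bsub>P\<^esub> tmon 0 (mat 1) z) m q = 0"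
proof -
  let ?f = "\<lambda>x. c * word u x"
  let ?X = "tmon n (mat 1) ?f \<otimes>\<^bsub>P\<^esub> hecke_rel v w \<otimes>\<^bsub>P\<^esub> tmon 0 (mat 1) z"
  let ?A = "lin F (tmul ?f (tmul (commutator v w) z)) (m - n) q"
  let ?B = "\<Sum>g\<in>G. \<alpha> (q ** matrix_inv g) g * (a g v w * lin F (tmul ?f (tensor_act g z)) (m - Suc n) (q ** matrix_inv g))"
  have X: "?X i g = (if i = n \<and> g = mat 1 then tmul ?f (tmul (commutator v w) z)
     else if i = n + 1 then (\<lambda>x. - a g v w * tmul ?f (tensor_act g z) x) else (\<lambda>x. 0))"
    if "g \<in> G" for i g
    using that z by (intro tmon_rel_tmon tensors_scale tensors_word)
  have "(\<Sum>g\<in>G. \<alpha> (q ** matrix_inv g) g * lin F (?X i g) (m - i) (q ** matrix_inv g))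
      = (if i = n then ?A else 0) - (if i = Suc n then ?B else 0)" for i
  proof (cases "i = n")
    case True
    have "(\<Sum>g\<in>G. \<alpha> (q ** matrix_inv g) g * lin F (?X i g) (m - i) (q ** matrix_inv g))
       = (\<Sum>g\<in>G. if g = mat 1 then ?A else 0)"
      using True q by (intro sum.cong refl) (simp add: X)
    then show ?thesis using True by simp
  next
    case False
    show ?thesis
    proof (cases "i = Suc n")
      case True
      then show ?thesis
        by (simp add: X lin_minus lin_scale sum_negf)
    next
      case False
      with \<open>i \<noteq> n\<close> show ?thesis by (simp add: X)
    qed
  qed
  then have "rext F ?X m q = (if n \<le> m then ?A else 0) - (if Suc n \<le> m then ?B else 0)"
    unfolding rext_def by (simp add: sum_subtractf)
  moreover have "?A = (if m - n = 0 then 0 else c * (\<Sum>k\<in>G. a k v w * (\<alpha> (q ** matrix_inv k) k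
      * lin F (tmul (word u) (tensor_act k z)) (m - n - 1) (q ** matrix_inv k))))"
    using lin_commutator[of F q z u v w "m - n"] F[OF q] z
    by (simp add: tmul_scale_left[abs_def] lin_scale)
  moreover have "?B = c * (\<Sum>k\<in>G. a k v w * (\<alpha> (q ** matrix_inv k) k
      * lin F (tmul (word u) (tensor_act k z)) (m - n - 1) (q ** matrix_inv k)))"
    unfolding sum_distrib_left
    by (intro sum.cong refl) (simp add: tmul_scale_left[abs_def] lin_scale)
  ultimately show ?thesis by auto
qed

text \<open>On monomials, the group element \<open>h\<close> of the left factor is moved across the
  relation and then across the tensor of the right factor. All group elements are thereby collected
  at the far right, where right linearity splits them off, and \<open>rext_rel_core\<close> applies
  to the rest.\<close>

lemma hecke_rel_annih:
  assumes eq: equivariant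
    and F: "\<And>u i j y n q. q \<in> G \<Longrightarrow> F (u @ i # j # y) n q - F (u @ j # i # y) n q = swap_term F n q u i j y"
  shows "hecke_rel v w \<in> annih F"
proof -
  interpret P: ring P by (rule ring_P)
  have mm: "rext F (tmon n h (\<lambda>x. c * word u x) \<otimes>\<^bsub>P\<^esub> (hecke_rel v w \<otimes>\<^bsub>P\<^esub> tmon m l f)) p q = 0"
    if h: "h \<in> G" and l: "l \<in> G" and f: "f \<in> tensors" and q: "q \<in> G" for n h c u m l f p q
  proof -
    let ?f = "\<lambda>x. c * word u x"
    let ?Y = "tmon n (mat 1) ?f" and ?h = "tmon 0 h (word [])"
      and ?Z = "tmon 0 (mat 1) (tensor_act h f)" and ?l = "tmon m (h ** l) (\<lambda>x. \<alpha> h l * word [] x)"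
    have c: "?Y \<in> carrier P" "?h \<in> carrier P" "?Z \<in> carrier P" "?l \<in> carrier P" "tmon m l f \<in> carrier P"
      "hecke_rel v w \<in> carrier P" "hecke_rel (h *v v) (h *v w) \<in> carrier P"
      by (intro tmon_closed tensors_scale tensors_word tensors_act f hecke_rel_closed)+
    have 1: "tmon n h ?f = ?Y \<otimes>\<^bsub>P\<^esub> ?h"
      using h by (simp add: tmon_mult tensors_scale)
    have 2: "?h \<otimes>\<^bsub>P\<^esub> tmon m l f = ?Z \<otimes>\<^bsub>P\<^esub> ?l"
      using h l f by (simp add: tmon_mult tensors_scale tensors_act tmul_scale_right)
    have "tmon n h ?f \<otimes>\<^bsub>P\<^esub> (hecke_rel v w \<otimes>\<^bsub>P\<^esub> tmon m l f)
      = ?Y \<otimes>\<^bsub>P\<^esub> ((?h \<otimes>\<^bsub>P\<^esub> hecke_rel v w) \<otimes>\<^bsub>P\<^esub> tmon m l f)"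
      unfolding 1 using c by (simp only: P.m_assoc P.m_closed)
    also have "\<dots> = ?Y \<otimes>\<^bsub>P\<^esub> (hecke_rel (h *v v) (h *v w) \<otimes>\<^bsub>P\<^esub> (?h \<otimes>\<^bsub>P\<^esub> tmon m l f))"
      unfolding group_hecke_rel[OF eq h] using c by (simp only: P.m_assoc P.m_closed)
    also have "\<dots> = (?Y \<otimes>\<^bsub>P\<^esub> hecke_rel (h *v v) (h *v w) \<otimes>\<^bsub>P\<^esub> ?Z) \<otimes>\<^bsub>P\<^esub> ?l"
      unfolding 2 using c by (simp only: P.m_assoc P.m_closed)
    finally have eqn: "tmon n h ?f \<otimes>\<^bsub>P\<^esub> (hecke_rel v w \<otimes>\<^bsub>P\<^esub> tmon m l f)
      = (?Y \<otimes>\<^bsub>P\<^esub> hecke_rel (h *v v) (h *v w) \<otimes>\<^bsub>P\<^esub> ?Z) \<otimes>\<^bsub>P\<^esub> ?l" .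
    show ?thesis unfolding eqn
      using c h l q by (simp add: rext_mult_group rext_rel_core[OF F] tensors_act f)
  qed
  have "rext F (y \<otimes>\<^bsub>P\<^esub> (hecke_rel v w \<otimes>\<^bsub>P\<^esub> z)) p q = 0"
    if y: "y \<in> carrier P" and z: "z \<in> carrier P" and q: "q \<in> G" for y z p q
    using y
  proof (induction y rule: P_induct)
    case (tmon n h c u)
    show ?case using z
    proof (induction z rule: P_induct)
      case (tmon m l d y)
      then show ?case using \<open>h \<in> G\<close> q by (intro mm tensors_scale tensors_word)
    next
      case (add x y)
      then show ?case
        by (simp add: P.r_distr hecke_rel_closed tmon_closed tensors_scale rext_add)
    qed
  next
    case (add x y)
    then show ?case using z by (simp add: P.l_distr hecke_rel_closed rext_add)
  qed
  then show ?thesis by (simp add: annih_def hecke_rel_closed)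
qed

text \<open>An element of the ideal whose words have length at most \<open>k\<close> has degree
  \<open>k\<close> part zero in the symmetric algebra: the functional attached to a monomial
  \<open>M\<close> of degree \<open>k\<close> kills the ideal, and on such elements it reads off the
  coefficient of \<open>M\<close>.\<close>

lemma top_symbol:
  assumes eq: equivariant and jac: jacobi and f: "f \<in> hideal"
    and deg: "\<And>i g w. g \<in> G \<Longrightarrow> f i g w \<noteq> 0 \<Longrightarrow> length w \<le> k"
    and g: "g \<in> G" and M: "size M = k"
  shows "symsum (f i g) M = 0"
proof -
  interpret P: ring P by (rule ring_P)
  obtain r :: "'n \<Rightarrow> nat" where r: "inj r"
    using finite_imp_inj_to_nat_seg[of "UNIV :: 'n set"] by auto
  \<comment> \<open>The value at \<open>M\<close> is the unit of the group algebra, so that right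
    linear extension singles out the component at power \<open>i\<close> and group element
    \<open>g\<close>.\<close>
  define b where "b M' n q = (if M' = M \<and> n = 0 \<and> q = mat 1 then 1 else 0 :: complex)"
    for M' and n :: nat and q :: "complex ^ 'n ^ 'n"
  let ?F = "coef r b"
  have F: "?F (u @ i # j # y) n q - ?F (u @ j # i # y) n q = swap_term ?F n q u i j y"
    if "q \<in> G" for u i j y n q
    using coef_swap[OF r eq jac that refl] .
  have "hideal \<subseteq> annih ?F"
    unfolding hecke_ideal_Idl
    by (rule P.genideal_minimal[OF ideal_annih]) (auto intro: hecke_rel_annih[OF eq F])
  then have fa: "f \<in> annih ?F" using f by blast
  then have fP: "f \<in> carrier P" by (simp add: annih_def)
  have "rext ?F (\<one>\<^bsub>P\<^esub> \<otimes>\<^bsub>P\<^esub> (f \<otimes>\<^bsub>P\<^esub> \<one>\<^bsub>P\<^esub>)) i g = 0"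
    using fa g unfolding annih_def by blast
  then have 0: "rext ?F f i g = 0" using fP by simp
  have l: "lin ?F (f j h) n q = (if n = 0 \<and> q = mat 1 then symsum (f j h) M else 0)"
    if h: "h \<in> G" for j h n q
  proof -
    have "lin ?F (f j h) n q = (\<Sum>w | f j h w \<noteq> 0. if mset w = M then (if n = 0 \<and> q = mat 1 then f j h w else 0) else 0)"
      unfolding lin_def
    proof (intro sum.cong refl)
      fix w assume "w \<in> {w. f j h w \<noteq> 0}"
      then have "length w \<le> k" using deg h by auto
      then have "?F w n q = b (mset w) n q"
        by (rule coef_low[rotated]) (use M in \<open>auto simp: b_def\<close>)
      then show "f j h w * ?F w n q = (if mset w = M then (if n = 0 \<and> q = mat 1 then f j h w else 0) else 0)"
        by (simp add: b_def)
    qed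
    also have "\<dots> = (\<Sum>w | mset w = M. if n = 0 \<and> q = mat 1 then f j h w else 0)"
      using P_tensors[OF fP h, of j]
      by (intro sum.mono_neutral_cong) (auto simp: tensors_def finite_mset_words)
    also have "\<dots> = (if n = 0 \<and> q = mat 1 then symsum (f j h) M else 0)"
      by (simp add: symsum_def)
    finally show ?thesis .
  qed
  have gh: "g ** matrix_inv h = mat 1 \<longleftrightarrow> h = g" if "h \<in> G" for h
    using that g by (metis inv_cancel_right inv_right matrix_mul_lid)
  have "rext ?F f i g = (\<Sum>j\<le>i. \<Sum>h\<in>G. if h = g then (if j = i then symsum (f i g) M else 0) else 0)"
    unfolding rext_def
  proof (intro sum.cong refl)
    fix j h assume "j \<in> {..i}" and h: "h \<in> G"
    then show "\<alpha> (g ** matrix_inv h) h * lin ?F (f j h) (i - j) (g ** matrix_inv h)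
        = (if h = g then (if j = i then symsum (f i g) M else 0) else 0)"
      using g by (auto simp: l gh)
  qed
  also have "\<dots> = symsum (f i g) M" using g by simp
  finally show ?thesis using 0 by simp
qed

end

section \<open>The map from the symmetric side\<close>

lemma sym_add_closed:
  "X \<in> carrier sym_algebra \<Longrightarrow> Y \<in> carrier sym_algebra \<Longrightarrow> X \<oplus>\<^bsub>sym_algebra\<^esub> Y \<in> carrier sym_algebra"
  by (auto simp: carrier_sym_algebra add_sym_algebra tensors_add)

lemma sym_smult_closed: "X \<in> carrier sym_algebra \<Longrightarrow> c \<odot>\<^bsub>sym_algebra\<^esub> X \<in> carrier sym_algebra"
  by (auto simp: carrier_sym_algebra smult_sym_algebra tensors_scale)

lemma sym_zero_closed: "\<zero>\<^bsub>sym_algebra\<^esub> \<in> carrier sym_algebra"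
  by (auto simp: carrier_sym_algebra zero_sym_algebra)

lemma abelian_monoid_sym: "abelian_monoid (sym_algebra :: (complex, ('n::finite list \<Rightarrow> complex) set) module)"
proof (rule abelian_monoidI)
  fix X Y Z :: "('n list \<Rightarrow> complex) set"
  assume "X \<in> carrier sym_algebra" "Y \<in> carrier sym_algebra" "Z \<in> carrier sym_algebra"
  then obtain x y z where "X = sym_proj x" "Y = sym_proj y" "Z = sym_proj z"
    "x \<in> tensors" "y \<in> tensors" "z \<in> tensors"
    by (auto simp: carrier_sym_algebra)
  then show "X \<oplus>\<^bsub>sym_algebra\<^esub> Y \<oplus>\<^bsub>sym_algebra\<^esub> Z = X \<oplus>\<^bsub>sym_algebra\<^esub> (Y \<oplus>\<^bsub>sym_algebra\<^esub> Z)"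
    by (simp add: add_sym_algebra tensors_add add.assoc)
next
  fix X Y :: "('n list \<Rightarrow> complex) set"
  assume "X \<in> carrier sym_algebra" "Y \<in> carrier sym_algebra"
  then obtain x y where "X = sym_proj x" "Y = sym_proj y" "x \<in> tensors" "y \<in> tensors"
    by (auto simp: carrier_sym_algebra)
  then show "X \<oplus>\<^bsub>sym_algebra\<^esub> Y = Y \<oplus>\<^bsub>sym_algebra\<^esub> X"
    by (simp add: add_sym_algebra add.commute)
next
  fix X :: "('n list \<Rightarrow> complex) set"
  assume "X \<in> carrier sym_algebra"
  then obtain x where "X = sym_proj x" "x \<in> tensors" by (auto simp: carrier_sym_algebra)
  then show "\<zero>\<^bsub>sym_algebra\<^esub> \<oplus>\<^bsub>sym_algebra\<^esub> X = X"
    by (simp add: zero_sym_algebra add_sym_algebra)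
qed (simp_all add: sym_add_closed sym_zero_closed)

locale hecke_section = hecke_forms G \<alpha> a + graded_section_locale \<sigma>
  for G :: "(complex ^ 'n ^ 'n) set" and \<alpha> :: "complex ^ 'n ^ 'n \<Rightarrow> complex ^ 'n ^ 'n \<Rightarrow> complex"
    and a :: "complex ^ 'n ^ 'n \<Rightarrow> complex ^ 'n \<Rightarrow> complex ^ 'n \<Rightarrow> complex"
    and \<sigma> :: "('n list \<Rightarrow> complex) set \<Rightarrow> 'n list \<Rightarrow> complex"
begin

section \<open>Coefficientwise lifting along the section\<close>

abbreviation "S \<equiv> sym_crossed G \<alpha>"
abbreviation "PS \<equiv> poly_algebra S"

lemma carrier_S: "carrier S = G \<rightarrow>\<^sub>E carrier sym_algebra"
  by (simp add: sym_crossed_def crossed_product_def)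

lemma add_S: "x \<oplus>\<^bsub>S\<^esub> y = (\<lambda>k\<in>G. x k \<oplus>\<^bsub>sym_algebra\<^esub> y k)"
  by (simp add: sym_crossed_def crossed_product_def)

lemma zero_S: "\<zero>\<^bsub>S\<^esub> = (\<lambda>k\<in>G. \<zero>\<^bsub>sym_algebra\<^esub>)"
  by (simp add: sym_crossed_def crossed_product_def)

lemma smult_S: "c \<odot>\<^bsub>S\<^esub> x = (\<lambda>k\<in>G. c \<odot>\<^bsub>sym_algebra\<^esub> x k)"
  by (simp add: sym_crossed_def crossed_product_def)

lemma S_sym: "x \<in> carrier S \<Longrightarrow> g \<in> G \<Longrightarrow> x g \<in> carrier sym_algebra"
  by (auto simp: carrier_S)

lemma add_S_closed: "x \<in> carrier S \<Longrightarrow> y \<in> carrier S \<Longrightarrow> x \<oplus>\<^bsub>S\<^esub> y \<in> carrier S"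
  by (auto simp: add_S carrier_S intro!: sym_add_closed)

lemma zero_S_closed: "\<zero>\<^bsub>S\<^esub> \<in> carrier S"
  by (auto simp: zero_S carrier_S intro!: sym_zero_closed)

lemma smult_S_closed: "x \<in> carrier S \<Longrightarrow> c \<odot>\<^bsub>S\<^esub> x \<in> carrier S"
  by (auto simp: smult_S carrier_S intro!: sym_smult_closed)

lemma S_eqI: "x \<in> carrier S \<Longrightarrow> y \<in> carrier S \<Longrightarrow> (\<And>g. g \<in> G \<Longrightarrow> x g = y g) \<Longrightarrow> x = y"
  unfolding carrier_S by (rule PiE_ext)

lemma abelian_monoid_S: "abelian_monoid S"
proof -
  interpret sym: abelian_monoid "sym_algebra :: (complex, ('n list \<Rightarrow> complex) set) module"
    by (rule abelian_monoid_sym)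
  show ?thesis
  proof (rule abelian_monoidI)
    fix x y z assume c: "x \<in> carrier S" "y \<in> carrier S" "z \<in> carrier S"
    show "x \<oplus>\<^bsub>S\<^esub> y \<oplus>\<^bsub>S\<^esub> z = x \<oplus>\<^bsub>S\<^esub> (y \<oplus>\<^bsub>S\<^esub> z)"
      by (intro S_eqI add_S_closed c) (simp add: add_S sym.a_assoc c[THEN S_sym])
  next
    fix x y assume c: "x \<in> carrier S" "y \<in> carrier S"
    show "x \<oplus>\<^bsub>S\<^esub> y = y \<oplus>\<^bsub>S\<^esub> x"
      by (intro S_eqI add_S_closed c) (simp add: add_S sym.a_comm c[THEN S_sym])
  next
    fix x assume c: "x \<in> carrier S"
    show "\<zero>\<^bsub>S\<^esub> \<oplus>\<^bsub>S\<^esub> x = x"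
      by (intro S_eqI add_S_closed c zero_S_closed) (simp add: add_S zero_S c[THEN S_sym])
  qed (simp_all add: add_S_closed zero_S_closed)
qed

lemma section_finsum_S:
  assumes "finite A" "\<And>x. x \<in> A \<Longrightarrow> F x \<in> carrier S" "k \<in> G"
  shows "\<sigma> ((\<Oplus>\<^bsub>S\<^esub>x\<in>A. F x) k) = (\<lambda>w. \<Sum>x\<in>A. \<sigma> (F x k) w)"
proof -
  interpret S: abelian_monoid S by (rule abelian_monoid_S)
  show ?thesis using assms
  proof (induction A rule: finite_induct)
    case empty
    then show ?case by (simp add: S.finsum_empty zero_S section_zero)
  next
    case (insert x A)
    have "(\<Oplus>\<^bsub>S\<^esub>x\<in>insert x A. F x) = F x \<oplus>\<^bsub>S\<^esub> (\<Oplus>\<^bsub>S\<^esub>x\<in>A. F x)"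
      using insert by (intro S.finsum_insert) (auto simp: Pi_def)
    moreover have "(\<Oplus>\<^bsub>S\<^esub>x\<in>A. F x) \<in> carrier S"
      using insert by (intro S.finsum_closed) auto
    ultimately show ?case
      using insert by (simp add: add_S section_add S_sym)
  qed
qed

lemma carrier_PS: "carrier PS = up S"
  by (simp add: poly_algebra_def UP_def)

lemma PS_S: "x \<in> carrier PS \<Longrightarrow> x i \<in> carrier S"
  by (auto simp: carrier_PS)

lemma PS_sym: "x \<in> carrier PS \<Longrightarrow> g \<in> G \<Longrightarrow> x i g \<in> carrier sym_algebra"
  by (rule S_sym[OF PS_S])

lemma PS_bound: "x \<in> carrier PS \<Longrightarrow> \<exists>n. \<forall>i>n. x i = \<zero>\<^bsub>S\<^esub>"
  unfolding carrier_PS up_def bound_def by simp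

lemma PS_I: "(\<And>i. x i \<in> carrier S) \<Longrightarrow> (\<And>i. n < i \<Longrightarrow> x i = \<zero>\<^bsub>S\<^esub>) \<Longrightarrow> x \<in> carrier PS"
  unfolding carrier_PS by (intro mem_upI exI[of _ n] bound.intro) auto

lemma PS_eqI: "x \<in> carrier PS \<Longrightarrow> y \<in> carrier PS \<Longrightarrow> (\<And>i g. g \<in> G \<Longrightarrow> x i g = y i g) \<Longrightarrow> x = y"
  by (rule ext, rule S_eqI) (auto intro: PS_S)

lemma add_PS: "x \<in> carrier PS \<Longrightarrow> y \<in> carrier PS \<Longrightarrow> x \<oplus>\<^bsub>PS\<^esub> y = (\<lambda>i. x i \<oplus>\<^bsub>S\<^esub> y i)"
  unfolding carrier_PS by (simp add: poly_algebra_def UP_def)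

lemma add_PS_closed:
  assumes "x \<in> carrier PS" "y \<in> carrier PS"
  shows "x \<oplus>\<^bsub>PS\<^esub> y \<in> carrier PS"
proof -
  interpret S: abelian_monoid S by (rule abelian_monoid_S)
  obtain n m where "\<forall>i>n. x i = \<zero>\<^bsub>S\<^esub>" "\<forall>i>m. y i = \<zero>\<^bsub>S\<^esub>"
    using assms PS_bound by blast
  then show ?thesis
    using assms by (intro PS_I[of _ "max n m"]) (simp_all add: add_PS add_S_closed PS_S)
qed

definition lift :: "(nat \<Rightarrow> complex ^ 'n ^ 'n \<Rightarrow> ('n list \<Rightarrow> complex) set) \<Rightarrow> nat \<Rightarrow> complex ^ 'n ^ 'n \<Rightarrow> 'n list \<Rightarrow> complex" where
  "lift x = (\<lambda>i. \<lambda>g\<in>G. \<sigma> (x i g))"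

lemma hecke_map_lift: "hecke_map G \<alpha> a \<sigma> x = hideal +>\<^bsub>P\<^esub> lift x"
  by (simp add: hecke_map_def lift_def)

lemma lift_closed: "x \<in> carrier PS \<Longrightarrow> lift x \<in> carrier P"
proof -
  assume x: "x \<in> carrier PS"
  obtain n where "\<forall>i>n. x i = \<zero>\<^bsub>S\<^esub>" using PS_bound[OF x] by blast
  then show ?thesis
    by (intro P_I[of _ n])
       (auto simp: lift_def carrier_R zero_R zero_S section_zero intro!: section_tensors PS_sym[OF x])
qed

lemma lift_add: "x \<in> carrier PS \<Longrightarrow> y \<in> carrier PS \<Longrightarrow> lift (x \<oplus>\<^bsub>PS\<^esub> y) = lift x \<oplus>\<^bsub>P\<^esub> lift y"
  by (intro P_eqI lift_closed add_PS_closed add_P_closed)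
     (simp_all add: add_P lift_closed, simp add: lift_def add_PS add_S section_add PS_sym)

lemma lift_smult:
  assumes x: "x \<in> carrier PS"
  shows "lift (p \<odot>\<^bsub>PS\<^esub> x) = p \<odot>\<^bsub>P\<^esub> lift x"
proof (rule ext)
  fix n
  have "\<sigma> ((p \<odot>\<^bsub>PS\<^esub> x) n g) = (\<lambda>w. \<Sum>i\<le>n. Polynomial.coeff p i * \<sigma> (x (n - i) g) w)" if "g \<in> G" for g
  proof -
    have "(p \<odot>\<^bsub>PS\<^esub> x) n = (\<Oplus>\<^bsub>S\<^esub>i\<in>{..n}. Polynomial.coeff p i \<odot>\<^bsub>S\<^esub> x (n - i))"
      by (simp add: poly_algebra_def)
    then have "\<sigma> ((p \<odot>\<^bsub>PS\<^esub> x) n g) = (\<lambda>w. \<Sum>i\<le>n. \<sigma> ((Polynomial.coeff p i \<odot>\<^bsub>S\<^esub> x (n - i)) g) w)"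
      using that x by (simp add: section_finsum_S smult_S_closed PS_S)
    then show ?thesis using that x by (simp add: smult_S section_smult PS_sym)
  qed
  then show "lift (p \<odot>\<^bsub>PS\<^esub> x) n = (p \<odot>\<^bsub>P\<^esub> lift x) n"
    unfolding smult_P[OF lift_closed[OF x]]
    by (simp add: lift_def[of "p \<odot>\<^bsub>PS\<^esub> x"] cong: restrict_cong) (simp add: lift_def cong: restrict_cong)
qed

lemma smult_P_closed: "x \<in> carrier P \<Longrightarrow> p \<odot>\<^bsub>P\<^esub> x \<in> carrier P"
  using smult_P_mult[of x p] mult_P_closed by auto

lemma smult_P_add:
  assumes x: "x \<in> carrier P" and y: "y \<in> carrier P"
  shows "p \<odot>\<^bsub>P\<^esub> (x \<oplus>\<^bsub>P\<^esub> y) = p \<odot>\<^bsub>P\<^esub> x \<oplus>\<^bsub>P\<^esub> p \<odot>\<^bsub>P\<^esub> y"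
proof (intro P_eqI smult_P_closed add_P_closed x y)
  fix n g w assume g: "g \<in> G"
  have "(p \<odot>\<^bsub>P\<^esub> (x \<oplus>\<^bsub>P\<^esub> y)) n g w = (\<Sum>i\<le>n. Polynomial.coeff p i * (x \<oplus>\<^bsub>P\<^esub> y) (n - i) g w)"
    using x y g by (simp add: smult_P add_P_closed)
  also have "\<dots> = (p \<odot>\<^bsub>P\<^esub> x) n g w + (p \<odot>\<^bsub>P\<^esub> y) n g w"
    using x y g by (simp add: add_P smult_P distrib_left sum.distrib)
  also have "\<dots> = (p \<odot>\<^bsub>P\<^esub> x \<oplus>\<^bsub>P\<^esub> p \<odot>\<^bsub>P\<^esub> y) n g w"
    using x y g by (simp add: add_P[of "p \<odot>\<^bsub>P\<^esub> x"] smult_P_closed)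
  finally show "(p \<odot>\<^bsub>P\<^esub> (x \<oplus>\<^bsub>P\<^esub> y)) n g w = (p \<odot>\<^bsub>P\<^esub> x \<oplus>\<^bsub>P\<^esub> p \<odot>\<^bsub>P\<^esub> y) n g w" .
qed

lemma hecke_hom: "hecke_map G \<alpha> a \<sigma> \<in> module_homs PS (hecke_algebra G \<alpha> a)"
proof -
  have "hideal +>\<^bsub>P\<^esub> lift (x \<oplus>\<^bsub>PS\<^esub> y)
     = (hideal +>\<^bsub>P\<^esub> lift x) \<oplus>\<^bsub>hecke_algebra G \<alpha> a\<^esub> (hideal +>\<^bsub>P\<^esub> lift y)"
    if "x \<in> carrier PS" "y \<in> carrier PS" for x y
    using that by (simp add: hecke_algebra_def add_quotient_algebra[OF ideal_hideal] lift_closed lift_add)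
  moreover have "hideal +>\<^bsub>P\<^esub> lift (p \<odot>\<^bsub>PS\<^esub> x) = p \<odot>\<^bsub>hecke_algebra G \<alpha> a\<^esub> (hideal +>\<^bsub>P\<^esub> lift x)"
    if x: "x \<in> carrier PS" for p x
  proof -
    have "p \<odot>\<^bsub>P\<^esub> z \<in> hideal" if z: "z \<in> hideal" for z
      using smult_P_mult[OF hideal_closed[OF z], of p] ideal.I_l_closed[OF ideal_hideal z] by auto
    then show ?thesis
      unfolding hecke_algebra_def lift_smult[OF x]
      by (intro smult_quotient_algebra[OF ideal_hideal, symmetric] lift_closed x smult_P_closed smult_P_add)
  qed
  ultimately show ?thesis
    by (auto simp: module_homs_def hecke_map_lift hecke_algebra_def carrier_quotient_algebra lift_closed)
qed

text \<open>If the lifts of \<open>x\<close> and \<open>y\<close> differ by a nonzero ideal element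
  \<open>d\<close>, let \<open>k\<close> be the greatest length of a word in it. By
  \<open>top_symbol\<close> the degree \<open>k\<close> part of each component of \<open>d\<close>
  has zero symmetric image, so the degree \<open>k\<close> components of the two lifts have equal
  projections and coincide by \<open>section_comp\<close>. This contradicts the choice of
  \<open>k\<close>.\<close>

lemma hecke_inj:
  assumes eq: equivariant and jac: jacobi
  shows "inj_on (hecke_map G \<alpha> a \<sigma>) (carrier PS)"
proof (rule inj_onI)
  interpret P: ring P by (rule ring_P)
  fix x y assume x: "x \<in> carrier PS" and y: "y \<in> carrier PS"
    and "hecke_map G \<alpha> a \<sigma> x = hecke_map G \<alpha> a \<sigma> y"
  define d where "d = lift x \<ominus>\<^bsub>P\<^esub> lift y"
  have d: "d \<in> hideal"
    using \<open>hecke_map G \<alpha> a \<sigma> x = hecke_map G \<alpha> a \<sigma> y\<close> lift_closed x y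
    unfolding d_def hecke_map_lift by (subst P.quotient_eq_iff_same_a_r_cos[OF ideal_hideal]) auto
  have dP: "d \<in> carrier P" using d by (rule hideal_closed)
  have dapp: "d i g = (\<lambda>w. \<sigma> (x i g) w - \<sigma> (y i g) w)" if "g \<in> G" for i g
    by (rule HOL.ext) (use that x y in \<open>simp add: d_def minus_P lift_closed, simp add: lift_def\<close>)
  have "d i g w = 0" if g: "g \<in> G" for i g w
  proof (rule ccontr)
    assume nz: "d i g w \<noteq> 0"
    obtain n where n: "\<forall>i>n. d i = \<zero>\<^bsub>R\<^esub>" using P_bound[OF dP] by blast
    let ?L = "\<Union>i\<in>{..n}. \<Union>g\<in>G. length ` {w. d i g w \<noteq> 0}"
    have finL: "finite ?L"
      using P_tensors[OF dP] by (intro finite_UN_I finite_imageI) (auto simp: tensors_def)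
    have inL: "length w \<in> ?L" if "g \<in> G" "d i g w \<noteq> 0" for i g w
    proof -
      have "i \<le> n" using that n by (cases "i \<le> n") (auto simp: zero_R)
      with that show ?thesis by blast
    qed
    define k where "k = Max ?L"
    have "k \<in> ?L" unfolding k_def using finL inL[OF g nz] by (intro Max_in) auto
    then obtain i' g' w' where g': "g' \<in> G" and w': "d i' g' w' \<noteq> 0" "length w' = k" by auto
    let ?X = "x i' g'" and ?Y = "y i' g'"
    have X: "?X \<in> carrier sym_algebra" and Y: "?Y \<in> carrier sym_algebra"
      using x y g' by (simp_all add: PS_sym)
    have deg: "length w \<le> k" if "g \<in> G" "d i g w \<noteq> 0" for i g w
      unfolding k_def using finL inL[OF that] by (rule Max_ge)
    have top: "symsum (d i' g') M = 0" if "size M = k" for M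
      using top_symbol[OF eq jac d deg g' that] .
    have c: "hcomp k (\<sigma> ?X) \<in> tensors" "hcomp k (\<sigma> ?Y) \<in> tensors"
      using X Y by (simp_all add: hcomp_tensors section_tensors)
    have "symsum (hcomp k (\<sigma> ?X)) M = symsum (hcomp k (\<sigma> ?Y)) M" for M
    proof (cases "size M = k")
      case True
      have "symsum (hcomp k f) M = symsum f M" for f :: "'n list \<Rightarrow> complex"
        unfolding symsum_def hcomp_def using True by (intro sum.cong) auto
      moreover have "symsum (\<sigma> ?X) M - symsum (\<sigma> ?Y) M = 0"
        using top[OF True] unfolding dapp[OF g'] by (simp add: symsum_diff)
      ultimately show ?thesis by simp
    next
      case False
      have "symsum (hcomp k f) M = 0" for f :: "'n list \<Rightarrow> complex"
        unfolding symsum_def hcomp_def using False by (intro sum.neutral) auto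
      then show ?thesis by simp
    qed
    then have "sym_proj (hcomp k (\<sigma> ?X)) = sym_proj (hcomp k (\<sigma> ?Y))"
      using c by (simp add: sym_proj_eq_iff fun_eq_iff)
    then have "hcomp k (\<sigma> ?X) = hcomp k (\<sigma> ?Y)"
      by (subst (1 2) section_comp[symmetric]) (simp_all only: X Y)
    then have "\<sigma> ?X w' = \<sigma> ?Y w'"
      using w'(2) by (auto simp: hcomp_def dest: fun_cong[of _ _ w'])
    then show False using w'(1) by (simp add: dapp[OF g'])
  qed
  then have "\<sigma> (x i g) = \<sigma> (y i g)" if "g \<in> G" for i g
    using dapp[OF that, of i] that by (auto simp: fun_eq_iff)
  then show "x = y"
    by (intro PS_eqI x y) (metis section_proj PS_sym x y)
qed

section \<open>Surjectivity by induction on the length of words\<close>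

definition attained :: "(nat \<Rightarrow> complex ^ 'n ^ 'n \<Rightarrow> 'n list \<Rightarrow> complex) \<Rightarrow> bool" where
  "attained f \<longleftrightarrow> (\<exists>x\<in>carrier PS. \<exists>z\<in>hideal. f = lift x \<oplus>\<^bsub>P\<^esub> z)"

lemma attained_add: "attained f \<Longrightarrow> attained f' \<Longrightarrow> attained (f \<oplus>\<^bsub>P\<^esub> f')"
proof -
  interpret P: ring P by (rule ring_P)
  interpret I: ideal hideal P by (rule ideal_hideal)
  assume "attained f" "attained f'"
  then obtain x x' z z' where x: "x \<in> carrier PS" "x' \<in> carrier PS" "z \<in> hideal" "z' \<in> hideal"
    "f = lift x \<oplus>\<^bsub>P\<^esub> z" "f' = lift x' \<oplus>\<^bsub>P\<^esub> z'"
    unfolding attained_def by blast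
  then have "f \<oplus>\<^bsub>P\<^esub> f' = lift (x \<oplus>\<^bsub>PS\<^esub> x') \<oplus>\<^bsub>P\<^esub> (z \<oplus>\<^bsub>P\<^esub> z')"
    by (simp add: lift_add lift_closed hideal_closed P.a_ac)
  then show ?thesis
    unfolding attained_def using x add_PS_closed I.a_closed by blast
qed

lemma zero_PS_closed: "(\<lambda>i. \<zero>\<^bsub>S\<^esub>) \<in> carrier PS"
  by (rule PS_I[of _ 0]) (simp_all add: zero_S_closed)

lemma lift_zero: "lift (\<lambda>i. \<zero>\<^bsub>S\<^esub>) = \<zero>\<^bsub>P\<^esub>"
  by (simp add: lift_def zero_S section_zero zero_P cong: restrict_cong)

lemma attained_ideal: "z \<in> hideal \<Longrightarrow> attained z"
proof -
  interpret P: ring P by (rule ring_P)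
  assume "z \<in> hideal"
  then have "z = lift (\<lambda>i. \<zero>\<^bsub>S\<^esub>) \<oplus>\<^bsub>P\<^esub> z" by (simp add: lift_zero hideal_closed)
  then show ?thesis
    unfolding attained_def using zero_PS_closed \<open>z \<in> hideal\<close> by blast
qed

lemma attained_lift: "x \<in> carrier PS \<Longrightarrow> attained (lift x)"
proof -
  interpret P: ring P by (rule ring_P)
  interpret I: ideal hideal P by (rule ideal_hideal)
  assume x: "x \<in> carrier PS"
  then have "lift x = lift x \<oplus>\<^bsub>P\<^esub> \<zero>\<^bsub>P\<^esub>" by (simp add: lift_closed)
  then show ?thesis unfolding attained_def using x I.zero_closed by blast
qed

lemma attained_zero: "attained (tmon n h (\<lambda>w. 0))"
proof -
  interpret P: ring P by (rule ring_P)
  interpret I: ideal hideal P by (rule ideal_hideal)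
  have "tmon n h (\<lambda>w. 0) = \<zero>\<^bsub>P\<^esub>" by (auto simp: tmon_def zero_P fun_eq_iff)
  then show ?thesis using attained_ideal[OF I.zero_closed] by simp
qed

lemma attained_low:
  assumes mon: "\<And>n h c w. h \<in> G \<Longrightarrow> length w < L \<Longrightarrow> attained (tmon n h (\<lambda>v. c * word w v))"
    and x: "x \<in> carrier P" and low: "\<And>i g w. g \<in> G \<Longrightarrow> x i g w \<noteq> 0 \<Longrightarrow> length w < L"
  shows "attained x"
proof -
  let ?t = "\<lambda>x i. \<lambda>g\<in>G. \<lambda>w. if length w < L then x i g w else (0::complex)"
  have clo: "?t x \<in> carrier P" if x: "x \<in> carrier P" for x
  proof -
    obtain n where n: "\<forall>i>n. x i = \<zero>\<^bsub>R\<^esub>" using P_bound[OF x] by blast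
    have "(\<lambda>w. if length w < L then f w else 0) \<in> tensors" if "f \<in> tensors" for f :: "'n list \<Rightarrow> complex"
      using that unfolding tensors_def mem_Collect_eq by (rule rev_finite_subset) auto
    then show ?thesis
      using n by (intro P_I[of _ n]) (auto simp: carrier_R zero_R P_tensors[OF x] cong: restrict_cong if_cong)
  qed
  have "attained (?t x)"
    using x
  proof (induction x rule: P_induct)
    case (tmon n h c w)
    have "?t (tmon n h (\<lambda>v. c * word w v)) = tmon n h (\<lambda>v. (if length w < L then c else 0) * word w v)"
      by (auto simp: tmon_def word_def fun_eq_iff)
    moreover have "attained (tmon n h (\<lambda>v. (if length w < L then c else 0) * word w v))"
      using mon[OF \<open>h \<in> G\<close>, of w n c] attained_zero[of n h] by (cases "length w < L") simp_all
    ultimately show ?case by (simp only:)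
  next
    case (add x y)
    have "?t (x \<oplus>\<^bsub>P\<^esub> y) = ?t x \<oplus>\<^bsub>P\<^esub> ?t y"
      by (intro P_eqI clo add_P_closed add) (simp add: add_P clo add)
    then show ?case using attained_add[OF add(3,4)] by (simp only:)
  qed
  moreover have "?t x = x"
    using low by (intro P_eqI clo x) auto
  ultimately show ?thesis by simp
qed

text \<open>The relation for \<open>i\<close>, \<open>j\<close>, multiplied by \<open>x\<close> and
  \<open>y\<close> and then by \<open>h\<close>, lies in the ideal. Its part with power
  \<open>n\<close> is the difference of the two words; its other terms have two letters fewer, so
  the hypothesis on short monomials covers them.\<close>

lemma attained_swap:
  assumes mon: "\<And>n h c w. h \<in> G \<Longrightarrow> length w < length x + length y + 2 \<Longrightarrow> attained (tmon n h (\<lambda>v. c * word w v))"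
    and h: "h \<in> G"
  shows "attained (tmon n h (\<lambda>v. c * (word (x @ i # j # y) v - word (x @ j # i # y) v)))"
proof -
  interpret P: ring P by (rule ring_P)
  interpret I: ideal hideal P by (rule ideal_hideal)
  let ?f = "\<lambda>v. c * word x v" and ?rel = "hecke_rel (basis_vec i) (basis_vec j)"
  let ?D = "\<lambda>v. c * (word (x @ i # j # y) v - word (x @ j # i # y) v)"
  let ?z = "(tmon n (mat 1) ?f \<otimes>\<^bsub>P\<^esub> ?rel \<otimes>\<^bsub>P\<^esub> tmon 0 (mat 1) (word y)) \<otimes>\<^bsub>P\<^esub> tmon 0 h (word [])"
  have c: "tmon n (mat 1) ?f \<in> carrier P" "tmon 0 (mat 1) (word y) \<in> carrier P" "tmon 0 h (word []) \<in> carrier P"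
    by (intro tmon_closed tensors_scale tensors_word)+
  have z: "?z \<in> hideal"
    by (intro I.I_l_closed I.I_r_closed hecke_rel_in c)
  then have zP: "?z \<in> carrier P" by (rule hideal_closed)
  have comm: "commutator (basis_vec i) (basis_vec j) = (\<lambda>v. word [i, j] v - word [j, i] v)"
    by (simp add: commutator_def tensor_vec_axis tmul_word_word)
  have zapp: "?z m k v = (if m = n \<and> k = h then ?D v else if m = n + 1 then
      - (\<alpha> (k ** matrix_inv h) h * (a (k ** matrix_inv h) (basis_vec i) (basis_vec j)
         * (c * tmul (word x) (tensor_act (k ** matrix_inv h) (word y)) v))) else 0)" if k: "k \<in> G" for m k v
  proof -
    have kh: "k ** matrix_inv h = mat 1 \<longleftrightarrow> k = h"
      by (metis h inv_cancel_right inv_right matrix_mul_lid)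
    have "?z m k v = \<alpha> (k ** matrix_inv h) h * (tmon n (mat 1) ?f \<otimes>\<^bsub>P\<^esub> ?rel \<otimes>\<^bsub>P\<^esub> tmon 0 (mat 1) (word y)) m (k ** matrix_inv h) v"
      using k h c by (simp add: tmon_mult_right mult_P_closed hecke_rel_closed)
    also have "\<dots> = (if m = n \<and> k = h then ?D v else if m = n + 1 then
      - (\<alpha> (k ** matrix_inv h) h * (a (k ** matrix_inv h) (basis_vec i) (basis_vec j)
         * (c * tmul (word x) (tensor_act (k ** matrix_inv h) (word y)) v))) else 0)"
      using k h kh
      by (auto simp: tmon_rel_tmon tensors_scale comm tmul_scale_left tmul_diff_left[abs_def] tmul_diff_right tmul_word_word)
    finally show ?thesis .
  qed
  define l where "l = tmon n h ?D \<ominus>\<^bsub>P\<^esub> ?z"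
  have D: "tmon n h ?D \<in> carrier P" by (intro tmon_closed tensors_scale tensors_diff tensors_word)
  have l: "l \<in> carrier P" unfolding l_def by (intro minus_P_closed D zP)
  have "attained l"
  proof (rule attained_low[of "length x + length y + 2", OF mon l])
    fix m k v assume k: "k \<in> G" and nz: "l m k v \<noteq> 0"
    have "tmul (word x) (tensor_act (k ** matrix_inv h) (word y)) v \<noteq> 0"
    proof
      assume "tmul (word x) (tensor_act (k ** matrix_inv h) (word y)) v = 0"
      then have "l m k v = 0"
        unfolding l_def using k by (simp only: minus_P D zP) (simp add: zapp tmon_apply)
      then show False using nz by simp
    qed
    then obtain v' where v: "v = x @ v'" and "tensor_act (k ** matrix_inv h) (word y) v' \<noteq> 0"
      by (auto simp: tmul_word_left split: if_splits)
    then have "length v' = length y" using tensor_act_word_other by metis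
    then show "length v < length x + length y + 2" using v by simp
  qed
  moreover have "tmon n h ?D = l \<oplus>\<^bsub>P\<^esub> ?z"
    unfolding l_def using D zP by (simp add: a_minus_def P.a_assoc P.l_neg)
  ultimately show ?thesis using attained_add[OF _ attained_ideal[OF z]] by simp
qed

text \<open>The word is compared with the tensor that the section assigns to its symmetric image.
  That tensor is a lift, and the difference \<open>z\<close> has zero symmetric image in the same
  degree, hence is a combination of differences of rearrangements, which swaps reduce to shorter
  words.\<close>

lemma attained_mon: "h \<in> G \<Longrightarrow> attained (tmon n h (\<lambda>v. c * word w v))"
proof (induction "length w" arbitrary: n h c w rule: less_induct)
  case less
  note h = \<open>h \<in> G\<close>
  let ?L = "length w" and ?f = "\<lambda>v. c * word w v"
  have f: "?f \<in> tensors" by (intro tensors_scale tensors_word)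
  define s where "s = \<sigma> (sym_proj ?f)"
  have s: "s \<in> tensors" unfolding s_def using f by (rule section_proj_tensors)
  define z where "z v = ?f v - s v" for v
  have z: "z \<in> tensors" unfolding z_def[abs_def] by (intro tensors_diff f s)
  have zs: "symsum z = (\<lambda>M. 0)"
    unfolding z_def[abs_def] symsum_diff s_def symsum_section[OF f] by simp
  have zl: "length v = ?L" if "z v \<noteq> 0" for v
  proof -
    have *: "\<And>v. ?f v \<noteq> 0 \<Longrightarrow> length v = ?L" by (simp add: word_def split: if_splits)
    have "?f v \<noteq> 0 \<or> s v \<noteq> 0" using that by (auto simp: z_def)
    then show ?thesis using * section_degree[OF f *] unfolding s_def by blast
  qed
  \<comment> \<open>The length is part of the invariant because the induction hypothesis reaches
    only monomials shorter than \<open>?L\<close>.\<close>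
  have sw: "length v = ?L \<longrightarrow> length v' = ?L \<and> (\<forall>c. attained (tmon n h (\<lambda>x. c * (word v x - word v' x))))"
    if "mset v = mset v'" for v v'
  proof (rule mset_swap_induct[where E = "\<lambda>v v'. length v = ?L \<longrightarrow> length v' = ?L \<and>
      (\<forall>c. attained (tmon n h (\<lambda>x. c * (word v x - word v' x))))", OF _ _ _ that])
    fix v :: "'n list"
    show "length v = ?L \<longrightarrow> length v = ?L \<and> (\<forall>c. attained (tmon n h (\<lambda>x. c * (word v x - word v x))))"
      using attained_zero by simp
  next
    fix u v v' :: "'n list"
    assume 1: "length u = ?L \<longrightarrow> length v = ?L \<and> (\<forall>c. attained (tmon n h (\<lambda>x. c * (word u x - word v x))))"
      and 2: "length v = ?L \<longrightarrow> length v' = ?L \<and> (\<forall>c. attained (tmon n h (\<lambda>x. c * (word v x - word v' x))))"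
    have "attained (tmon n h (\<lambda>x. c * (word u x - word v' x)))" if u: "length u = ?L" for c
    proof -
      have "tmon n h (\<lambda>x. c * (word u x - word v' x))
         = tmon n h (\<lambda>x. c * (word u x - word v x)) \<oplus>\<^bsub>P\<^esub> tmon n h (\<lambda>x. c * (word v x - word v' x))"
        by (simp add: tmon_add tensors_scale tensors_diff distrib_left[symmetric] del: distrib_left)
      then show ?thesis using attained_add 1 2 u by simp
    qed
    with 1 2 show "length u = ?L \<longrightarrow> length v' = ?L \<and> (\<forall>c. attained (tmon n h (\<lambda>x. c * (word u x - word v' x))))"
      by blast
  next
    fix x y :: "'n list" and i j
    show "length (x @ i # j # y) = ?L \<longrightarrow> length (x @ j # i # y) = ?L \<and>
      (\<forall>c. attained (tmon n h (\<lambda>v. c * (word (x @ i # j # y) v - word (x @ j # i # y) v))))"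
    proof (intro impI conjI allI)
      fix c assume "length (x @ i # j # y) = ?L"
      then show "attained (tmon n h (\<lambda>v. c * (word (x @ i # j # y) v - word (x @ j # i # y) v)))"
        using less.hyps by (intro attained_swap h) simp
    qed simp
  qed
  have "attained (tmon n h z)"
    using z zs
  proof (induction rule: symsum_zero_induct)
    case zero
    show ?case by (rule attained_zero)
  next
    case (add f g)
    then show ?case using attained_add[of "tmon n h f" "tmon n h g"] by (simp add: tmon_add)
  next
    case (word c v w)
    then show ?case using sw[of v w] zl by blast
  qed
  moreover have "attained (tmon n h s)"
  proof -
    let ?x = "\<lambda>i. \<lambda>g\<in>G. if i = n \<and> g = h then sym_proj ?f else \<zero>\<^bsub>sym_algebra\<^esub>"
    have "?x \<in> carrier PS"
      using f by (intro PS_I[of _ n]) (auto simp: carrier_S zero_S carrier_sym_algebra zero_sym_algebra)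
    moreover have "lift ?x = tmon n h s"
      by (auto simp: lift_def tmon_def s_def section_zero fun_eq_iff)
    ultimately show ?thesis using attained_lift by metis
  qed
  moreover have "tmon n h ?f = tmon n h s \<oplus>\<^bsub>P\<^esub> tmon n h z"
    using s z by (simp add: tmon_add z_def)
  ultimately show ?case using attained_add by simp
qed

lemma hecke_surj: "hecke_map G \<alpha> a \<sigma> ` carrier PS = carrier (hecke_algebra G \<alpha> a)"
proof
  interpret P: ring P by (rule ring_P)
  show "hecke_map G \<alpha> a \<sigma> ` carrier PS \<subseteq> carrier (hecke_algebra G \<alpha> a)"
    using hecke_hom by (auto simp: module_homs_def)
  show "carrier (hecke_algebra G \<alpha> a) \<subseteq> hecke_map G \<alpha> a \<sigma> ` carrier PS"
  proof
    fix X assume "X \<in> carrier (hecke_algebra G \<alpha> a)"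
    then obtain f where f: "f \<in> carrier P" and X: "X = hideal +>\<^bsub>P\<^esub> f"
      by (auto simp: hecke_algebra_def carrier_quotient_algebra)
    have "attained f"
      using f
    proof (induction f rule: P_induct)
      case (add x y)
      then show ?case by (intro attained_add)
    qed (rule attained_mon)
    then obtain x z where x: "x \<in> carrier PS" and z: "z \<in> hideal" and e: "f = lift x \<oplus>\<^bsub>P\<^esub> z"
      unfolding attained_def by blast
    have "f \<ominus>\<^bsub>P\<^esub> lift x = z"
      unfolding e using lift_closed[OF x] hideal_closed[OF z]
      by (simp add: a_minus_def P.a_assoc P.a_comm[of "lift x"] P.r_neg)
    then have "hideal +>\<^bsub>P\<^esub> f = hideal +>\<^bsub>P\<^esub> lift x"
      using z f lift_closed[OF x] by (subst P.quotient_eq_iff_same_a_r_cos[OF ideal_hideal, symmetric]) auto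
    then show "X \<in> hecke_map G \<alpha> a \<sigma> ` carrier PS"
      using x X by (auto simp: hecke_map_lift)
  qed
qed

lemma pbw:
  assumes equivariant jacobi
  shows "twisted_graded_hecke_algebra G \<alpha> a \<sigma>"
  using assms hecke_inj hecke_surj hecke_hom
  by (auto simp: twisted_graded_hecke_algebra_def module_isos_def bij_betw_def)

section \<open>Necessity of equivariance and of the Jacobi identity\<close>

text \<open>In degree at most one the section is the identity, so \<open>e\<close> is the lift of
  its own symmetric image. Being in the ideal, it represents zero, and injectivity makes the image
  vanish. Degree zero yields equivariance and degree one the Jacobi identity.\<close>

lemma low_degree_zero:
  assumes tw: "twisted_graded_hecke_algebra G \<alpha> a \<sigma>" and e: "e \<in> hideal" and k: "k \<le> 1"
    and deg: "\<And>i g w. g \<in> G \<Longrightarrow> e i g w \<noteq> 0 \<Longrightarrow> length w = k" and g: "g \<in> G"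
  shows "e i g = (\<lambda>w. 0)"
proof -
  interpret P: ring P by (rule ring_P)
  interpret I: ideal hideal P by (rule ideal_hideal)
  have eP: "e \<in> carrier P" using e by (rule hideal_closed)
  let ?x = "\<lambda>i. \<lambda>g\<in>G. sym_proj (e i g)"
  obtain n where n: "\<forall>i>n. e i = \<zero>\<^bsub>R\<^esub>" using P_bound[OF eP] by blast
  have x: "?x \<in> carrier PS"
    using n P_tensors[OF eP]
    by (intro PS_I[of _ n]) (auto simp: carrier_S zero_S carrier_sym_algebra zero_sym_algebra zero_R cong: restrict_cong)
  have sec: "\<sigma> (sym_proj (e i g)) = e i g" if "g \<in> G" for i g
    using that by (intro section_short[OF P_tensors[OF eP] deg k])
  have l: "lift ?x = e"
    by (intro P_eqI lift_closed x eP) (simp add: lift_def sec)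
  have "hecke_map G \<alpha> a \<sigma> ?x = hecke_map G \<alpha> a \<sigma> (\<lambda>i. \<zero>\<^bsub>S\<^esub>)"
    unfolding hecke_map_lift l lift_zero using I.a_rcos_const[OF e] I.a_rcos_const[OF I.zero_closed] by simp
  moreover have "inj_on (hecke_map G \<alpha> a \<sigma>) (carrier PS)"
    using tw by (simp add: twisted_graded_hecke_algebra_def module_isos_def bij_betw_def)
  ultimately have "?x = (\<lambda>i. \<zero>\<^bsub>S\<^esub>)"
    using x zero_PS_closed by (meson inj_onD)
  from fun_cong[OF fun_cong[OF this], of i g] have "sym_proj (e i g) = \<zero>\<^bsub>sym_algebra\<^esub>"
    using g by (simp add: zero_S)
  then show ?thesis using sec[OF g, of i] g by (simp add: section_zero)
qed

lemma twisted_equivariant: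
  assumes tw: "twisted_graded_hecke_algebra G \<alpha> a \<sigma>"
  shows equivariant
  unfolding equivariant_def
proof (intro ballI allI)
  fix h x v w assume h: "h \<in> G" and x: "x \<in> G"
  interpret P: ring P by (rule ring_P)
  interpret I: ideal hideal P by (rule ideal_hideal)
  let ?t = "tmon 0 h (word [])"
  \<comment> \<open>The commutator parts of the two products agree, since \<open>h\<close> acts on
    both vectors; only multiples of group elements with power one remain.\<close>
  define e where "e = ?t \<otimes>\<^bsub>P\<^esub> hecke_rel v w \<ominus>\<^bsub>P\<^esub> hecke_rel (h *v v) (h *v w) \<otimes>\<^bsub>P\<^esub> ?t"
  have t: "?t \<in> carrier P" by (intro tmon_closed tensors_word)
  have e: "e \<in> hideal"
    unfolding e_def a_minus_def by (intro I.a_closed I.a_inv_closed I.I_l_closed I.I_r_closed hecke_rel_in t)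
  have app: "e i k y = (if i = 1 then (\<alpha> (k ** matrix_inv h) h * a (k ** matrix_inv h) (h *v v) (h *v w)
      - \<alpha> h (matrix_inv h ** k) * a (matrix_inv h ** k) v w) * word [] y else 0)" if k: "k \<in> G" for i k y
    unfolding e_def using k h
    by (simp add: minus_P t mult_P_closed hecke_rel_closed tmon_hecke_rel hecke_rel_tmon left_diff_distrib)
  \<comment> \<open>At the component \<open>h ** x\<close> the two terms involve the forms at
    \<open>h ** x ** matrix_inv h\<close> and at \<open>x\<close>.\<close>
  have hx: "h ** x \<in> G" using h x by simp
  have "e 1 (h ** x) = (\<lambda>w. 0)"
    by (rule low_degree_zero[OF tw e, of 0]) (use hx in \<open>auto simp: app word_def split: if_splits\<close>)
  then have "e 1 (h ** x) [] = 0" by simp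
  then show "\<alpha> (h ** x ** matrix_inv h) h * a (h ** x ** matrix_inv h) (h *v v) (h *v w) = \<alpha> h x * a x v w"
    using h x by (simp add: app[OF hx] word_def)
qed

definition jac_elem :: "complex ^ 'n \<Rightarrow> complex ^ 'n \<Rightarrow> complex ^ 'n \<Rightarrow> nat \<Rightarrow> complex ^ 'n ^ 'n \<Rightarrow> 'n list \<Rightarrow> complex" where
  "jac_elem u v w = hecke_rel u v \<otimes>\<^bsub>P\<^esub> tmon 0 (mat 1) (tensor_vec w)
     \<ominus>\<^bsub>P\<^esub> tmon 0 (mat 1) (tensor_vec w) \<otimes>\<^bsub>P\<^esub> hecke_rel u v"

lemma jac_elem_in: "jac_elem u v w \<in> hideal"
proof -
  interpret P: ring P by (rule ring_P)
  interpret I: ideal hideal P by (rule ideal_hideal)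
  have t: "tmon 0 (mat 1) (tensor_vec w) \<in> carrier P" by (intro tmon_closed tensor_vec_in_tensors)
  show ?thesis
    unfolding jac_elem_def a_minus_def
    by (intro I.a_closed I.a_inv_closed I.I_l_closed I.I_r_closed hecke_rel_in t)
qed

lemma jac_elem_apply:
  assumes k: "k \<in> G"
  shows "jac_elem u v w i k x = (if i = 0 \<and> k = mat 1 then
      tmul (commutator u v) (tensor_vec w) x - tmul (tensor_vec w) (commutator u v) x
    else if i = 1 then - (a k u v * (tensor_vec (k *v w) x - tensor_vec w x)) else 0)"
proof -
  have t: "tmon 0 (mat 1) (tensor_vec w) \<in> carrier P" by (intro tmon_closed tensor_vec_in_tensors)
  have s: "tmul (\<lambda>x. - (c * word [] x)) f y = - (c * f y)" for c f y
    using tmul_scale_left[of "- c" "word []" f y] by simp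
  show ?thesis
    unfolding jac_elem_def using k
    by (simp add: minus_P t mult_P_closed hecke_rel_closed tmon_mult_right tmon_hecke_rel
        hecke_rel_apply tensor_act_vec s right_diff_distrib)
qed

lemma twisted_jacobi:
  assumes tw: "twisted_graded_hecke_algebra G \<alpha> a \<sigma>"
  shows jacobi
  unfolding jacobi_def
proof (intro ballI allI)
  fix k u v w assume k: "k \<in> G"
  interpret P: ring P by (rule ring_P)
  interpret I: ideal hideal P by (rule ideal_hideal)
  \<comment> \<open>The cubic parts cancel by the Jacobi identity for commutators in the associative
    tensor algebra, which leaves vectors with power one.\<close>
  define e where "e = jac_elem u v w \<oplus>\<^bsub>P\<^esub> jac_elem v w u \<oplus>\<^bsub>P\<^esub> jac_elem w u v"
  have e: "e \<in> hideal" unfolding e_def by (intro I.a_closed jac_elem_in)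
  have c: "jac_elem u v w \<in> carrier P" for u v w by (rule hideal_closed[OF jac_elem_in])
  have sum: "e i g x = jac_elem u v w i g x + jac_elem v w u i g x + jac_elem w u v i g x" if "g \<in> G" for i g x
    unfolding e_def using that
    by (simp add: add_P[of "_ \<oplus>\<^bsub>P\<^esub> _"] c add_P_closed, simp add: add_P c)
  have comm: "tmul (commutator u v) (tensor_vec w) x - tmul (tensor_vec w) (commutator u v) x
      + (tmul (commutator v w) (tensor_vec u) x - tmul (tensor_vec u) (commutator v w) x)
      + (tmul (commutator w u) (tensor_vec v) x - tmul (tensor_vec v) (commutator w u) x) = 0" for x
    by (simp add: commutator_def tmul_diff_left tmul_diff_right tmul_assoc)
  have short: "length x = 1" if "tensor_vec v x \<noteq> 0" for v :: "complex ^ 'n" and x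
    using that by (auto simp: tensor_vec_def split: list.splits)
  have deg: "length x = 1" if g: "g \<in> G" and nz: "e i g x \<noteq> 0" for i g x
  proof (rule ccontr)
    assume "length x \<noteq> 1"
    then have "tensor_vec v x = 0" for v :: "complex ^ 'n" using short[of v x] by blast
    then have "e i g x = 0" using comm[of x] by (simp add: sum[OF g] jac_elem_apply[OF g])
    with nz show False by simp
  qed
  have "e 1 k = (\<lambda>w. 0)" by (rule low_degree_zero[OF tw e order.refl deg k])
  then have "e 1 k [d] = 0" for d by simp
  then have 0: "a k u v * ((k *v w) $ d - w $ d) + a k v w * ((k *v u) $ d - u $ d) + a k w u * ((k *v v) $ d - v $ d) = 0" for d
    by (simp add: sum[OF k] jac_elem_apply[OF k] tensor_vec_def add_eq_0_iff2 algebra_simps)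
  show "a k u v *s (k *v w - w) + a k v w *s (k *v u - u) + a k w u *s (k *v v - v) = 0"
    by (simp only: vec_eq_iff vector_add_component vector_smult_component vector_minus_component 0 zero_index)
       simp
qed

text \<open>The right side does not mention \<open>\<sigma>\<close>: being a twisted graded Hecke
  algebra does not depend on the graded section.\<close>

lemma twisted_iff: "twisted_graded_hecke_algebra G \<alpha> a \<sigma> \<longleftrightarrow> equivariant \<and> jacobi"
  using pbw twisted_equivariant twisted_jacobi by blast

end

section \<open>Fixed spaces and forms of rank two\<close>

lemma fixed_space_subspace: "vec.subspace (fixed_space g)"
  by (simp add: vec.subspace_def fixed_space_def vec.add vec.scale matrix_vector_right_distrib vector_scalar_commute[symmetric])

section \<open>Orthogonal decomposition with respect to an invariant form\<close>

locale hermitian_group = cocycle_group G \<alpha>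
  for G :: "(complex ^ 'n ^ 'n) set" and \<alpha> :: "complex ^ 'n ^ 'n \<Rightarrow> complex ^ 'n ^ 'n \<Rightarrow> complex" +
  fixes H :: "complex ^ 'n \<Rightarrow> complex ^ 'n \<Rightarrow> complex" and g :: "complex ^ 'n ^ 'n"
  assumes hermitian: "invariant_nondegenerate_hermitian G H" and g: "g \<in> G"
begin

abbreviation "F \<equiv> fixed_space g"
abbreviation "W \<equiv> orth_compl H F"

lemma H_add: "H (v + v') w = H v w + H v' w" and H_scale: "H (c *s v) w = c * H v w"
proof -
  have "Vector_Spaces.linear (*s) (*) (\<lambda>v. H v w)"
    using hermitian unfolding invariant_nondegenerate_hermitian_def by blast
  note l = Vector_Spaces.linear.axioms(3)[OF this]
  show "H (v + v') w = H v w + H v' w" by (rule module_hom.add[OF l])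
  show "H (c *s v) w = c * H v w" by (rule module_hom.scale[OF l])
qed

lemma H_cnj: "H w v = cnj (H v w)"
  using hermitian unfolding invariant_nondegenerate_hermitian_def by blast

lemma H_nondegenerate: "(\<And>w. H v w = 0) \<Longrightarrow> v = 0"
  using hermitian unfolding invariant_nondegenerate_hermitian_def by blast

lemma H_invariant: "h \<in> G \<Longrightarrow> H (h *v v) (h *v w) = H v w"
  using hermitian unfolding invariant_nondegenerate_hermitian_def by blast

lemma H_0: "H 0 w = 0"
  using H_scale[of 0 0 w] by simp

lemma H_diff: "H (v - v') w = H v w - H v' w"
  using H_add[of "v - v'" v' w] by (simp add: algebra_simps)

lemma W_subspace: "vec.subspace W"
  by (simp add: vec.subspace_def orth_compl_def H_0 H_add H_scale)

definition gpow :: "nat \<Rightarrow> complex ^ 'n ^ 'n" where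
  "gpow k = ((\<lambda>A. g ** A) ^^ k) (mat 1)"

lemma gpow_Suc: "gpow (Suc k) = g ** gpow k" and gpow_0: "gpow 0 = mat 1"
  by (simp_all add: gpow_def)

lemma gpow_G: "gpow k \<in> G"
  by (induction k) (simp_all add: gpow_Suc gpow_0 g)

lemma gpow_add: "gpow (i + j) = gpow i ** gpow j"
  by (induction i) (simp_all add: gpow_Suc gpow_0 matrix_mul_assoc)

lemma gpow_order: "\<exists>n>0. gpow n = mat 1"
proof -
  have "\<not> inj gpow"
  proof
    assume "inj gpow"
    moreover have "finite (range gpow)" by (rule finite_subset[OF _ finite_G]) (auto simp: gpow_G)
    ultimately have "finite (UNIV :: nat set)" by (rule finite_imageD[rotated])
    then show False by simp
  qed
  then obtain i' j' where "gpow i' = gpow j'" "i' \<noteq> j'" by (auto simp: inj_def)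
  then obtain i j where ij: "gpow i = gpow j" "i < j" by (metis linorder_neqE_nat)
  have "gpow i ** gpow (j - i) = gpow i"
    using ij gpow_add[of i "j - i"] by simp
  then have "matrix_inv (gpow i) ** (gpow i ** gpow (j - i)) = matrix_inv (gpow i) ** gpow i" by simp
  then have "gpow (j - i) = mat 1" by (simp add: gpow_G)
  then show ?thesis using ij(2) by (intro exI[of _ "j - i"]) simp
qed

lemma gpow_fixed: "w \<in> F \<Longrightarrow> gpow k *v w = w"
  by (induction k) (simp_all add: gpow_Suc gpow_0 fixed_space_def matrix_vector_mul_assoc[symmetric])

text \<open>The projection onto the fixed space is the average over the powers of \<open>g\<close>.\<close>

lemma decomposition: "\<exists>u\<in>F. v - u \<in> W"
proof -
  obtain n where n: "n > 0" "gpow n = mat 1" using gpow_order by blast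
  let ?s = "\<Sum>k<n. gpow k *v v"
  let ?u = "(1 / of_nat n) *s ?s"
  have "g *v ?s = (\<Sum>k<n. gpow (Suc k) *v v)"
    by (simp add: vec.sum gpow_Suc matrix_vector_mul_assoc)
  also have "\<dots> = ?s"
    using sum.lessThan_Suc_shift[of "\<lambda>k. gpow k *v v" n] n by (simp add: gpow_0)
  finally have u: "?u \<in> F" by (simp add: fixed_space_def vec.scale)
  have "H (v - ?u) w = 0" if w: "w \<in> F" for w
  proof -
    have "H (gpow k *v v) w = H v w" for k
      using H_invariant[OF gpow_G, of k v w] gpow_fixed[OF w] by simp
    then have "H (\<Sum>k<m. gpow k *v v) w = of_nat m * H v w" for m
      by (induction m) (simp_all add: H_0 H_add algebra_simps)
    then show ?thesis using n by (simp add: H_diff H_scale)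
  qed
  then show ?thesis using u by (auto simp: orth_compl_def)
qed

text \<open>The Hermitian form may be indefinite, so \<open>H x x = 0\<close> says nothing. Instead
  every \<open>w\<close> splits into a part in \<open>F\<close> and a part in \<open>W\<close>; the
  vector \<open>x\<close> is orthogonal to both parts, hence to everything, and nondegeneracy
  applies.\<close>

lemma F_inter_W: assumes "x \<in> F" "x \<in> W" shows "x = 0"
proof (rule H_nondegenerate)
  fix w
  obtain u where u: "u \<in> F" "w - u \<in> W" using decomposition by blast
  have "H x w = cnj (H ((w - u) + u) x)" using H_cnj[of x w] by simp
  also have "\<dots> = cnj (H (w - u) x) + cnj (H u x)" by (simp only: H_add complex_cnj_add)
  also have "\<dots> = 0"
    using assms u H_cnj[of u x] by (simp add: orth_compl_def)
  finally show "H x w = 0" .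
qed

lemma dim_F_W: "vec.dim F + vec.dim W = CARD('n)"
proof -
  obtain B where B: "B \<subseteq> F" "vec.independent B" "F \<subseteq> vec.span B" "card B = vec.dim F"
    using vec.basis_exists[of F] by blast
  obtain C where C: "C \<subseteq> W" "vec.independent C" "W \<subseteq> vec.span C" "card C = vec.dim W"
    using vec.basis_exists[of W] by blast
  have fin: "finite B" "finite C" using vec.finiteI_independent[OF B(2)] vec.finiteI_independent[OF C(2)] by auto
  have "0 \<notin> B" using B(2) vec.dependent_zero[of B] by blast
  then have disj: "B \<inter> C = {}" using B(1) C(1) F_inter_W by blast
  have "\<not> vec.dependent (B \<union> C)"
  proof
    assume "vec.dependent (B \<union> C)"
    then obtain c where c: "\<exists>v\<in>B \<union> C. c v \<noteq> 0" "(\<Sum>v\<in>B \<union> C. c v *s v) = 0"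
      using fin by (auto simp: vec.dependent_finite)
    have sum: "(\<Sum>v\<in>B. c v *s v) + (\<Sum>v\<in>C. c v *s v) = 0"
      using c(2) fin disj by (simp add: sum.union_disjoint)
    have BF: "(\<Sum>v\<in>B. c v *s v) \<in> F"
      using B(1) by (intro vec.subspace_sum vec.subspace_scale fixed_space_subspace) auto
    have CW: "(\<Sum>v\<in>C. c v *s v) \<in> W"
      using C(1) by (intro vec.subspace_sum vec.subspace_scale W_subspace) auto
    have "(\<Sum>v\<in>B. c v *s v) = (-1) *s (\<Sum>v\<in>C. c v *s v)"
      using sum by (simp add: eq_neg_iff_add_eq_0)
    then have "(\<Sum>v\<in>B. c v *s v) \<in> W" using vec.subspace_scale[OF W_subspace CW, of "-1"] by (simp only:)
    then have 0: "(\<Sum>v\<in>B. c v *s v) = 0" using F_inter_W[OF BF] by simp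
    then have 1: "(\<Sum>v\<in>C. c v *s v) = 0" using sum by simp
    have "c v = 0" if "v \<in> B" for v
      using B(2) fin(1) 0 that by (auto simp: vec.dependent_finite)
    moreover have "c v = 0" if "v \<in> C" for v
      using C(2) fin(2) 1 that by (auto simp: vec.dependent_finite)
    ultimately show False using c(1) by auto
  qed
  moreover have "vec.span (B \<union> C) = UNIV"
  proof -
    have "v \<in> vec.span (B \<union> C)" for v
    proof -
      obtain u where u: "u \<in> F" "v - u \<in> W" using decomposition by blast
      have "u \<in> vec.span (B \<union> C)" "v - u \<in> vec.span (B \<union> C)"
        using u B(3) C(3) vec.span_mono[of B "B \<union> C"] vec.span_mono[of C "B \<union> C"] by auto
      from vec.span_add[OF this] show ?thesis by simp
    qed
    then show ?thesis by auto
  qed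
  ultimately have "vec.dim (UNIV :: (complex ^ 'n) set) = card (B \<union> C)"
    by (intro vec.dim_eq_card) simp_all
  then show ?thesis
    using fin disj B(4) C(4) by (simp only: vec_dim_card card_Un_disjoint)
qed

lemma perp_map_props: "perp_map H g h v \<in> W \<and> h *v v - perp_map H g h v \<in> F"
  unfolding perp_map_def
proof (rule theI')
  obtain u where u: "u \<in> F" "h *v v - u \<in> W" using decomposition by blast
  show "\<exists>!w. w \<in> W \<and> h *v v - w \<in> F"
  proof (rule ex1I[of _ "h *v v - u"])
    fix w assume w: "w \<in> W \<and> h *v v - w \<in> F"
    have "(h *v v - u) - w \<in> W" using u w vec.subspace_diff[OF W_subspace, of "h *v v - u" w] by simp
    moreover have "(h *v v - w) - u \<in> F"
      using u w vec.subspace_diff[OF fixed_space_subspace, of "h *v v - w" g u] by simp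
    moreover have "(h *v v - w) - u = (h *v v - u) - w" by simp
    ultimately have "(h *v v - u) - w = 0" using F_inter_W by metis
    then show "w = h *v v - u" by simp
  qed (use u in simp)
qed

text \<open>The vectors obtained are the very basis that the choice in \<open>det_on\<close>
  selects, so the Leibniz formula can be evaluated on them, the two permutations being the identity
  and the transposition.\<close>

lemma det_on_two:
  assumes "codim F = 2"
  obtains b0 b1 where "b0 \<in> W" "b1 \<in> W" "b0 \<noteq> b1" "vec.independent {b0, b1}" "vec.span {b0, b1} = W"
    "\<And>f. det_on W f = vec.representation {b0, b1} (f b0) b0 * vec.representation {b0, b1} (f b1) b1
       - vec.representation {b0, b1} (f b0) b1 * vec.representation {b0, b1} (f b1) b0"
proof -
  have dimW: "vec.dim W = 2" using assms dim_F_W by (simp add: codim_def)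
  define bs where "bs = (SOME bs. basis_list W bs)"
  obtain C where C: "C \<subseteq> W" "vec.independent C" "W \<subseteq> vec.span C" "card C = vec.dim W"
    using vec.basis_exists[of W] by blast
  obtain cs where "distinct cs" "set cs = C"
    using finite_distinct_list[OF vec.finiteI_independent[OF C(2)]] by blast
  moreover have "vec.span C = W"
    using C vec.span_minimal[OF C(1) W_subspace] by auto
  ultimately have "basis_list W cs" using C by (simp add: basis_list_def)
  then have bs: "basis_list W bs" unfolding bs_def by (rule someI)
  then have bs': "distinct bs" "vec.independent (set bs)" "vec.span (set bs) = W"
    by (simp_all add: basis_list_def)
  have "vec.dim W = vec.dim (set bs)" using vec.dim_span[of "set bs"] bs'(3) by simp
  also have "\<dots> = length bs"
    using vec.dim_eq_card_independent[OF bs'(2)] distinct_card[OF bs'(1)] by simp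
  finally have "length bs = 2" using dimW by simp
  then obtain b0 b1 where b: "bs = [b0, b1]"
    by (auto simp: numeral_2_eq_2 length_Suc_conv)
  have ne: "b0 \<noteq> b1" and ind: "vec.independent {b0, b1}" and sp: "vec.span {b0, b1} = W"
    using bs by (simp_all add: b basis_list_def)
  have two: "{..<2::nat} = {0, 1}" by auto
  have "{p. p permutes {0, 1::nat}} = {id, Transposition.transpose 0 1}"
    by (auto simp: permutes_doubleton_iff)
  moreover have "id \<noteq> Transposition.transpose 0 (1::nat)"
    by (metis id_apply transpose_apply_first zero_neq_one)
  ultimately have "det_on W f = vec.representation {b0, b1} (f b0) b0 * vec.representation {b0, b1} (f b1) b1
       - vec.representation {b0, b1} (f b0) b1 * vec.representation {b0, b1} (f b1) b0" for f
    unfolding det_on_def bs_def[symmetric] b Let_def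
    by (simp add: numeral_2_eq_2[symmetric] two sign_swap_id sign_id del: One_nat_def)
  moreover have "b0 \<in> W" "b1 \<in> W" using vec.span_base[of _ "{b0, b1}"] sp by auto
  ultimately show ?thesis using that ne ind sp by blast
qed

lemma span_two:
  assumes "b0 \<noteq> b1" "vec.independent {b0, b1}" "v \<in> vec.span {b0, b1}"
  shows "v = vec.representation {b0, b1} v b0 *s b0 + vec.representation {b0, b1} v b1 *s b1"
  using vec.sum_representation_eq[OF assms(2,3), of "{b0, b1}"] assms(1) by simp

section \<open>Skew forms whose kernel is a fixed space of codimension two\<close>

context
  fixes b :: "complex ^ 'n \<Rightarrow> complex ^ 'n \<Rightarrow> complex"
  assumes b: "skew_bilinear_form b" and ker: "form_kernel b = F" and codim: "codim F = 2"
begin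

lemma form_fixed: "x \<in> F \<Longrightarrow> b x w = 0" "x \<in> F \<Longrightarrow> b w x = 0"
proof -
  assume "x \<in> F"
  then show "b x w = 0" using ker by (auto simp: form_kernel_def)
  then show "b w x = 0" using skew_form_swap[OF b, of w x] by simp
qed

lemma form_mod_fixed:
  "x \<in> F \<Longrightarrow> y \<in> F \<Longrightarrow> b (x + v) (y + w) = b v w"
  by (simp add: skew_form_add_left[OF b] skew_form_add_right[OF b] form_fixed)

lemma form_two: "b (x0 *s p + x1 *s q) (y0 *s p + y1 *s q) = (x0 * y1 - x1 * y0) * b p q"
  using skew_form_swap[OF b, of q p]
  by (simp add: skew_form_add_left[OF b] skew_form_add_right[OF b] skew_form_scale_left[OF b]
      skew_form_scale_right[OF b] skew_form_self[OF b] algebra_simps)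

lemma coordinates_exist:
  assumes "b0 \<noteq> b1" "vec.independent {b0, b1}" "vec.span {b0, b1} = W"
  shows "\<exists>v0\<in>F. \<exists>x0 x1. v = v0 + (x0 *s b0 + x1 *s b1)"
proof -
  obtain u where u: "u \<in> F" "v - u \<in> W" using decomposition by blast
  have "v = u + (v - u)" by simp
  then show ?thesis using u span_two[OF assms(1,2), of "v - u"] assms(3) by metis
qed

text \<open>Modulo \<open>F\<close> the space is a plane, and a skew form on a plane scales by the
  determinant of an endomorphism. The form ignores \<open>F\<close>, so on \<open>W\<close> the map
  \<open>h\<close> may be replaced by \<open>perp_map H g h\<close>; since \<open>h\<close> commutes
  with \<open>g\<close> it preserves \<open>F\<close>, which extends the formula to all
  vectors.\<close>

lemma form_det:
  assumes h: "h \<in> G" and comm: "h ** g = g ** h"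
  shows "b (h *v v) (h *v w) = det_on W (perp_map H g h) * b v w"
proof -
  obtain b0 b1 where B: "b0 \<in> W" "b1 \<in> W" "b0 \<noteq> b1" "vec.independent {b0, b1}" "vec.span {b0, b1} = W"
    and det: "\<And>f. det_on W f = vec.representation {b0, b1} (f b0) b0 * vec.representation {b0, b1} (f b1) b1
       - vec.representation {b0, b1} (f b0) b1 * vec.representation {b0, b1} (f b1) b0"
    using det_on_two[OF codim] by metis
  let ?f = "perp_map H g h"
  have f: "?f v = vec.representation {b0, b1} (?f v) b0 *s b0 + vec.representation {b0, b1} (?f v) b1 *s b1" for v
    using perp_map_props B by (intro span_two) auto
  have "b (h *v b0) (h *v b1) = b ((h *v b0 - ?f b0) + ?f b0) ((h *v b1 - ?f b1) + ?f b1)" by simp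
  also have "\<dots> = b (?f b0) (?f b1)"
    using perp_map_props by (intro form_mod_fixed) auto
  also have "\<dots> = det_on W ?f * b b0 b1"
    unfolding det by (subst (1 2) f, subst form_two) simp
  finally have hb: "b (h *v b0) (h *v b1) = det_on W ?f * b b0 b1" .
  have hF: "h *v u \<in> F" if "u \<in> F" for u
    using that comm by (simp add: fixed_space_def) (metis matrix_vector_mul_assoc)
  obtain v0 x0 x1 where v: "v0 \<in> F" "v = v0 + (x0 *s b0 + x1 *s b1)"
    using coordinates_exist[OF B(3-5)] by metis
  obtain w0 y0 y1 where w: "w0 \<in> F" "w = w0 + (y0 *s b0 + y1 *s b1)"
    using coordinates_exist[OF B(3-5)] by metis
  have "b (h *v v) (h *v w) = b (x0 *s (h *v b0) + x1 *s (h *v b1)) (y0 *s (h *v b0) + y1 *s (h *v b1))"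
    unfolding v(2) w(2) using hF[OF v(1)] hF[OF w(1)]
    by (simp add: vec.add vec.scale form_mod_fixed)
  also have "\<dots> = (x0 * y1 - x1 * y0) * b (h *v b0) (h *v b1)" by (rule form_two)
  also have "\<dots> = det_on W ?f * b v w"
    unfolding v(2) w(2) hb form_mod_fixed[OF v(1) w(1)] form_two by simp
  finally show ?thesis .
qed

text \<open>Both the form and \<open>g - 1\<close> factor through the quotient by \<open>F\<close>.
  The expression is alternating in three vectors of a plane, hence zero.\<close>

lemma form_jacobi: "b u v *s (g *v w - w) + b v w *s (g *v u - u) + b w u *s (g *v v - v) = 0"
proof -
  obtain b0 b1 where B: "b0 \<in> W" "b1 \<in> W" "b0 \<noteq> b1" "vec.independent {b0, b1}" "vec.span {b0, b1} = W"
    using det_on_two[OF codim] by metis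
  obtain u0 x0 x1 where u: "u0 \<in> F" "u = u0 + (x0 *s b0 + x1 *s b1)"
    using coordinates_exist[OF B(3-5)] by metis
  obtain v0 y0 y1 where v: "v0 \<in> F" "v = v0 + (y0 *s b0 + y1 *s b1)"
    using coordinates_exist[OF B(3-5)] by metis
  obtain w0 z0 z1 where w: "w0 \<in> F" "w = w0 + (z0 *s b0 + z1 *s b1)"
    using coordinates_exist[OF B(3-5)] by metis
  have d: "g *v (x + (c0 *s b0 + c1 *s b1)) - (x + (c0 *s b0 + c1 *s b1))
      = c0 *s (g *v b0 - b0) + c1 *s (g *v b1 - b1)" if "x \<in> F" for x c0 c1
    using that by (simp add: vec.add vec.scale fixed_space_def vec.scale_right_diff_distrib)
  show ?thesis
    unfolding u(2) v(2) w(2) d[OF u(1)] d[OF v(1)] d[OF w(1)]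
      form_mod_fixed[OF u(1) v(1)] form_mod_fixed[OF v(1) w(1)] form_mod_fixed[OF w(1) u(1)] form_two
    by (simp add: vec_eq_iff) (simp add: algebra_simps)
qed

end

text \<open>For \<open>x\<close> in the kernel, the Jacobi identity with a pair \<open>v\<close>,
  \<open>w\<close> on which the form is nonzero leaves only the term in \<open>g *v x - x\<close>.
  For a fixed \<open>x\<close> outside the kernel it forces \<open>g - 1\<close> to have its image
  on one line, and invariance turns this into \<open>g = mat 1\<close>. Finally \<open>v\<close> and
  \<open>w\<close> complement the fixed space.\<close>

lemma form_kernel_codim:
  assumes b: "skew_bilinear_form b" and nz: "b \<noteq> (\<lambda>v w. 0)" and g1: "g \<noteq> mat 1"
    and inv: "\<And>v w. b (g *v v) (g *v w) = b v w"
    and jac: "\<And>u v w. b u v *s (g *v w - w) + b v w *s (g *v u - u) + b w u *s (g *v v - v) = 0"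
  shows "form_kernel b = F \<and> codim F = 2"
proof -
  obtain v w where vw: "b v w \<noteq> 0" using nz by (auto simp: fun_eq_iff)
  have sub1: "x \<in> F" if "x \<in> form_kernel b" for x
  proof -
    have "b w x = 0" "b x v = 0"
      using that skew_form_swap[OF b, of w x] by (auto simp: form_kernel_def)
    then have "b v w *s (g *v x - x) = 0" using jac[of v w x] by simp
    then show ?thesis using vw by (simp add: fixed_space_def)
  qed
  have sub2: "x \<in> form_kernel b" if x: "x \<in> F" for x
  proof (rule ccontr)
    assume "x \<notin> form_kernel b"
    then obtain y where y: "b x y \<noteq> 0" by (auto simp: form_kernel_def)
    have gx: "g *v x = x" using x by (simp add: fixed_space_def)
    have line: "b x y *s (g *v u - u) = - (b u x *s (g *v y - y))" for u
    proof -
      have "b u x *s (g *v y - y) + b x y *s (g *v u - u) = 0"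
        using jac[of u x y] by (simp only: gx diff_self vec.scale_zero_right add_0_right)
      then show ?thesis by (simp only: add_eq_0_iff)
    qed
    let ?y = "g *v y - y"
    \<comment> \<open>Invariance gives \<open>b (g *v y) x = b y x\<close>, because \<open>x\<close>
      is fixed.\<close>
    have "b ?y x = 0"
      using inv[of y x] skew_form_add_left[OF b, of "?y" y x] gx by simp
    then have "b x y *s (g *v ?y - ?y) = 0" using line[of ?y] by simp
    then have "g *v ?y - ?y = 0" using y by (simp only: vec.scale_eq_0_iff) simp
    then have "?y \<in> F" by (simp only: fixed_space_def mem_Collect_eq right_minus_eq)
    \<comment> \<open>The image of \<open>g - 1\<close> is orthogonal to the fixed vectors by
      invariance of \<open>H\<close>. The vector \<open>?y\<close> is now both fixed and orthogonal
      to the fixed space.\<close>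
    moreover have "?y \<in> W"
      using H_invariant[OF g, of y] by (auto simp: orth_compl_def H_diff fixed_space_def) metis
    ultimately have "?y = 0" by (rule F_inter_W)
    then have "b x y *s (g *v u - u) = 0" for u using line[of u] by simp
    then have "g *v u - u = 0" for u using y by (simp only: vec.scale_eq_0_iff) simp
    then have "g *v u = u" for u by (simp only: right_minus_eq)
    then have "g = mat 1" by (simp add: matrix_eq)
    with g1 show False by simp
  qed
  have ker: "form_kernel b = F" using sub1 sub2 by auto
  have kerD: "b x y = 0" if "x \<in> F" for x y using ker that by (auto simp: form_kernel_def)
  obtain B where B: "B \<subseteq> F" "vec.independent B" "F \<subseteq> vec.span B" "card B = vec.dim F"
    using vec.basis_exists[of F] by blast
  have fin: "finite B" by (rule vec.finiteI_independent[OF B(2)])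
  have spB: "vec.span B = F"
    using B vec.span_minimal[OF B(1) fixed_space_subspace] by auto
  have wB: "w \<notin> vec.span B"
    unfolding spB using kerD[of w v] vw skew_form_swap[OF b, of v w] by auto
  have vB: "v \<notin> vec.span (insert w B)"
  proof
    assume "v \<in> vec.span (insert w B)"
    then obtain k where "v - k *s w \<in> F" unfolding vec.span_breakdown_eq spB by blast
    then have "b (v - k *s w) w = 0" by (rule kerD)
    moreover have "b v w = b ((v - k *s w) + k *s w) w" by simp
    ultimately have "b v w = 0"
      by (simp only: skew_form_add_left[OF b] skew_form_scale_left[OF b] skew_form_self[OF b]) simp
    with vw show False by simp
  qed
  have ind: "vec.independent (insert v (insert w B))"
    by (intro vec.independent_insertI vB wB B(2))
  have "u \<in> vec.span (insert v (insert w B))" for u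
  proof -
    \<comment> \<open>The coefficients \<open>s\<close> and \<open>t\<close> are chosen so that
      \<open>u - s *s v - t *s w\<close> pairs to zero with \<open>v\<close> and \<open>w\<close>;
      the Jacobi identity then makes this vector fixed.\<close>
    define s where "s = b u w / b v w"
    define t where "t = b v u / b v w"
    have "b (u - s *s v - t *s w) v = 0" "b (u - s *s v - t *s w) w = 0"
    proof -
      have e: "b (u - s *s v - t *s w) y = b u y - s * b v y - t * b w y" for y
      proof -
        have "u - s *s v - t *s w = u + (-s) *s v + (-t) *s w" by simp
        then show ?thesis by (simp only: skew_form_add_left[OF b] skew_form_scale_left[OF b]) simp
      qed
      show "b (u - s *s v - t *s w) v = 0"
        using vw skew_form_swap[OF b, of u v] skew_form_swap[OF b, of w v]
        unfolding e by (simp add: skew_form_self[OF b] t_def)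
      show "b (u - s *s v - t *s w) w = 0"
        unfolding e using vw by (simp add: skew_form_self[OF b] s_def)
    qed
    then have "b v w *s (g *v (u - s *s v - t *s w) - (u - s *s v - t *s w)) = 0"
      using jac[of v w "u - s *s v - t *s w"] skew_form_swap[OF b, of w "u - s *s v - t *s w"] by simp
    then have "g *v (u - s *s v - t *s w) - (u - s *s v - t *s w) = 0"
      using vw by (simp only: vec.scale_eq_0_iff) simp
    then have "u - s *s v - t *s w \<in> vec.span B"
      by (simp only: spB fixed_space_def mem_Collect_eq right_minus_eq)
    then show ?thesis unfolding vec.span_breakdown_eq by blast
  qed
  then have "vec.span (insert v (insert w B)) = vec.span (UNIV :: (complex ^ 'n) set)" by auto
  from vec.dim_eq_card[OF this ind] have "CARD('n) = card (insert v (insert w B))"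
    by (simp only: vec_dim_card)
  also have "\<dots> = Suc (Suc (card B))"
    using vB wB fin vec.span_base by (simp add: card_insert_if) blast
  finally have "codim F = 2" unfolding codim_def B(4)[symmetric] by simp
  with ker show ?thesis by blast
qed

text \<open>Equivariance dictates the form at a conjugate \<open>h ** g ** matrix_inv h\<close>,
  with weight \<open>\<alpha> h g / \<alpha> m h\<close>. Averaging over all \<open>h\<close> that
  conjugate \<open>g\<close> to \<open>m\<close> avoids a choice of representatives. Such
  \<open>h\<close> form a coset of the centralizer if there are any, so its order is the right
  divisor; at an \<open>m\<close> not conjugate to \<open>g\<close> the sum is empty and the form is
  zero.\<close>

definition transport :: "(complex ^ 'n \<Rightarrow> complex ^ 'n \<Rightarrow> complex) \<Rightarrow> complex ^ 'n ^ 'n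
    \<Rightarrow> complex ^ 'n \<Rightarrow> complex ^ 'n \<Rightarrow> complex" where
  "transport b m v w = (\<Sum>h | h \<in> G \<and> h ** g ** matrix_inv h = m.
     \<alpha> h g / \<alpha> m h * b (matrix_inv h *v v) (matrix_inv h *v w))
     / of_nat (card {h \<in> G. h ** g ** matrix_inv h = g})"

lemma skew_transport:
  assumes b: "skew_bilinear_form b"
  shows "skew_bilinear_form (transport b m)"
proof -
  have l: "Vector_Spaces.linear (*s) (*) (\<lambda>w. b 0 w)"
    using b unfolding skew_bilinear_form_def by blast
  note vs = Vector_Spaces.linear.axioms(1,2)[OF l]
  have s: "transport b m v w = - transport b m w v" for v w
    unfolding transport_def minus_divide_left sum_negf[symmetric]
    by (intro arg_cong2[where f = "(/)"] sum.cong refl)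
       (subst skew_form_swap[OF b], simp)
  have 1: "transport b m (v + v') w = transport b m v w + transport b m v' w" for v v' w
    by (simp add: transport_def vec.add skew_form_add_left[OF b] distrib_left sum.distrib add_divide_distrib)
  have 2: "transport b m (c *s v) w = c * transport b m v w" for c v w
    by (simp add: transport_def vec.scale skew_form_scale_left[OF b] sum_distrib_left mult_ac)
  have 3: "transport b m w (v + v') = transport b m w v + transport b m w v'"
    and 4: "transport b m w (c *s v) = c * transport b m w v" for c v v' w
    using s[of w "v + v'"] s[of w v] s[of w v'] s[of w "c *s v"] 1[of v v' w] 2[of c v w] by auto
  show ?thesis
    unfolding skew_bilinear_form_def Vector_Spaces.linear_iff using vs 1 2 3 4 s by blast
qed

lemma conj_eq_iff: "h \<in> G \<Longrightarrow> h ** g ** matrix_inv h = g \<longleftrightarrow> h ** g = g ** h"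
  by (metis inv_cancel_right inv_cancel_right')

lemma transport_self:
  assumes "\<And>h v w. h \<in> G \<Longrightarrow> h ** g = g ** h \<Longrightarrow> b (h *v v) (h *v w) = \<alpha> h g / \<alpha> g h * b v w"
  shows "transport b g = b"
proof (intro ext)
  fix v w
  let ?C = "{h \<in> G. h ** g ** matrix_inv h = g}"
  have S: "(\<Sum>h | h \<in> G \<and> h ** g ** matrix_inv h = g. \<alpha> h g / \<alpha> g h * b (matrix_inv h *v v) (matrix_inv h *v w))
     = (\<Sum>h\<in>?C. b v w)"
  proof (rule sum.cong[OF refl])
    fix h assume "h \<in> {h. h \<in> G \<and> h ** g ** matrix_inv h = g}"
    then have h: "h \<in> G" "h ** g = g ** h" using conj_eq_iff[of h] by auto
    from assms[OF this, of "matrix_inv h *v v" "matrix_inv h *v w"] h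
    show "\<alpha> h g / \<alpha> g h * b (matrix_inv h *v v) (matrix_inv h *v w) = b v w" by simp
  qed
  have "mat 1 \<in> ?C" "finite ?C" by simp_all
  then have "card ?C \<noteq> 0" by (subst card_0_eq) blast+
  then have "(of_nat (card ?C) :: complex) \<noteq> 0" by (simp only: of_nat_eq_0_iff not_False_eq_True)
  then show "transport b g v w = b v w"
    unfolding transport_def S sum_constant by (rule nonzero_mult_div_cancel_left)
qed

text \<open>The substitution \<open>h = k ** l\<close> identifies the elements conjugating
  \<open>g\<close> to \<open>?z\<close> with those conjugating it to \<open>m\<close>. The weights
  match by the cocycle identity for the triples \<open>k, l, g\<close>, then \<open>k, m, l\<close>,
  then \<open>?z, k, l\<close>.\<close>

lemma transport_equivariant:
  assumes k: "k \<in> G" and m: "m \<in> G"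
  shows "\<alpha> (k ** m ** matrix_inv k) k * transport b (k ** m ** matrix_inv k) (k *v v) (k *v w)
    = \<alpha> k m * transport b m v w"
proof -
  let ?z = "k ** m ** matrix_inv k"
  have S1: "(\<Sum>h | h \<in> G \<and> h ** g ** matrix_inv h = ?z.
      \<alpha> h g / \<alpha> ?z h * b (matrix_inv h *v (k *v v)) (matrix_inv h *v (k *v w)))
    = (\<Sum>l | l \<in> G \<and> l ** g ** matrix_inv l = m. \<alpha> (k ** l) g / \<alpha> ?z (k ** l)
      * b (matrix_inv l *v v) (matrix_inv l *v w))"
  proof (rule sum.reindex_bij_witness[where i = "\<lambda>l. k ** l" and j = "\<lambda>h. matrix_inv k ** h"])
    fix h assume "h \<in> {h. h \<in> G \<and> h ** g ** matrix_inv h = ?z}"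
    then have h: "h \<in> G" "h ** g ** matrix_inv h = ?z" by auto
    show "k ** (matrix_inv k ** h) = h" using k by simp
    have "matrix_inv k ** h ** g ** matrix_inv (matrix_inv k ** h) = matrix_inv k ** (h ** g ** matrix_inv h) ** k"
      using k h(1) by (simp add: inv_mult matrix_mul_assoc)
    also have "\<dots> = m" unfolding h(2) using k by (simp add: matrix_mul_assoc[symmetric])
    finally show "matrix_inv k ** h \<in> {l. l \<in> G \<and> l ** g ** matrix_inv l = m}"
      using k h(1) by simp
    have "matrix_inv (matrix_inv k ** h) *v v = matrix_inv h *v (k *v v)" for v
      using k h(1) by (simp add: inv_mult matrix_vector_mul_assoc)
    then show "\<alpha> (k ** (matrix_inv k ** h)) g / \<alpha> ?z (k ** (matrix_inv k ** h))
        * b (matrix_inv (matrix_inv k ** h) *v v) (matrix_inv (matrix_inv k ** h) *v w)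
        = \<alpha> h g / \<alpha> ?z h * b (matrix_inv h *v (k *v v)) (matrix_inv h *v (k *v w))"
      using k by simp
  next
    fix l assume "l \<in> {l. l \<in> G \<and> l ** g ** matrix_inv l = m}"
    then have l: "l \<in> G" "l ** g ** matrix_inv l = m" by auto
    show "matrix_inv k ** (k ** l) = l" using k by simp
    show "k ** l \<in> {h. h \<in> G \<and> h ** g ** matrix_inv h = ?z}"
      using k l by (auto simp: inv_mult matrix_mul_assoc)
  qed
  have ratio: "\<alpha> ?z k * (\<alpha> (k ** l) g / \<alpha> ?z (k ** l)) = \<alpha> k m * (\<alpha> l g / \<alpha> m l)"
    if l: "l \<in> G" "l ** g ** matrix_inv l = m" for l
  proof -
    have z: "?z \<in> G" using k m by simp
    have ml: "m ** l = l ** g" unfolding l(2)[symmetric] using l(1) by simp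
    have zk: "?z ** k = k ** m" using k by simp
    have 1: "\<alpha> k l * \<alpha> (k ** l) g = \<alpha> l g * \<alpha> k (l ** g)" by (rule alpha_cocycle[OF k l(1) g])
    have 2: "\<alpha> k m * \<alpha> (k ** m) l = \<alpha> m l * \<alpha> k (l ** g)" using alpha_cocycle[OF k m l(1)] by (simp only: ml)
    have 3: "\<alpha> ?z k * \<alpha> (k ** m) l = \<alpha> k l * \<alpha> ?z (k ** l)" using alpha_cocycle[OF z k l(1)] by (simp only: zk)
    have nz: "\<alpha> k l \<noteq> 0" "\<alpha> ?z (k ** l) \<noteq> 0" "\<alpha> m l \<noteq> 0" using k l m z by simp_all
    have "\<alpha> k l * (\<alpha> ?z k * \<alpha> (k ** l) g * \<alpha> m l) = \<alpha> ?z k * \<alpha> l g * (\<alpha> m l * \<alpha> k (l ** g))"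
      using 1 by (simp add: mult_ac)
    also have "\<dots> = \<alpha> k m * \<alpha> l g * (\<alpha> ?z k * \<alpha> (k ** m) l)"
      unfolding 2[symmetric] by (simp add: mult_ac)
    also have "\<dots> = \<alpha> k l * (\<alpha> k m * \<alpha> l g * \<alpha> ?z (k ** l))"
      unfolding 3 by (simp add: mult_ac)
    finally have "\<alpha> ?z k * \<alpha> (k ** l) g * \<alpha> m l = \<alpha> k m * \<alpha> l g * \<alpha> ?z (k ** l)"
      using nz(1) by (simp only: mult_cancel_left) simp
    then show ?thesis using nz by (simp add: field_simps)
  qed
  have S2: "\<alpha> ?z k * (\<Sum>l | l \<in> G \<and> l ** g ** matrix_inv l = m. \<alpha> (k ** l) g / \<alpha> ?z (k ** l)
        * b (matrix_inv l *v v) (matrix_inv l *v w))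
     = \<alpha> k m * (\<Sum>l | l \<in> G \<and> l ** g ** matrix_inv l = m. \<alpha> l g / \<alpha> m l
        * b (matrix_inv l *v v) (matrix_inv l *v w))"
    unfolding sum_distrib_left
  proof (rule sum.cong[OF refl])
    fix l assume "l \<in> {l. l \<in> G \<and> l ** g ** matrix_inv l = m}"
    then show "\<alpha> ?z k * (\<alpha> (k ** l) g / \<alpha> ?z (k ** l) * b (matrix_inv l *v v) (matrix_inv l *v w))
        = \<alpha> k m * (\<alpha> l g / \<alpha> m l * b (matrix_inv l *v v) (matrix_inv l *v w))"
      using ratio[of l] by (simp only: mult.assoc[symmetric] mem_Collect_eq)
  qed
  show ?thesis
    unfolding transport_def S1 times_divide_eq_right S2 ..
qed

text \<open>The identity is linear in the form, and each summand is the image under \<open>h\<close>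
  of the identity for \<open>g\<close> at the vectors transformed by
  \<open>matrix_inv h\<close>.\<close>

lemma transport_jacobi:
  assumes b: "skew_bilinear_form b"
    and jac: "\<And>u v w. b u v *s (g *v w - w) + b v w *s (g *v u - u) + b w u *s (g *v v - v) = 0"
  shows "transport b m u v *s (m *v w - w) + transport b m v w *s (m *v u - u)
    + transport b m w u *s (m *v v - v) = 0"
proof -
  let ?A = "{h. h \<in> G \<and> h ** g ** matrix_inv h = m}"
  let ?c = "of_nat (card {h \<in> G. h ** g ** matrix_inv h = g}) :: complex"
  have t: "transport b m p q *s x = (\<Sum>h\<in>?A. (\<alpha> h g / \<alpha> m h / ?c) *s (b (matrix_inv h *v p) (matrix_inv h *v q) *s x))"
    for p q x
    by (simp add: transport_def sum_divide_distrib vec.scale_sum_left)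
  have "(\<alpha> h g / \<alpha> m h / ?c) *s (b (matrix_inv h *v u) (matrix_inv h *v v) *s (m *v w - w))
      + (\<alpha> h g / \<alpha> m h / ?c) *s (b (matrix_inv h *v v) (matrix_inv h *v w) *s (m *v u - u))
      + (\<alpha> h g / \<alpha> m h / ?c) *s (b (matrix_inv h *v w) (matrix_inv h *v u) *s (m *v v - v)) = 0"
    if h: "h \<in> ?A" for h
  proof -
    have hG: "h \<in> G" and m: "m = h ** g ** matrix_inv h" using h by auto
    have mx: "m *v x - x = h *v (g *v (matrix_inv h *v x) - matrix_inv h *v x)" for x
      unfolding m using hG by (simp add: vec.diff matrix_vector_mul_assoc[symmetric])
    have "b (matrix_inv h *v u) (matrix_inv h *v v) *s (m *v w - w)
      + b (matrix_inv h *v v) (matrix_inv h *v w) *s (m *v u - u)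
      + b (matrix_inv h *v w) (matrix_inv h *v u) *s (m *v v - v)
      = h *v (b (matrix_inv h *v u) (matrix_inv h *v v) *s (g *v (matrix_inv h *v w) - matrix_inv h *v w)
      + b (matrix_inv h *v v) (matrix_inv h *v w) *s (g *v (matrix_inv h *v u) - matrix_inv h *v u)
      + b (matrix_inv h *v w) (matrix_inv h *v u) *s (g *v (matrix_inv h *v v) - matrix_inv h *v v))"
      unfolding mx by (simp only: vec.add vec.scale)
    also have "\<dots> = 0" unfolding jac by simp
    finally show ?thesis by (simp only: vec.scale_right_distrib[symmetric] vec.scale_zero_right)
  qed
  then show ?thesis
    unfolding t sum.distrib[symmetric] by (intro sum.neutral ballI)
qed

end

section \<open>Equivalence of the global condition with the criterion at \<open>g\<close>\<close>

theorem theorem2p10: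
  fixes G :: "(complex ^ 'n ^ 'n) set"
    and \<alpha> :: "complex ^ 'n ^ 'n \<Rightarrow> complex ^ 'n ^ 'n \<Rightarrow> complex"
    and g :: "complex ^ 'n ^ 'n"
    and ag :: "complex ^ 'n \<Rightarrow> complex ^ 'n \<Rightarrow> complex"
    and \<sigma> :: "('n list \<Rightarrow> complex) set \<Rightarrow> 'n list \<Rightarrow> complex"
    and H :: "complex ^ 'n \<Rightarrow> complex ^ 'n \<Rightarrow> complex"
  assumes "subgroup G GL" and "finite G"
    and "normalized_two_cocycle (GL\<lparr>carrier := G\<rparr>) \<alpha>"
    and "g \<in> G" and "g \<noteq> mat 1"
    and "skew_bilinear_form ag"
    and "graded_section \<sigma>"
    and "invariant_nondegenerate_hermitian G H"
  shows "(ag \<noteq> (\<lambda>v w. 0) \<and>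
          (\<exists>a. (\<forall>h \<in> G. skew_bilinear_form (a h)) \<and> a g = ag \<and>
               twisted_graded_hecke_algebra G \<alpha> a \<sigma>))
     \<longleftrightarrow> (form_kernel ag = fixed_space g \<and> codim (fixed_space g) = 2 \<and>
          (\<forall>h \<in> {h \<in> G. h ** g = g ** h}.
             det_on (orth_compl H (fixed_space g)) (perp_map H g h) = \<alpha> h g * inverse (\<alpha> g h)))"
    (is "?L \<longleftrightarrow> ?R")
proof
  interpret hermitian_group G \<alpha> H g
    by (intro hermitian_group.intro cocycle_group.intro hermitian_group_axioms.intro assms)
  note sk = \<open>skew_bilinear_form ag\<close>
  {
    assume ?L
    then obtain a where nz: "ag \<noteq> (\<lambda>v w. 0)" and a: "\<forall>h\<in>G. skew_bilinear_form (a h)" "a g = ag"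
      and tw: "twisted_graded_hecke_algebra G \<alpha> a \<sigma>" by blast
    interpret A: hecke_section G \<alpha> a \<sigma>
      using a
      by (intro hecke_section.intro hecke_forms.intro hecke_forms_axioms.intro graded_section_locale.intro
          cocycle_group_axioms assms) auto
    have eq: "A.equivariant" and jac: "A.jacobi" using tw A.twisted_iff by auto
    have E: "\<alpha> g h * ag (h *v v) (h *v w) = \<alpha> h g * ag v w" if h: "h \<in> G" "h ** g = g ** h" for h v w
    proof -
      have "h ** g ** matrix_inv h = g" using h conj_eq_iff by simp
      then show ?thesis using eq g h a(2) unfolding A.equivariant_def by metis
    qed
    have "form_kernel ag = fixed_space g \<and> codim (fixed_space g) = 2"
    proof (rule form_kernel_codim[OF sk nz assms(5)])
      \<comment> \<open>For \<open>h = g\<close> the two cocycle values in \<open>E\<close> coincide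
        and cancel.\<close>
      show "ag (g *v v) (g *v w) = ag v w" for v w using E[OF g refl, of v w] g by simp
      show "ag u v *s (g *v w - w) + ag v w *s (g *v u - u) + ag w u *s (g *v v - v) = 0" for u v w
        using jac g a(2) unfolding A.jacobi_def by blast
    qed
    then have K: "form_kernel ag = fixed_space g" "codim (fixed_space g) = 2" by auto
    \<comment> \<open>One pair with nonzero value suffices to read the determinant off from the two
      scaling rules.\<close>
    obtain v w where vw: "ag v w \<noteq> 0" using nz by (auto simp: fun_eq_iff)
    have "det_on W (perp_map H g h) = \<alpha> h g * inverse (\<alpha> g h)" if h: "h \<in> G" "h ** g = g ** h" for h
    proof -
      have "\<alpha> g h * (det_on W (perp_map H g h) * ag v w) = \<alpha> h g * ag v w"
        using E[OF h, of v w] unfolding form_det[OF sk K h] .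
      then have "\<alpha> g h * det_on W (perp_map H g h) = \<alpha> h g" using vw by simp
      then show ?thesis using h g by (simp add: field_simps)
    qed
    with K show ?R by blast
  next
    assume R: ?R
    then have K: "form_kernel ag = fixed_space g" "codim (fixed_space g) = 2" by auto
    have E: "ag (h *v v) (h *v w) = \<alpha> h g / \<alpha> g h * ag v w" if h: "h \<in> G" "h ** g = g ** h" for h v w
      unfolding form_det[OF sk K h] using R h by (simp add: divide_inverse)
    interpret A: hecke_section G \<alpha> "transport ag" \<sigma>
      by (intro hecke_section.intro hecke_forms.intro hecke_forms_axioms.intro graded_section_locale.intro
          cocycle_group_axioms assms skew_transport sk)
    have "A.equivariant"
      unfolding A.equivariant_def using transport_equivariant by blast
    moreover have "A.jacobi"
      unfolding A.jacobi_def using transport_jacobi[OF sk form_jacobi[OF sk K]] by blast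
    ultimately have "twisted_graded_hecke_algebra G \<alpha> (transport ag) \<sigma>" using A.twisted_iff by blast
    moreover have "transport ag g = ag" using E by (rule transport_self)
    moreover have "ag \<noteq> (\<lambda>v w. 0)"
    proof
      assume "ag = (\<lambda>v w. 0)"
      \<comment> \<open>The kernel of the zero form is the whole space, of codimension zero instead
        of two.\<close>
      then have "fixed_space g = UNIV" using K(1) by (auto simp: form_kernel_def)
      then show False using K(2) vec_dim_card[where ?'a = complex and ?'n = 'n] unfolding codim_def by simp
    qed
    ultimately show ?L using skew_transport[OF sk] by blast
  }
qed

end
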